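(* Let $A$ be an abelian group and let $\delta_D\in H_1(D,A)$, where $D$ runs over all diagrams of an oriented virtual knot $\mathcal K$, be an invariant normalized 1-cycle with values in $A$. Then the formula $$p^\delta_D(v)=D^l_v\cdot\delta_D,\qquad v\in\mathcal V(D),$$ defines an oriented parity $p^\delta$ with coefficients in $A$ on the diagrams of $\mathcal K$.
   Context: Diagrams. A virtual knot diagram $D$ is a generic oriented closed curve in the plane whose double points are marked classical (with over/under information) or virtual. A virtual knot $\mathcal K$ is a class of diagrams modulo isotopy, classical Reidemeister moves R1, R2, R3 and detour moves (replacing a path containing only virtual crossings by another path with the same ends containing only virtual crossings). $\mathcal V(D)$ is the set of classical crossings; $\mathcal A(D)$ is the set of arcs, i.e. pieces of $D$ between consecutive classical crossings (one closed arc if there are no classical crossings). A move $f\colon D\to D'$ induces a partial bijection $f_*\colon\mathcal V(D)\to\mathcal V(D')$ between surviving crossings. Arcs $a\in\mathcal A(D)$, $a'\in\mathcal A(D')$ are correspondent under a Reidemeister move if they share a point outside the region of the move; isotopies and detour moves induce a bijection of arcs. Local picture. Draw a classical crossing $v$ with both strands directed upward: the incoming arcs are SW, SE, the outgoing ones NW, NE, and the strands run SW$\to$NE and SE$\to$NW. The oriented smoothing at $v$ splits $D$ into the left half $D^l_v$ (leaving $v$ along NW, returning along SW) and the right half $D^r_v$ (leaving along NE, returning along SE). Chains. $C_1(D,A)$ is the group of $A$-linear combinations of arcs, i.e. 1-chains of the graph $\tilde D$ with vertices $\mathcal V(D)$ and edges $\mathcal A(D)$ oriented along $D$; $H_1(D,A)$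 is its subgroup of 1-cycles (at each crossing the sum of incoming values equals the sum of outgoing values). The graph $\tilde D$ is embedded in the closed oriented surface $AD(D)$ obtained by gluing discs to the boundary of the ribbon surface that is the (immersed) neighbourhood of $D$ (virtual crossings not being vertices). $C_1\cdot C_2$ denotes the intersection number in $AD(D)$, a transverse intersection counting $+1$ when (tangent of $C_1$, tangent of $C_2$) is positively oriented. $D$, $D^l_v$, $D^r_v$ are viewed as integral 1-cycles. Oriented parity. A family of maps $p_D\colon\mathcal V(D)\to A$ for all diagrams $D$ of $\mathcal K$ such that: (P0) $p_D(v)=p_{D'}(f_*(v))$ for every move $f\colon D\to D'$ and every $v$ for which $f_*(v)$ exists; (P1) $p_D(v)=0$ if $v$ disappears in a decreasing R1; (P2) $p_D(v_1)+p_D(v_2)=0$ if $v_1,v_2$ disappear in a decreasing R2; (P3+) $\sum_{i=1}^3\epsilon_\Delta(v_i)p_D(v_i)=0$ if $v_1,v_2,v_3$ are the vertices of the disappearing triangle $\Delta$ of an R3. Here $\epsilon_\Delta(v)=+1$ if $\Delta$ lies to the left or right of $v$ in the local picture (between SW and NW, or between SE and NE) and $-1$ if it lies above or below $v$. A family $\gamma_D\in C_1(D,A)$ is invariant if $\gamma_D(a)=\gamma_{D'}(a')$ for every move $D\to D'$ and all correspondent arcs $a,a'$. A cycle $\delta_D\in H_1(D,A)$ is normalized if $D\cdot\delta_D=0$. *)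

theory Defs
  imports "HOL-Analysis.Analysis"
begin

section \<open>Virtual knot diagrams\<close>

text \<open>
  A diagram is a closed curve in the oriented plane, parametrised by the unit circle (values of
  \<open>curve\<close> off the unit circle are irrelevant).  \<open>classical\<close> is the set of classical crossings, as
  points of the plane; all other double points are virtual.  For a classical crossing \<open>v\<close>,
  \<open>overpass v\<close> is the parameter at which the overcrossing strand runs through \<open>v\<close>.
\<close>

record vdiagram =
  curve :: "complex \<Rightarrow> complex"
  classical :: "complex set"
  overpass :: "complex \<Rightarrow> complex"

abbreviation circle :: "complex set" where
  "circle \<equiv> sphere 0 1"

definition tangent :: "vdiagram \<Rightarrow> complex \<Rightarrow> complex" where
  "tangent D x = vector_derivative (\<lambda>t. curve D (x * cis t)) (at 0)"

text \<open>Positive iff the pair \<open>(a, b)\<close> is a positively oriented basis of the plane.\<close>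

definition orient :: "complex \<Rightarrow> complex \<Rightarrow> real" where
  "orient a b = Re a * Im b - Im a * Re b"

definition double_points :: "vdiagram \<Rightarrow> complex set" where
  "double_points D = {v. \<exists>x\<in>circle. \<exists>y\<in>circle. x \<noteq> y \<and> curve D x = v \<and> curve D y = v}"

definition is_diagram :: "vdiagram \<Rightarrow> bool" where
  "is_diagram D \<longleftrightarrow>
     (\<lambda>t. curve D (cis t)) C1_differentiable_on UNIV \<and>
     (\<forall>x\<in>circle. tangent D x \<noteq> 0) \<and>
     finite (double_points D) \<and>
     (\<forall>x\<in>circle. \<forall>y\<in>circle. \<forall>z\<in>circle.
        curve D x = curve D y \<and> curve D y = curve D z \<longrightarrow> x = y \<or> y = z \<or> x = z) \<and>
     (\<forall>x\<in>circle. \<forall>y\<in>circle. x \<noteq> y \<and> curve D x = curve D y \<longrightarrow>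
        orient (tangent D x) (tangent D y) \<noteq> 0) \<and>
     classical D \<subseteq> double_points D \<and>
     (\<forall>v\<in>classical D. overpass D v \<in> circle \<and> curve D (overpass D v) = v)"

text \<open>
  Arcs are encoded by their (open) parameter sets.  Without classical crossings the whole circle
  is the only arc.
\<close>

definition arcs :: "vdiagram \<Rightarrow> complex set set" where
  "arcs D = components (circle - {x \<in> circle. curve D x \<in> classical D})"

definition arc_from :: "vdiagram \<Rightarrow> complex \<Rightarrow> complex set" where
  "arc_from D x = (THE a. a \<in> arcs D \<and> (\<forall>\<^sub>F t in at_right 0. x * cis t \<in> a))"

definition arc_into :: "vdiagram \<Rightarrow> complex \<Rightarrow> complex set" where
  "arc_into D x = (THE a. a \<in> arcs D \<and> (\<forall>\<^sub>F t in at_left 0. x * cis t \<in> a))"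

text \<open>
  With both strands at \<open>v\<close> directed upward, \<open>to_NE D v\<close> is the parameter at which the strand
  SW \<open>\<rightarrow>\<close> NE runs through \<open>v\<close>, and \<open>to_NW D v\<close> the one of the strand SE \<open>\<rightarrow>\<close> NW: the pair of
  tangents (towards NE, towards NW) is positively oriented.
\<close>

definition to_NE :: "vdiagram \<Rightarrow> complex \<Rightarrow> complex" where
  "to_NE D v = (THE x. x \<in> circle \<and> curve D x = v \<and>
     (\<exists>y\<in>circle. curve D y = v \<and> orient (tangent D x) (tangent D y) > 0))"

definition to_NW :: "vdiagram \<Rightarrow> complex \<Rightarrow> complex" where
  "to_NW D v = (THE y. y \<in> circle \<and> curve D y = v \<and>
     (\<exists>x\<in>circle. curve D x = v \<and> orient (tangent D x) (tangent D y) > 0))"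

definition arc_NE :: "vdiagram \<Rightarrow> complex \<Rightarrow> complex set" where
  "arc_NE D v = arc_from D (to_NE D v)"

definition arc_SW :: "vdiagram \<Rightarrow> complex \<Rightarrow> complex set" where
  "arc_SW D v = arc_into D (to_NE D v)"

definition arc_NW :: "vdiagram \<Rightarrow> complex \<Rightarrow> complex set" where
  "arc_NW D v = arc_from D (to_NW D v)"

definition arc_SE :: "vdiagram \<Rightarrow> complex \<Rightarrow> complex set" where
  "arc_SE D v = arc_into D (to_NW D v)"


section \<open>Chains, cycles and intersection numbers\<close>

definition chains :: "vdiagram \<Rightarrow> (complex set \<Rightarrow> 'a::ab_group_add) set" where
  "chains D = {c. \<forall>a. a \<notin> arcs D \<longrightarrow> c a = 0}"

definition cycles :: "vdiagram \<Rightarrow> (complex set \<Rightarrow> 'a::ab_group_add) set" where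
  "cycles D = {c \<in> chains D. \<forall>v\<in>classical D.
     c (arc_SW D v) + c (arc_SE D v) = c (arc_NW D v) + c (arc_NE D v)}"

text \<open>The diagram \<open>D\<close> itself as an integral 1-cycle.\<close>

definition diagram_cycle :: "vdiagram \<Rightarrow> complex set \<Rightarrow> int" where
  "diagram_cycle D a = (if a \<in> arcs D then 1 else 0)"

text \<open>The points met after leaving \<open>x\<close> and before first arriving at \<open>y\<close>, in the direction of the
  circle.\<close>

definition circle_path :: "complex \<Rightarrow> complex \<Rightarrow> complex set" where
  "circle_path x y = {x * cis t | t. t > 0 \<and> (\<forall>s. 0 < s \<and> s \<le> t \<longrightarrow> x * cis s \<noteq> y)}"

definition left_half :: "vdiagram \<Rightarrow> complex \<Rightarrow> complex set \<Rightarrow> int" where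
  "left_half D v a = (if a \<in> arcs D \<and> a \<subseteq> circle_path (to_NW D v) (to_NE D v) then 1 else 0)"

definition int_scale :: "int \<Rightarrow> 'a::ab_group_add \<Rightarrow> 'a" where
  "int_scale n x = (if n \<ge> 0 then ((\<lambda>y. x + y) ^^ nat n) 0 else - (((\<lambda>y. x + y) ^^ nat (- n)) 0))"

text \<open>
  The intersection number of the cycles \<open>c\<close> and \<open>d\<close> in the closed oriented surface obtained by
  capping off the ribbon neighbourhood of the diagram.  It is computed inside the ribbon
  neighbourhood: displace \<open>c\<close> slightly to the left of every arc.  Along the arcs the displaced cycle
  is disjoint from the graph.  Near a classical crossing \<open>v\<close>, where all four arcs point upward, the
  displacement is a small translation to the west, so the displaced copy of \<open>c\<close> meets \<open>d\<close>
  transversally in two points: its NE arc crosses the NW arc of \<open>d\<close>, with tangents (towards NE,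
  towards NW), hence with sign +1; its SE arc crosses the SW arc of \<open>d\<close>, with tangents (towards NW,
  towards NE), hence with sign -1.  (Virtual crossings are not vertices: there the neighbourhood is
  only immersed.)
\<close>

definition intersection_number ::
    "vdiagram \<Rightarrow> (complex set \<Rightarrow> int) \<Rightarrow> (complex set \<Rightarrow> 'a::ab_group_add) \<Rightarrow> 'a" where
  "intersection_number D c d =
     (\<Sum>v\<in>classical D. int_scale (c (arc_NE D v)) (d (arc_NW D v))
                      - int_scale (c (arc_SE D v)) (d (arc_SW D v)))"


section \<open>Isotopies\<close>

text \<open>A \<open>C\<^sup>1\<close> ambient isotopy of the plane, starting at the identity.\<close>

definition ambient_isotopy :: "(real \<Rightarrow> complex \<Rightarrow> complex) \<Rightarrow> bool" where
  "ambient_isotopy \<Phi> \<longleftrightarrow> \<Phi> 0 = id \<and>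
     (\<exists>\<Phi>' :: real \<Rightarrow> complex \<Rightarrow> complex \<Rightarrow>\<^sub>L complex.
        (\<forall>t\<in>{0..1}. bij (\<Phi> t) \<and>
           (\<forall>z. (\<Phi> t has_derivative blinfun_apply (\<Phi>' t z)) (at z) \<and>
                orient (\<Phi>' t z 1) (\<Phi>' t z \<i>) \<noteq> 0)) \<and>
        continuous_on ({0..1} \<times> UNIV) (\<lambda>(t, z). \<Phi> t z) \<and>
        continuous_on ({0..1} \<times> UNIV) (\<lambda>(t, z). \<Phi>' t z))"

text \<open>Orientation preserving changes of the parametrisation.\<close>

definition reparametrisation :: "(complex \<Rightarrow> complex) \<Rightarrow> bool" where
  "reparametrisation \<rho> \<longleftrightarrow>
     (\<exists>g g' :: real \<Rightarrow> real. continuous_on UNIV g' \<and>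
        (\<forall>t. (g has_real_derivative g' t) (at t) \<and> g' t > 0 \<and>
             g (t + 2 * pi) = g t + 2 * pi \<and> \<rho> (cis t) = cis (g t)))"


section \<open>Reidemeister moves\<close>

text \<open>Orientation preserving \<open>C\<^sup>1\<close> diffeomorphisms of the plane; they carry the standard pictures,
  drawn in the disc \<open>cball 0 2\<close>, to the region of a move.\<close>

definition plane_chart :: "(complex \<Rightarrow> complex) \<Rightarrow> bool" where
  "plane_chart h \<longleftrightarrow> bij h \<and>
     (\<exists>h' :: complex \<Rightarrow> complex \<Rightarrow>\<^sub>L complex. continuous_on UNIV h' \<and>
        (\<forall>z. (h has_derivative blinfun_apply (h' z)) (at z) \<and> orient (h' z 1) (h' z \<i>) > 0))"

text \<open>
  Inside the region \<open>h ` cball 0 2\<close> the diagram consists of \<open>n\<close> strands.  Strand \<open>k < n\<close> has the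
  parameters \<open>cis ` {a k..b k}\<close> and is, up to a change of parameter \<open>g\<close>, the image under \<open>h\<close> of the
  part of the model curve \<open>m k\<close> in the disc, with the direction of \<open>m k\<close> if \<open>\<sigma> k = 1\<close> and the
  opposite direction if \<open>\<sigma> k = -1\<close>.
\<close>

definition tangle ::
    "vdiagram \<Rightarrow> (complex \<Rightarrow> complex) \<Rightarrow> nat \<Rightarrow> (nat \<Rightarrow> real) \<Rightarrow> (nat \<Rightarrow> real) \<Rightarrow> (nat \<Rightarrow> real)
      \<Rightarrow> (nat \<Rightarrow> real \<Rightarrow> complex) \<Rightarrow> bool" where
  "tangle D h n a b \<sigma> m \<longleftrightarrow>
     plane_chart h \<and>
     (\<forall>k<n. a k < b k \<and> b k < a k + 2 * pi \<and> \<sigma> k \<in> {1, -1}) \<and>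
     (\<forall>j<n. \<forall>k<n. j \<noteq> k \<longrightarrow> cis ` {a j..b j} \<inter> cis ` {a k..b k} = {}) \<and>
     {x \<in> circle. curve D x \<in> h ` cball 0 2} = (\<Union>k<n. cis ` {a k..b k}) \<and>
     (\<forall>k<n. \<exists>g g'. g ` {a k..b k} = {s. m k s \<in> cball 0 2} \<and>
        (\<forall>t\<in>{a k..b k}. (g has_real_derivative g' t) (at t within {a k..b k}) \<and>
           \<sigma> k * g' t > 0 \<and> curve D (cis t) = h (m k (g t))))"

text \<open>The standard pictures: a nodal cubic, with node \<open>0\<close> at the parameters \<open>\<plusminus>1\<close>; a straight line;
  a parabola that meets the real axis in \<open>\<plusminus>1\<close> or not at all; three lines which bound a triangle
  centred at \<open>0\<close>, each of them passing \<open>0\<close> on one or on the other side.\<close>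

definition kink :: "real \<Rightarrow> complex" where
  "kink s = Complex (s ^ 3 - s) (s\<^sup>2 - 1)"

definition straight :: "real \<Rightarrow> complex" where
  "straight s = of_real s"

definition parabola :: "real \<Rightarrow> real \<Rightarrow> complex" where
  "parabola e s = Complex s (s\<^sup>2 + e)"

definition triangle_line :: "real \<Rightarrow> nat \<Rightarrow> real \<Rightarrow> complex" where
  "triangle_line e k s = cis (2 * pi * real k / 3) * Complex s (e / 2)"

definition same_outside :: "complex set \<Rightarrow> vdiagram \<Rightarrow> vdiagram \<Rightarrow> bool" where
  "same_outside U D D' \<longleftrightarrow>
     (\<forall>x\<in>circle. curve D x \<notin> U \<or> curve D' x \<notin> U \<longrightarrow> curve D x = curve D' x) \<and>
     classical D - U = classical D' - U \<and>
     (\<forall>v\<in>classical D - U. overpass D v = overpass D' v)"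

text \<open>\<open>decreasing_R1 U D D'\<close>: the decreasing first Reidemeister move in the region \<open>U\<close> turns
  \<open>D\<close> into \<open>D'\<close>.\<close>

definition decreasing_R1 :: "complex set \<Rightarrow> vdiagram \<Rightarrow> vdiagram \<Rightarrow> bool" where
  "decreasing_R1 U D D' \<longleftrightarrow> is_diagram D \<and> is_diagram D' \<and> same_outside U D D' \<and>
     double_points D \<inter> U \<subseteq> classical D \<and>
     (\<exists>h h' a b \<sigma>. U = h ` cball 0 2 \<and> U = h' ` cball 0 2 \<and>
        tangle D h 1 a b \<sigma> (\<lambda>_. kink) \<and> tangle D' h' 1 a b \<sigma> (\<lambda>_. straight))"

definition decreasing_R2 :: "complex set \<Rightarrow> vdiagram \<Rightarrow> vdiagram \<Rightarrow> bool" where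
  "decreasing_R2 U D D' \<longleftrightarrow> is_diagram D \<and> is_diagram D' \<and> same_outside U D D' \<and>
     double_points D \<inter> U \<subseteq> classical D \<and>
     (\<exists>h h' a b \<sigma>. U = h ` cball 0 2 \<and> U = h' ` cball 0 2 \<and>
        tangle D h 2 a b \<sigma> (\<lambda>k. if k = 0 then straight else parabola (-1)) \<and>
        tangle D' h' 2 a b \<sigma> (\<lambda>k. if k = 0 then straight else parabola 1) \<and>
        (\<exists>j<2. \<forall>v\<in>classical D \<inter> U. overpass D v \<in> cis ` {a j..b j}))"

text \<open>
  The third Reidemeister move; \<open>height\<close> orders the strands from bottom to top, in \<open>D\<close> as well as in
  \<open>D'\<close>.  The relation \<open>f\<close> matches the crossings of the triangle of \<open>D\<close> with those of \<open>D'\<close>: the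
  crossings of the same two strands correspond.  Rotation by \<open>\<pi>\<close> interchanges the two pictures, so
  the inverse of such a move is again of this form.
\<close>

definition R3 ::
    "complex set \<Rightarrow> vdiagram \<Rightarrow> vdiagram \<Rightarrow> (complex \<times> complex) set \<Rightarrow> bool" where
  "R3 U D D' f \<longleftrightarrow> is_diagram D \<and> is_diagram D' \<and> same_outside U D D' \<and>
     double_points D \<inter> U \<subseteq> classical D \<and> double_points D' \<inter> U \<subseteq> classical D' \<and>
     (\<exists>h h' a b \<sigma> (height :: nat \<Rightarrow> nat). U = h ` cball 0 2 \<and> U = h' ` cball 0 2 \<and>
        tangle D h 3 a b \<sigma> (triangle_line 1) \<and> tangle D' h' 3 a b \<sigma> (triangle_line (-1)) \<and>
        inj_on height {..<3} \<and>
        (\<forall>E\<in>{D, D'}. \<forall>i<3. \<forall>j<3. height i < height j \<longrightarrow>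
           (\<forall>v \<in> curve E ` cis ` {a i..b i} \<inter> curve E ` cis ` {a j..b j}.
              overpass E v \<in> cis ` {a j..b j})) \<and>
        f = {(v, v'). \<exists>i<3. \<exists>j<3. i \<noteq> j \<and>
              v \<in> curve D ` cis ` {a i..b i} \<inter> curve D ` cis ` {a j..b j} \<and>
              v' \<in> curve D' ` cis ` {a i..b i} \<inter> curve D' ` cis ` {a j..b j}})"

definition correspondent_arcs ::
    "complex set \<Rightarrow> vdiagram \<Rightarrow> vdiagram \<Rightarrow> (complex set \<times> complex set) set" where
  "correspondent_arcs U D D' =
     {(a, a'). a \<in> arcs D \<and> a' \<in> arcs D' \<and> (\<exists>x \<in> a \<inter> a'. curve D x \<notin> U)}"


section \<open>Moves and virtual knots\<close>

text \<open>
  \<open>move D D' f r\<close>: there is a move from \<open>D\<close> to \<open>D'\<close> for which \<open>f\<close> is (the graph of) the induced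
  partial bijection of classical crossings and \<open>r\<close> is the relation of correspondence of arcs.
  In \<open>detour\<close>, the path with the parameters \<open>cis ` {p<..<q}\<close> is replaced.
\<close>

inductive move ::
    "vdiagram \<Rightarrow> vdiagram \<Rightarrow> (complex \<times> complex) set \<Rightarrow> (complex set \<times> complex set) set \<Rightarrow> bool"
where
  isotopy:
    "\<lbrakk>is_diagram D; is_diagram D'; ambient_isotopy \<Phi>; reparametrisation \<rho>;
      \<forall>x\<in>circle. curve D' (\<rho> x) = \<Phi> 1 (curve D x);
      classical D' = \<Phi> 1 ` classical D;
      \<forall>v\<in>classical D. overpass D' (\<Phi> 1 v) = \<rho> (overpass D v)\<rbrakk>
     \<Longrightarrow> move D D' {(v, \<Phi> 1 v) | v. v \<in> classical D} {(a, \<rho> ` a) | a. a \<in> arcs D}"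
| detour:
    "\<lbrakk>is_diagram D; is_diagram D'; p < q; q < p + 2 * pi;
      \<forall>x \<in> circle - cis ` {p<..<q}. curve D' x = curve D x;
      \<forall>x \<in> cis ` {p<..<q}. curve D x \<notin> classical D \<and> curve D' x \<notin> classical D';
      classical D' = classical D;
      \<forall>v\<in>classical D. overpass D' v = overpass D v\<rbrakk>
     \<Longrightarrow> move D D' (Id_on (classical D)) (Id_on (arcs D))"
| R1_decreasing:
    "decreasing_R1 U D D' \<Longrightarrow> move D D' (Id_on (classical D - U)) (correspondent_arcs U D D')"
| R1_increasing:
    "decreasing_R1 U D' D \<Longrightarrow> move D D' (Id_on (classical D - U)) (correspondent_arcs U D D')"
| R2_decreasing:
    "decreasing_R2 U D D' \<Longrightarrow> move D D' (Id_on (classical D - U)) (correspondent_arcs U D D')"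
| R2_increasing:
    "decreasing_R2 U D' D \<Longrightarrow> move D D' (Id_on (classical D - U)) (correspondent_arcs U D D')"
| R3:
    "R3 U D D' f \<Longrightarrow> move D D' (Id_on (classical D - U) \<union> f) (correspondent_arcs U D D')"

definition is_virtual_knot :: "vdiagram set \<Rightarrow> bool" where
  "is_virtual_knot K \<longleftrightarrow>
     (\<exists>D0. is_diagram D0 \<and> K = {D. equivclp (\<lambda>D D'. \<exists>f r. move D D' f r) D0 D})"


section \<open>Invariant chains and oriented parities\<close>

definition invariant_chain ::
    "vdiagram set \<Rightarrow> (vdiagram \<Rightarrow> complex set \<Rightarrow> 'a::ab_group_add) \<Rightarrow> bool" where
  "invariant_chain K \<gamma> \<longleftrightarrow>
     (\<forall>D\<in>K. \<gamma> D \<in> chains D) \<and>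
     (\<forall>D\<in>K. \<forall>D'\<in>K. \<forall>f r. move D D' f r \<longrightarrow> (\<forall>(a, a')\<in>r. \<gamma> D a = \<gamma> D' a'))"

definition normalized :: "vdiagram \<Rightarrow> (complex set \<Rightarrow> 'a::ab_group_add) \<Rightarrow> bool" where
  "normalized D \<delta> \<longleftrightarrow> intersection_number D (diagram_cycle D) \<delta> = 0"

text \<open>
  For a triangle in the region \<open>U\<close>: the sides of the triangle are the arcs lying inside \<open>U\<close>.
  The triangle lies to the left or to the right of \<open>v\<close> if its two sides at \<open>v\<close> are SW and NW, or
  SE and NE.
\<close>

definition triangle_sign :: "complex set \<Rightarrow> vdiagram \<Rightarrow> complex \<Rightarrow> int" where
  "triangle_sign U D v =
     (let sides = {a \<in> arcs D. curve D ` a \<subseteq> U}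
      in if {arc_SW D v, arc_NW D v} \<subseteq> sides \<or> {arc_SE D v, arc_NE D v} \<subseteq> sides then 1 else -1)"

definition oriented_parity ::
    "vdiagram set \<Rightarrow> (vdiagram \<Rightarrow> complex \<Rightarrow> 'a::ab_group_add) \<Rightarrow> bool" where
  "oriented_parity K p \<longleftrightarrow>
     (\<forall>D\<in>K. \<forall>D'\<in>K. \<forall>f r. move D D' f r \<longrightarrow> (\<forall>(v, v')\<in>f. p D v = p D' v')) \<and>
     (\<forall>D\<in>K. \<forall>D'\<in>K. \<forall>U. decreasing_R1 U D D' \<longrightarrow> (\<forall>v\<in>classical D \<inter> U. p D v = 0)) \<and>
     (\<forall>D\<in>K. \<forall>D'\<in>K. \<forall>U. decreasing_R2 U D D' \<longrightarrow>
        (\<forall>v1 v2. v1 \<noteq> v2 \<and> classical D \<inter> U = {v1, v2} \<longrightarrow> p D v1 + p D v2 = 0)) \<and>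
     (\<forall>D\<in>K. \<forall>D'\<in>K. \<forall>U f. R3 U D D' f \<longrightarrow>
        (\<Sum>v\<in>classical D \<inter> U. int_scale (triangle_sign U D v) (p D v)) = 0)"

end

theory Submission
  imports Defs
begin

text \<open>
  Fix a diagram with a cycle \<open>d\<close>, and let \<open>I\<close> be a set of parameters on the circle.  The chain that
  is 1 along the parameters in \<open>I\<close>, pushed off to its left, meets \<open>d\<close> only near the crossings: at a
  crossing \<open>w\<close> whose strands run through the parameters \<open>x\<close> (towards NE) and \<open>y\<close> (towards NW) it picks
  up \<open>d(NW)\<close> if \<open>x \<in> I\<close> and \<open>- d(SW)\<close> if \<open>y \<in> I\<close>.  This contribution is called the flux of \<open>I\<close> at \<open>w\<close>.
  The parity of \<open>v\<close> is the sum of the fluxes of the path from \<open>y\<close> to \<open>x\<close> of \<open>v\<close> over all crossings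
  (lemma \<open>intersection_left_half\<close>), and the cycle is normalized if the fluxes of the whole circle add
  up to 0, so that complementary sets of parameters have opposite sums.  Only the cyclic order of the
  parameters, the orientation of the crossings and the values of \<open>d\<close> near the crossings matter.

  Isotopies and detours carry all these data over.  A Reidemeister move changes the diagram only along
  one, two or three strands; all other crossings contribute the same before and after it, since
  their arcs are correspondent.  It remains to compare the crossings inside the region.

  In the first two moves a strand has no crossing after the move, so \<open>d\<close> has the same value before and
  after the strand.  Hence the crossings that disappear contribute nothing to a path that contains
  their strands or misses them (\<open>R1_parity\<close>, \<open>R2_parity\<close>).  The left path of a kink is a loop without
  further crossings or else contains everything outside, and the left paths of the two crossings of a
  bigon are complementary outside; in each case the sum reduces to that of the whole circle.

  In the third move the values of \<open>d\<close> along the triangle are determined by the values at the starts of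
  the three strands and by three jumps at the corners.  The start values survive the move; the jumps
  change by a common constant, and the order of the two crossings on each strand is reversed.  Invariance
  then is an identity for each choice of the directions of the strands (\<open>triangle_flux_strands\<close>,
  \<open>triangle_flux_corner\<close>).  For the relation among the corners, let a path with negative sign be
  replaced by its complement, which changes the sign of its sum.  The three sets so obtained cover the
  circle outside the triangle evenly, once or twice according to the order in which the strands are
  passed, and by \<open>triangle_flux_sum\<close> inside the triangle their sum is the same multiple of the sum for
  the whole circle.  The latter is 0 (\<open>triangle_relation\<close>).
\<close>

section \<open>The circle and its cyclic order\<close>

lemma cis_eq_imp_eq:
  assumes "cis s = cis t" "\<bar>s - t\<bar> < 2 * pi"
  shows "s = t"
proof -
  have "cos s = cos t" "sin s = sin t"
    using assms(1) by (simp_all add: complex_eq_iff)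
  then obtain n :: int where n: "s = t + 2 * pi * n"
    using sin_cos_eq_iff by metis
  then have "2 * pi * \<bar>real_of_int n\<bar> < 2 * pi * 1"
    using assms(2) by (simp add: abs_mult)
  then have "\<bar>real_of_int n\<bar> < 1"
    by (subst (asm) mult_less_cancel_left_pos) auto
  then have "n = 0" by linarith
  then show ?thesis using n by simp
qed

lemma cis_plus_2pi [simp]: "cis (t + 2 * pi) = cis t"
  by (simp add: complex_eq_iff)

lemma cis_in_circle [simp]: "cis t \<in> circle"
  by simp

lemma circle_angle:
  assumes "x \<in> circle"
  obtains t where "0 \<le> t" "t < 2 * pi" "x = cis t"
proof -
  have "exp (\<i> * of_real (Arg2pi x)) = x"
    using assms complex_norm_eq_1_exp by simp
  then show ?thesis
    using that[of "Arg2pi x"] Arg2pi[of x] by (simp add: cis_conv_exp)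
qed

lemma circle_angle_from:
  assumes "x \<in> circle"
  obtains t where "s < t" "t \<le> s + 2 * pi" "x = cis t"
proof -
  have "x / cis s \<in> circle" using assms by (simp add: norm_divide)
  then obtain u where u: "0 \<le> u" "u < 2 * pi" "x / cis s = cis u"
    by (rule circle_angle)
  then have x: "x = cis (s + u)" by (simp add: cis_mult[symmetric] field_simps)
  show ?thesis
  proof (cases "u = 0")
    case True
    then show ?thesis using that[of "s + 2 * pi"] x by (simp add: complex_eq_iff)
  next
    case False
    then show ?thesis using that[of "s + u"] x u by simp
  qed
qed

lemma cis_in_image_iff:
  assumes "T \<subseteq> {s - 2 * pi<..<s + 2 * pi}"
  shows "cis s \<in> cis ` T \<longleftrightarrow> s \<in> T"
proof
  assume "cis s \<in> cis ` T"
  then obtain t where t: "t \<in> T" "cis s = cis t" by auto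
  then have "s = t" using assms by (intro cis_eq_imp_eq) (auto simp: abs_less_iff)
  then show "s \<in> T" using t by simp
qed simp

lemma circle_path_cis:
  assumes "s < t" "t \<le> s + 2 * pi"
  shows "circle_path (cis s) (cis t) = cis ` {s<..<t}"
proof (intro equalityI subsetI)
  fix z assume "z \<in> circle_path (cis s) (cis t)"
  then obtain u where u: "u > 0" "z = cis (s + u)"
    and avoid: "\<And>r. 0 < r \<Longrightarrow> r \<le> u \<Longrightarrow> cis (s + r) \<noteq> cis t"
    unfolding circle_path_def by (auto simp: cis_mult)
  have "u < t - s" using avoid[of "t - s"] assms by force
  then show "z \<in> cis ` {s<..<t}" using u by auto
next
  fix z assume "z \<in> cis ` {s<..<t}"
  then obtain u where u: "s < u" "u < t" "z = cis u" by auto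
  have "cis (s + r) \<noteq> cis t" if "0 < r" "r \<le> u - s" for r
  proof
    assume "cis (s + r) = cis t"
    then have "s + r = t" using that assms u by (intro cis_eq_imp_eq) auto
    then show False using that u by simp
  qed
  then show "z \<in> circle_path (cis s) (cis t)"
    using u by (auto simp: circle_path_def cis_mult intro!: exI[of _ "u - s"])
qed

text \<open>
  Cutting the circle at the angle 0 turns the cyclic order of its points into the linear order of
  their angles; statements about finitely many points become linear arithmetic.
\<close>

lemma circle_path_angle_iff:
  assumes "0 \<le> s" "s < 2 * pi" "0 \<le> t" "t < 2 * pi" "0 \<le> u" "u < 2 * pi"
    and "cis s \<noteq> cis t" "cis s \<noteq> cis u" "cis t \<noteq> cis u"
  shows "cis u \<in> circle_path (cis s) (cis t) \<longleftrightarrow> s < u \<and> u < t \<or> t < s \<and> s < u \<or> u < t \<and> t < s"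
proof (cases "s < t")
  case True
  have "s \<noteq> u" "t \<noteq> u" using assms by auto
  have "cis u \<in> cis ` {s<..<t} \<longleftrightarrow> u \<in> {s<..<t}"
    by (rule cis_in_image_iff) (use assms in auto)
  then show ?thesis using True circle_path_cis[of s t] assms \<open>s \<noteq> u\<close> \<open>t \<noteq> u\<close> by auto
next
  case False
  have neq: "s \<noteq> u" "t \<noteq> u" "s \<noteq> t" using assms by auto
  then have ts: "t < s" using False by simp
  have path: "circle_path (cis s) (cis t) = cis ` {s<..<t + 2 * pi}"
    using circle_path_cis[of s "t + 2 * pi"] ts assms by simp
  show ?thesis
  proof (cases "t < u")
    case True
    have "cis u \<in> cis ` {s<..<t + 2 * pi} \<longleftrightarrow> u \<in> {s<..<t + 2 * pi}"
      by (rule cis_in_image_iff) (use assms ts True neq in auto)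
    then show ?thesis using True path ts assms neq by auto
  next
    case False
    have "cis (u + 2 * pi) \<in> cis ` {s<..<t + 2 * pi}"
      using assms ts False neq by (intro imageI) auto
    then show ?thesis using False path ts assms neq by simp
  qed
qed

lemma circle_path_endpoints [simp]:
  assumes "x \<in> circle" "y \<in> circle"
  shows "y \<notin> circle_path x y" "x \<notin> circle_path x y"
proof -
  show "y \<notin> circle_path x y" by (auto simp: circle_path_def)
  obtain s where s: "x = cis s" using assms circle_angle by metis
  obtain t where t: "s < t" "t \<le> s + 2 * pi" "y = cis t"
    using assms circle_angle_from by metis
  have "cis s \<notin> cis ` {s<..<t}"
    by (subst cis_in_image_iff) (use t in auto)
  then show "x \<notin> circle_path x y" using s t circle_path_cis by simp
qed

lemma circle_path_rotate:
  assumes "x \<in> circle" "y \<in> circle" "z \<in> circle" "x \<noteq> y" "y \<noteq> z" "x \<noteq> z"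
  shows "y \<in> circle_path x z \<longleftrightarrow> z \<in> circle_path y x"
  using assms
  by (elim circle_angle) (simp add: circle_path_angle_iff, argo)

lemma circle_path_antisym:
  assumes "x \<in> circle" "y \<in> circle" "z \<in> circle" "x \<noteq> y" "y \<noteq> z" "x \<noteq> z"
  shows "y \<in> circle_path x z \<longleftrightarrow> y \<notin> circle_path z x"
proof -
  obtain a where a: "0 \<le> a" "a < 2 * pi" "x = cis a"
    using assms(1) by (rule circle_angle)
  obtain b where b: "0 \<le> b" "b < 2 * pi" "y = cis b"
    using assms(2) by (rule circle_angle)
  obtain c where c: "0 \<le> c" "c < 2 * pi" "z = cis c"
    using assms(3) by (rule circle_angle)
  have "a \<noteq> b" "b \<noteq> c" "a \<noteq> c"
    using assms(4-6) a b c by auto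
  with a b c show ?thesis
    using assms(4-6) by (simp add: circle_path_angle_iff) argo
qed

text \<open>
  This counts how often the paths between three strands cover a point off the strands.
\<close>

lemma circle_path_three:
  assumes "x \<in> circle" "y \<in> circle" "z \<in> circle" "w \<in> circle"
    and "x \<noteq> y" "y \<noteq> z" "x \<noteq> z" "w \<noteq> x" "w \<noteq> y" "w \<noteq> z"
    and "y \<in> circle_path x z"
  shows "w \<in> circle_path x y \<and> w \<notin> circle_path y z \<and> w \<notin> circle_path z x \<or>
         w \<notin> circle_path x y \<and> w \<in> circle_path y z \<and> w \<notin> circle_path z x \<or>
         w \<notin> circle_path x y \<and> w \<notin> circle_path y z \<and> w \<in> circle_path z x"
proof -
  obtain a where a: "0 \<le> a" "a < 2 * pi" "x = cis a"
    using assms(1) by (rule circle_angle)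
  obtain b where b: "0 \<le> b" "b < 2 * pi" "y = cis b"
    using assms(2) by (rule circle_angle)
  obtain c where c: "0 \<le> c" "c < 2 * pi" "z = cis c"
    using assms(3) by (rule circle_angle)
  obtain d where d: "0 \<le> d" "d < 2 * pi" "w = cis d"
    using assms(4) by (rule circle_angle)
  have "a \<noteq> b" "b \<noteq> c" "a \<noteq> c" "d \<noteq> a" "d \<noteq> b" "d \<noteq> c"
    using assms(5-10) a b c d by auto
  with a b c d show ?thesis
    using assms(5-11) by (simp add: circle_path_angle_iff) argo
qed

text \<open>
  With their ends added, the two paths between \<open>x\<close> and \<open>y\<close> are compact and cover the circle; they
  separate a set that avoids the ends.
\<close>

lemma circle_path_connected:
  assumes "x \<in> circle" "y \<in> circle" "x \<noteq> y"
    and "connected Z" "Z \<subseteq> circle" "x \<notin> Z" "y \<notin> Z" "z \<in> Z" "z' \<in> Z"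
  shows "z \<in> circle_path x y \<longleftrightarrow> z' \<in> circle_path x y"
proof -
  obtain s where s: "x = cis s" using assms circle_angle by metis
  obtain t where t: "s < t" "t \<le> s + 2 * pi" "y = cis t"
    using assms circle_angle_from by metis
  have "t \<noteq> s + 2 * pi" using assms s t by auto
  with t have t': "t < s + 2 * pi" by simp
  let ?A = "cis ` {s..t}" and ?B = "cis ` {t..s + 2 * pi}"
  have cont: "continuous_on T cis" for T by (intro continuous_intros)
  have "closed ?A" "closed ?B"
    by (auto intro!: compact_imp_closed compact_continuous_image cont)
  moreover have "Z \<subseteq> ?A \<union> ?B"
  proof
    fix w assume "w \<in> Z"
    then obtain u where "s < u" "u \<le> s + 2 * pi" "w = cis u"
      using assms(5) circle_angle_from[of w s] by blast
    then show "w \<in> ?A \<union> ?B" by (cases "u \<le> t") auto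
  qed
  moreover have AB: "w \<notin> ?B" if wA: "w \<in> ?A" and "w \<in> Z" for w
  proof
    assume "w \<in> ?B"
    obtain u where u: "u \<in> {s..t}" "w = cis u" using wA by blast
    obtain v where v: "v \<in> {t..s + 2 * pi}" "w = cis v" using \<open>w \<in> ?B\<close> by blast
    have "cis u \<noteq> x" "cis u \<noteq> y" using u(2) \<open>w \<in> Z\<close> \<open>x \<notin> Z\<close> \<open>y \<notin> Z\<close> by blast+
    then have ne: "u \<noteq> s" "u \<noteq> t" using s t(3) by blast+
    have "cis v = cis u" using u(2) v(2) by simp
    moreover have "\<bar>v - u\<bar> < 2 * pi" using u(1) v(1) ne by (auto simp: abs_less_iff)
    ultimately have "v = u" by (rule cis_eq_imp_eq)
    then show False using u(1) v(1) ne by auto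
  qed
  ultimately have "?A \<inter> Z = {} \<or> ?B \<inter> Z = {}"
    using connected_closedD[OF \<open>connected Z\<close>, of ?A ?B] by blast
  moreover have "w \<in> circle_path x y \<longleftrightarrow> w \<in> ?A" if "w \<in> Z" for w
  proof -
    have "circle_path x y = cis ` {s<..<t}" using s t circle_path_cis by simp
    moreover have "{s..t} = insert s (insert t {s<..<t})" using t by auto
    moreover have "w \<noteq> cis s" "w \<noteq> cis t" using that s t assms by auto
    ultimately show ?thesis by auto
  qed
  ultimately show ?thesis using \<open>z \<in> Z\<close> \<open>z' \<in> Z\<close> \<open>Z \<subseteq> ?A \<union> ?B\<close> by blast
qed

text \<open>
  By rotation each end of the path becomes the point whose membership is tested, and then
  \<open>circle_path_connected\<close> applies to it.
\<close>

lemma circle_path_move_endpoints: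
  assumes "connected S" "S \<subseteq> circle" "connected T" "T \<subseteq> circle" "S \<inter> T = {}"
    and "x \<in> S" "x' \<in> S" "y \<in> T" "y' \<in> T" "z \<in> circle" "z \<notin> S" "z \<notin> T"
  shows "z \<in> circle_path x y \<longleftrightarrow> z \<in> circle_path x' y'"
proof -
  have neq: "x \<noteq> y" "x' \<noteq> y" "x' \<noteq> y'" "z \<noteq> x" "z \<noteq> x'" "z \<noteq> y" "z \<noteq> y'"
    and circ: "x \<in> circle" "x' \<in> circle" "y \<in> circle" "y' \<in> circle"
    using assms by auto
  have "z \<in> circle_path x y \<longleftrightarrow> y \<in> circle_path z x"
    using circle_path_rotate[of x z y] neq circ assms by auto
  also have "\<dots> \<longleftrightarrow> x \<in> circle_path y z"
    using circle_path_rotate[of z y x] neq circ assms by auto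
  also have "\<dots> \<longleftrightarrow> x' \<in> circle_path y z"
    using circle_path_connected[of y z S x x'] assms neq circ by auto
  also have "\<dots> \<longleftrightarrow> z \<in> circle_path x' y"
    using circle_path_rotate[of y x' z] neq circ assms by auto
  also have "\<dots> \<longleftrightarrow> y \<in> circle_path z x'"
    using circle_path_rotate[of x' z y] neq circ assms by auto
  also have "\<dots> \<longleftrightarrow> y' \<in> circle_path z x'"
    using circle_path_connected[of z x' T y y'] assms neq circ by auto
  also have "\<dots> \<longleftrightarrow> x' \<in> circle_path y' z"
    using circle_path_rotate[of z y' x'] neq circ assms by auto
  also have "\<dots> \<longleftrightarrow> z \<in> circle_path x' y'"
    using circle_path_rotate[of y' x' z] neq circ assms by auto
  finally show ?thesis .
qed

text \<open>
  As long as the third point stays off an interval of angles shorter than a full turn, the cyclic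
  order of two points of the interval is the order of their angles.
\<close>

lemma circle_path_strand:
  assumes "a \<le> s" "s < t" "t \<le> b" "b < a + 2 * pi" "x \<in> circle" "x \<notin> cis ` {a..b}"
  shows "cis t \<in> circle_path (cis s) x" "cis s \<notin> circle_path (cis t) x"
    "cis s \<in> circle_path x (cis t)" "cis t \<notin> circle_path x (cis s)"
proof -
  have "cis (s + r) \<noteq> x" if "0 < r" "r \<le> t - s" for r
    using assms that by (metis (no_types, lifting) add.commute atLeastAtMost_iff imageI
        add_increasing2 le_diff_eq less_imp_le order_trans)
  then show 1: "cis t \<in> circle_path (cis s) x"
    using assms by (auto simp: circle_path_def cis_mult intro!: exI[of _ "t - s"])
  have neq: "cis s \<noteq> cis t" using cis_eq_imp_eq[of s t] assms by auto
  have x: "x \<noteq> cis s" "x \<noteq> cis t" using assms by auto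
  note [simp] = neq neq[symmetric] x x[symmetric] assms(5)
  show 2: "cis s \<in> circle_path x (cis t)"
    using 1 circle_path_rotate[of "cis s" "cis t" x] circle_path_rotate[of "cis t" x "cis s"]
      circle_path_rotate[of x "cis s" "cis t"] assms by auto
  show "cis s \<notin> circle_path (cis t) x"
    using 2 circle_path_antisym[of x "cis s" "cis t"] assms by auto
  show "cis t \<notin> circle_path x (cis s)"
    using 1 circle_path_antisym[of x "cis t" "cis s"] assms by auto
qed

lemma circle_path_strand_iff:
  assumes "s \<in> {a..b}" "t \<in> {a..b}" "s \<noteq> t" "b < a + 2 * pi" "x \<in> circle" "x \<notin> cis ` {a..b}"
  shows "cis t \<in> circle_path (cis s) x \<longleftrightarrow> s < t" "cis s \<in> circle_path x (cis t) \<longleftrightarrow> s < t"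
  using circle_path_strand[of a s t b x] circle_path_strand[of a t s b x] assms
  by (auto simp: neq_iff)

section \<open>Crossings and arcs of a diagram\<close>

definition crossing_parameters :: "vdiagram \<Rightarrow> complex set" where
  "crossing_parameters D = {x \<in> circle. curve D x \<in> classical D}"

lemma arcs_eq: "arcs D = components (circle - crossing_parameters D)"
  by (simp add: arcs_def crossing_parameters_def)

lemma orient_swap: "orient b a = - orient a b"
  by (simp add: orient_def)

lemma orient_scaleR: "orient (r *\<^sub>R a) (s *\<^sub>R b) = r * s * orient a b"
  by (simp add: orient_def algebra_simps)

text \<open>
  The factor is the determinant of \<open>f\<close>.
\<close>

lemma orient_linear:
  assumes "linear f"
  shows "orient (f a) (f b) = orient (f 1) (f \<i>) * orient a b"
proof -
  have "f z = Re z *\<^sub>R f 1 + Im z *\<^sub>R f \<i>" for z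
  proof -
    have "z = Re z *\<^sub>R 1 + Im z *\<^sub>R \<i>" by (simp add: complex_eq_iff)
    then have "f z = f (Re z *\<^sub>R 1 + Im z *\<^sub>R \<i>)" by simp
    then show ?thesis using assms by (simp add: linear_add linear_scale)
  qed
  then have "f a = Re a *\<^sub>R f 1 + Im a *\<^sub>R f \<i>" "f b = Re b *\<^sub>R f 1 + Im b *\<^sub>R f \<i>" by blast+
  then show ?thesis by (simp add: orient_def algebra_simps)
qed

lemma two_crossing_parameters:
  assumes "is_diagram D" "x \<in> circle" "y \<in> circle" "z \<in> circle" "x \<noteq> y"
    and "curve D x = curve D y" "curve D z = curve D y"
  shows "z = x \<or> z = y"
  using assms unfolding is_diagram_def by metis

text \<open>
  A diagram has no triple points, so no third parameter competes for the two roles.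
\<close>

lemma to_NE_to_NW_eqI:
  assumes "is_diagram D" "x \<in> circle" "y \<in> circle" "curve D x = v" "curve D y = v"
    and pos: "orient (tangent D x) (tangent D y) > 0"
  shows "to_NE D v = x" "to_NW D v = y"
proof -
  have neq: "x \<noteq> y" using pos by (auto simp: orient_def)
  have only: "z = x \<or> z = y" if "z \<in> circle" "curve D z = v" for z
    using two_crossing_parameters[OF assms(1-3) _ neq, of z] that assms by simp
  have neg: "\<not> orient (tangent D y) (tangent D x) > 0" and diag: "orient (tangent D z) (tangent D z) = 0" for z
    using pos orient_swap[of "tangent D x" "tangent D y"] by (linarith, simp add: orient_def)
  show "to_NE D v = x" unfolding to_NE_def
  proof (rule the_equality)
    show "x \<in> circle \<and> curve D x = v \<and> (\<exists>y\<in>circle. curve D y = v \<and> 0 < orient (tangent D x) (tangent D y))"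
      using assms by blast
  next
    fix z assume z: "z \<in> circle \<and> curve D z = v \<and> (\<exists>y\<in>circle. curve D y = v \<and> 0 < orient (tangent D z) (tangent D y))"
    then obtain z' where "z' \<in> circle" "curve D z' = v" "0 < orient (tangent D z) (tangent D z')"
      by blast
    then show "z = x" using only[of z] only[of z'] z neg diag by (metis less_irrefl)
  qed
  show "to_NW D v = y" unfolding to_NW_def
  proof (rule the_equality)
    show "y \<in> circle \<and> curve D y = v \<and> (\<exists>x\<in>circle. curve D x = v \<and> 0 < orient (tangent D x) (tangent D y))"
      using assms by blast
  next
    fix z assume z: "z \<in> circle \<and> curve D z = v \<and> (\<exists>x\<in>circle. curve D x = v \<and> 0 < orient (tangent D x) (tangent D z))"
    then obtain z' where "z' \<in> circle" "curve D z' = v" "0 < orient (tangent D z') (tangent D z)"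
      by blast
    then show "z = y" using only[of z] only[of z'] z neg diag by (metis less_irrefl)
  qed
qed

lemma classical_crossing:
  assumes "is_diagram D" "v \<in> classical D"
  shows "to_NE D v \<in> circle" "to_NW D v \<in> circle" "to_NE D v \<noteq> to_NW D v"
    "curve D (to_NE D v) = v" "curve D (to_NW D v) = v"
    "orient (tangent D (to_NE D v)) (tangent D (to_NW D v)) > 0"
proof -
  have "v \<in> double_points D" using assms unfolding is_diagram_def by blast
  then obtain x y where xy: "x \<in> circle" "y \<in> circle" "x \<noteq> y" "curve D x = v" "curve D y = v"
    unfolding double_points_def by blast
  then have "orient (tangent D x) (tangent D y) \<noteq> 0"
    using assms unfolding is_diagram_def by metis
  then have "orient (tangent D x) (tangent D y) > 0 \<or> orient (tangent D y) (tangent D x) > 0"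
    using orient_swap[of "tangent D x" "tangent D y"] by linarith
  then obtain x y where xy: "x \<in> circle" "y \<in> circle" "x \<noteq> y" "curve D x = v" "curve D y = v"
    and pos: "orient (tangent D x) (tangent D y) > 0"
    using xy by blast
  note eqs = to_NE_to_NW_eqI[OF assms(1) xy(1,2,4,5) pos]
  show "to_NE D v \<in> circle" "to_NW D v \<in> circle" "to_NE D v \<noteq> to_NW D v"
    "curve D (to_NE D v) = v" "curve D (to_NW D v) = v"
    "orient (tangent D (to_NE D v)) (tangent D (to_NW D v)) > 0"
    using xy pos unfolding eqs by simp_all
qed

lemma crossing_parameters_cases:
  assumes "is_diagram D" "x \<in> crossing_parameters D"
  shows "x = to_NE D (curve D x) \<or> x = to_NW D (curve D x)"
proof -
  have v: "curve D x \<in> classical D" "x \<in> circle"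
    using assms by (auto simp: crossing_parameters_def)
  note cr = classical_crossing[OF assms(1) v(1)]
  show ?thesis
    by (rule two_crossing_parameters[OF assms(1)]) (use cr v in auto)
qed

lemma to_NE_to_NW_crossing_parameters:
  assumes "is_diagram D" "v \<in> classical D"
  shows "to_NE D v \<in> crossing_parameters D" "to_NW D v \<in> crossing_parameters D"
  using classical_crossing[OF assms] assms(2) by (auto simp: crossing_parameters_def)

lemma finite_classical: "is_diagram D \<Longrightarrow> finite (classical D)"
  unfolding is_diagram_def using finite_subset by blast

lemma finite_crossing_parameters:
  assumes "is_diagram D" shows "finite (crossing_parameters D)"
proof (rule finite_subset)
  show "crossing_parameters D \<subseteq> to_NE D ` classical D \<union> to_NW D ` classical D"
    using crossing_parameters_cases[OF assms] by (auto simp: crossing_parameters_def)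
  show "finite (to_NE D ` classical D \<union> to_NW D ` classical D)"
    using finite_classical[OF assms] by simp
qed

lemma closed_avoids_near:
  assumes "closed S" "cis s \<notin> S"
  obtains e where "e > 0" "\<And>u. \<bar>u - s\<bar> < e \<Longrightarrow> cis u \<notin> S"
proof -
  have "open (cis -` (- S))"
    using assms by (intro open_vimage) (auto intro: continuous_intros)
  moreover have "s \<in> cis -` (- S)" using assms by simp
  ultimately obtain e where "e > 0" "\<And>u. dist u s < e \<Longrightarrow> u \<in> cis -` (- S)"
    unfolding open_dist by blast
  then show ?thesis using that[of e] by (auto simp: dist_real_def)
qed

lemma finite_avoids_near:
  assumes "finite F"
  obtains e where "e > 0" "\<And>u. u \<noteq> s \<Longrightarrow> \<bar>u - s\<bar> < e \<Longrightarrow> cis u \<notin> F"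
proof -
  obtain e where e: "e > 0" "\<And>u. \<bar>u - s\<bar> < e \<Longrightarrow> cis u \<notin> F - {cis s}"
    using closed_avoids_near[of "F - {cis s}" s] assms finite_imp_closed by blast
  have "cis u \<noteq> cis s" if "u \<noteq> s" "\<bar>u - s\<bar> < 2 * pi" for u
    using cis_eq_imp_eq that by blast
  then show ?thesis using that[of "min e (2 * pi)"] e by auto
qed

lemma arc_unique: "\<lbrakk>a \<in> arcs D; a' \<in> arcs D; z \<in> a; z \<in> a'\<rbrakk> \<Longrightarrow> a = a'"
  unfolding arcs_eq by (metis components_eq disjoint_iff)

lemma arc_connected: "a \<in> arcs D \<Longrightarrow> connected a"
  and arc_subset: "a \<in> arcs D \<Longrightarrow> a \<subseteq> circle - crossing_parameters D"
  unfolding arcs_eq by (auto simp: in_components_connected dest: in_components_subset)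

lemma connected_cis_image: "connected T \<Longrightarrow> connected (cis ` T)"
  by (intro connected_continuous_image continuous_intros)

lemma arc_containing:
  assumes "connected T" "T \<noteq> {}" "cis ` T \<inter> crossing_parameters D = {}"
  obtains a where "a \<in> arcs D" "cis ` T \<subseteq> a"
proof -
  have *: "cis ` T \<subseteq> circle - crossing_parameters D" using assms by auto
  obtain t where t: "t \<in> T" using assms by blast
  let ?a = "connected_component_set (circle - crossing_parameters D) (cis t)"
  have "?a \<in> arcs D" unfolding arcs_eq components_def using * t by blast
  moreover have "cis ` T \<subseteq> ?a"
    using * t assms connected_cis_image by (intro connected_component_maximal) auto
  ultimately show ?thesis using that by blast
qed

lemma arc_from_interval:
  assumes "s < t" "cis ` {s<..<t} \<inter> crossing_parameters D = {}"
  shows "arc_from D (cis s) \<in> arcs D" "cis ` {s<..<t} \<subseteq> arc_from D (cis s)"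
proof -
  obtain a where a: "a \<in> arcs D" "cis ` {s<..<t} \<subseteq> a"
    using arc_containing[of "{s<..<t}" D] assms by auto
  have ev: "\<forall>\<^sub>F r in at_right 0. cis s * cis r \<in> a"
    unfolding eventually_at_right_field cis_mult
    using assms a by (intro exI[of _ "t - s"]) (auto simp: image_subset_iff)
  have "arc_from D (cis s) = a" unfolding arc_from_def
  proof (rule the_equality)
    show "a \<in> arcs D \<and> (\<forall>\<^sub>F r in at_right 0. cis s * cis r \<in> a)" using a ev by simp
    fix b assume b: "b \<in> arcs D \<and> (\<forall>\<^sub>F r in at_right 0. cis s * cis r \<in> b)"
    then have "\<forall>\<^sub>F r in at_right 0. cis s * cis r \<in> a \<and> cis s * cis r \<in> b"
      using ev by (auto intro: eventually_conj)
    then obtain r where "cis s * cis r \<in> a \<and> cis s * cis r \<in> b"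
      using eventually_happens' trivial_limit_at_right_real by blast
    then show "b = a" using arc_unique a b by blast
  qed
  then show "arc_from D (cis s) \<in> arcs D" "cis ` {s<..<t} \<subseteq> arc_from D (cis s)" using a by auto
qed

lemma arc_into_interval:
  assumes "s < t" "cis ` {s<..<t} \<inter> crossing_parameters D = {}"
  shows "arc_into D (cis t) \<in> arcs D" "cis ` {s<..<t} \<subseteq> arc_into D (cis t)"
proof -
  obtain a where a: "a \<in> arcs D" "cis ` {s<..<t} \<subseteq> a"
    using arc_containing[of "{s<..<t}" D] assms by auto
  have ev: "\<forall>\<^sub>F r in at_left 0. cis t * cis r \<in> a"
    unfolding eventually_at_left_field cis_mult
    using assms a by (intro exI[of _ "s - t"]) (auto simp: image_subset_iff)
  have "arc_into D (cis t) = a" unfolding arc_into_def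
  proof (rule the_equality)
    show "a \<in> arcs D \<and> (\<forall>\<^sub>F r in at_left 0. cis t * cis r \<in> a)" using a ev by simp
    fix b assume b: "b \<in> arcs D \<and> (\<forall>\<^sub>F r in at_left 0. cis t * cis r \<in> b)"
    then have "\<forall>\<^sub>F r in at_left 0. cis t * cis r \<in> a \<and> cis t * cis r \<in> b"
      using ev by (auto intro: eventually_conj)
    then obtain r where "cis t * cis r \<in> a \<and> cis t * cis r \<in> b"
      using eventually_happens' trivial_limit_at_left_real by blast
    then show "b = a" using arc_unique a b by blast
  qed
  then show "arc_into D (cis t) \<in> arcs D" "cis ` {s<..<t} \<subseteq> arc_into D (cis t)" using a by auto
qed

lemma arc_from_eq_arc_into:
  assumes "s < t" "cis ` {s<..<t} \<inter> crossing_parameters D = {}"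
  shows "arc_from D (cis s) = arc_into D (cis t)"
proof -
  have "(s + t) / 2 \<in> {s<..<t}" using assms by (simp add: field_simps)
  then show ?thesis
    using arc_from_interval[OF assms] arc_into_interval[OF assms] arc_unique by blast
qed

lemma arc_from_eq_arc_into_same:
  assumes "is_diagram D" "cis s \<notin> crossing_parameters D"
  shows "arc_from D (cis s) = arc_into D (cis s)"
proof -
  obtain e where e: "e > 0" "\<And>u. u \<noteq> s \<Longrightarrow> \<bar>u - s\<bar> < e \<Longrightarrow> cis u \<notin> crossing_parameters D"
    using finite_avoids_near finite_crossing_parameters assms by blast
  have free: "cis u \<notin> crossing_parameters D" if "\<bar>u - s\<bar> < e" for u
    using that e assms(2) by (cases "u = s") auto
  have "arc_from D (cis (s - e)) = arc_into D (cis (s + e))"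
    "arc_from D (cis (s - e)) = arc_into D (cis s)"
    "arc_from D (cis s) = arc_into D (cis (s + e))"
    by (rule arc_from_eq_arc_into; use free e(1) in auto)+
  then show ?thesis by simp
qed

lemma arc_from_into_in_arcs:
  assumes "is_diagram D" "x \<in> circle"
  shows "arc_from D x \<in> arcs D" "arc_into D x \<in> arcs D"
proof -
  obtain s where s: "x = cis s" using assms circle_angle by metis
  obtain e where e: "e > 0" "\<And>u. u \<noteq> s \<Longrightarrow> \<bar>u - s\<bar> < e \<Longrightarrow> cis u \<notin> crossing_parameters D"
    using finite_avoids_near finite_crossing_parameters assms by blast
  show "arc_from D x \<in> arcs D"
    unfolding s by (rule arc_from_interval[of s "s + e"]) (use e in auto)
  show "arc_into D x \<in> arcs D"
    unfolding s by (rule arc_into_interval[of "s - e" s]) (use e in auto)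
qed

section \<open>The half cycle as an indicator function\<close>

text \<open>
  The contribution of \<open>w\<close> to the intersection number of a first cycle that is 1 along the parameters
  in \<open>I\<close> and 0 along the others.  Away from the ends of \<open>I\<close> the two arcs of a strand at \<open>w\<close> have the
  same coefficient, so that the parameter of the strand can stand for both.
\<close>

definition flux :: "vdiagram \<Rightarrow> (complex set \<Rightarrow> 'a::ab_group_add) \<Rightarrow> complex set \<Rightarrow> complex \<Rightarrow> 'a" where
  "flux D d I w = (if to_NE D w \<in> I then d (arc_NW D w) else 0)
                - (if to_NW D w \<in> I then d (arc_SW D w) else 0)"

abbreviation left_path :: "vdiagram \<Rightarrow> complex \<Rightarrow> complex set" where
  "left_path D v \<equiv> circle_path (to_NW D v) (to_NE D v)"

lemma int_scale_simps [simp]: "int_scale 1 x = x" "int_scale 0 x = 0" "int_scale (-1) x = - x"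
  by (simp_all add: int_scale_def)

lemma left_half_arc:
  assumes D: "is_diagram D" and v: "v \<in> classical D" and a: "a \<in> arcs D" "z \<in> a"
  shows "left_half D v a = (if z \<in> left_path D v then 1 else 0)"
proof -
  note cr = classical_crossing[OF D v]
  have sub: "a \<subseteq> circle" "to_NE D v \<notin> a" "to_NW D v \<notin> a"
    using arc_subset[OF a(1)] to_NE_to_NW_crossing_parameters[OF D v] by auto
  have "z' \<in> left_path D v \<longleftrightarrow> z \<in> left_path D v" if "z' \<in> a" for z'
    by (rule circle_path_connected[OF cr(2,1) cr(3)[symmetric] arc_connected[OF a(1)] sub(1,3,2) that a(2)])
  then have "a \<subseteq> left_path D v \<longleftrightarrow> z \<in> left_path D v" using a(2) by (meson subsetD subsetI)
  then show ?thesis using a(1) by (simp add: left_half_def)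
qed

text \<open>
  The indicator of the left path is locally constant off the two ends of the path.  The ends are not
  on the path, although the arc that leaves from its start and the arc that arrives at its end belong
  to the left half: these two arcs have to be excluded.
\<close>

lemma left_half_arc_from_into:
  assumes D: "is_diagram D" and v: "v \<in> classical D" and z: "z \<in> circle"
  shows "z \<noteq> to_NW D v \<Longrightarrow> left_half D v (arc_from D z) = (if z \<in> left_path D v then 1 else 0)"
    and "z \<noteq> to_NE D v \<Longrightarrow> left_half D v (arc_into D z) = (if z \<in> left_path D v then 1 else 0)"
proof -
  note cr = classical_crossing[OF D v]
  obtain s where s: "z = cis s" using z circle_angle by metis
  let ?X = "to_NE D v" and ?Y = "to_NW D v"
  obtain e where e: "e > 0"
    "\<And>u. u \<noteq> s \<Longrightarrow> \<bar>u - s\<bar> < e \<Longrightarrow> cis u \<notin> crossing_parameters D \<union> {?X, ?Y}"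
    using finite_avoids_near[of "crossing_parameters D \<union> {?X, ?Y}" s] finite_crossing_parameters[OF D]
    by auto
  have near: "cis u \<in> circle_path p q \<longleftrightarrow> z \<in> circle_path p q"
    if "{p, q} = {?X, ?Y}" "z \<notin> {p, q}" "\<bar>u - s\<bar> < e" for u p q
  proof -
    have avoid: "cis r \<notin> {p, q}" if "\<bar>r - s\<bar> < e" for r
      using e(2)[of r] that \<open>{p, q} = {?X, ?Y}\<close> \<open>z \<notin> {p, q}\<close> s by (cases "r = s") auto
    have pq: "p \<noteq> q" "p \<in> circle" "q \<in> circle"
      using that(1) cr by (auto simp: doubleton_eq_iff)
    let ?Z = "cis ` {s - e<..<s + e}"
    have "connected ?Z" by (rule connected_cis_image) simp
    moreover have "\<forall>r\<in>{s - e<..<s + e}. cis r \<notin> {p, q}" using avoid by (simp add: abs_less_iff)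
    then have "p \<notin> ?Z" "q \<notin> ?Z" by blast+
    moreover have "cis u \<in> ?Z" "z \<in> ?Z" using that(3) e(1) s by (auto simp: abs_less_iff)
    ultimately show ?thesis
      by (intro circle_path_connected[OF pq(2,3,1)]) auto
  qed
  have "cis ` {s<..<s + e} \<inter> crossing_parameters D = {}"
    "cis ` {s - e<..<s} \<inter> crossing_parameters D = {}"
    using e(2) by auto
  then have "cis ` {s<..<s + e} \<subseteq> arc_from D z" "cis ` {s - e<..<s} \<subseteq> arc_into D z"
    unfolding s using e(1) arc_from_interval(2)[of s "s + e" D] arc_into_interval(2)[of "s - e" s D]
    by simp_all
  moreover have "s + e / 2 \<in> {s<..<s + e}" "s - e / 2 \<in> {s - e<..<s}" using e(1) by auto
  ultimately have fr: "cis (s + e / 2) \<in> arc_from D z" and to: "cis (s - e / 2) \<in> arc_into D z"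
    by blast+
  have endp: "cis (s + e / 2) \<notin> {?X, ?Y}" "cis (s - e / 2) \<notin> {?X, ?Y}"
    using e(2)[of "s + e/2"] e(2)[of "s - e/2"] e(1) by auto
  { assume "z \<noteq> ?Y"
    have "cis (s + e / 2) \<in> circle_path ?Y ?X \<longleftrightarrow> z \<in> circle_path ?Y ?X"
    proof (cases "z = ?X")
      case True
      have "cis (s + r) \<noteq> ?Y" if "0 < r" "r \<le> e / 2" for r
        using e(2)[of "s + r"] e(1) that by auto
      then have "cis (s + e / 2) \<in> circle_path z ?Y"
        using e(1) s by (auto simp: circle_path_def cis_mult intro!: exI[of _ "e / 2"])
      then show ?thesis
        using circle_path_antisym[of ?X "cis (s + e / 2)" ?Y] cr endp True by auto
    next
      case False
      then show ?thesis using near[of ?Y ?X "s + e / 2"] \<open>z \<noteq> ?Y\<close> e(1) by auto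
    qed
    then show "left_half D v (arc_from D z) = (if z \<in> left_path D v then 1 else 0)"
      using left_half_arc[OF D v arc_from_into_in_arcs(1)[OF D z] fr] by simp }
  { assume "z \<noteq> ?X"
    have "cis (s - e / 2) \<in> circle_path ?Y ?X \<longleftrightarrow> z \<in> circle_path ?Y ?X"
    proof (cases "z = ?Y")
      case True
      have "cis (s - e / 2 + r) \<noteq> ?X" if "0 < r" "r \<le> e / 2" for r
        using e(2)[of "s - e / 2 + r"] e(1) that True s cr by (cases "r = e / 2") auto
      then have "z \<in> circle_path (cis (s - e / 2)) ?X"
        using e(1) s by (auto simp: circle_path_def cis_mult intro!: exI[of _ "e / 2"])
      then have "cis (s - e / 2) \<in> circle_path ?X ?Y"
        using circle_path_rotate[of ?X "cis (s - e / 2)" ?Y]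
          circle_path_rotate[of "cis (s - e / 2)" ?Y ?X] cr endp True by auto
      then show ?thesis
        using circle_path_antisym[of ?X "cis (s - e / 2)" ?Y] cr endp True by auto
    next
      case False
      then show ?thesis using near[of ?Y ?X "s - e / 2"] \<open>z \<noteq> ?X\<close> e(1) by auto
    qed
    then show "left_half D v (arc_into D z) = (if z \<in> left_path D v then 1 else 0)"
      using left_half_arc[OF D v arc_from_into_in_arcs(2)[OF D z] to] by simp }
qed

lemma crossing_points_distinct:
  assumes D: "is_diagram D" and "v \<in> classical D" "w \<in> classical D"
  shows "to_NE D v \<noteq> to_NW D w" "v \<noteq> w \<Longrightarrow> to_NE D v \<noteq> to_NE D w" "v \<noteq> w \<Longrightarrow> to_NW D v \<noteq> to_NW D w"
  using classical_crossing[OF D assms(2)] classical_crossing[OF D assms(3)] by metis+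

text \<open>
  The intersection number refers to the arc NE of \<open>w\<close>, which starts at the NE strand, and to the arc
  SE, which ends on the NW strand.  No parameter belongs to a NE strand and to a NW strand, so these are
  not the two excluded arcs, not even for \<open>w = v\<close>.
\<close>

lemma intersection_left_half:
  assumes D: "is_diagram D" and v: "v \<in> classical D"
  shows "intersection_number D (left_half D v) d = (\<Sum>w\<in>classical D. flux D d (left_path D v) w)"
  unfolding intersection_number_def
proof (rule sum.cong[OF refl])
  fix w assume w: "w \<in> classical D"
  have "left_half D v (arc_NE D w) = (if to_NE D w \<in> left_path D v then 1 else 0)"
    "left_half D v (arc_SE D w) = (if to_NW D w \<in> left_path D v then 1 else 0)"
    unfolding arc_NE_def arc_SE_def
    using left_half_arc_from_into[OF D v] classical_crossing[OF D w]
      crossing_points_distinct[OF D w v] crossing_points_distinct[OF D v w] by metis+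
  then show "int_scale (left_half D v (arc_NE D w)) (d (arc_NW D w)) -
    int_scale (left_half D v (arc_SE D w)) (d (arc_SW D w)) = flux D d (left_path D v) w"
    by (simp add: flux_def)
qed

lemma normalized_iff_flux:
  assumes D: "is_diagram D"
  shows "normalized D d \<longleftrightarrow> (\<Sum>w\<in>classical D. flux D d UNIV w) = 0"
proof -
  have "intersection_number D (diagram_cycle D) d = (\<Sum>w\<in>classical D. flux D d UNIV w)"
    unfolding intersection_number_def
  proof (rule sum.cong[OF refl])
    fix w assume w: "w \<in> classical D"
    then show "int_scale (diagram_cycle D (arc_NE D w)) (d (arc_NW D w)) -
      int_scale (diagram_cycle D (arc_SE D w)) (d (arc_SW D w)) = flux D d UNIV w"
      using arc_from_into_in_arcs[OF D] classical_crossing[OF D w]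
      by (simp add: flux_def diagram_cycle_def arc_NE_def arc_SE_def)
  qed
  then show ?thesis by (simp add: normalized_def)
qed

section \<open>Isotopies and detours\<close>

lemma curve_has_vector_derivative:
  assumes "is_diagram D"
  shows "((\<lambda>t. curve D (cis t)) has_vector_derivative tangent D (cis t)) (at t)"
proof -
  obtain d where d: "((\<lambda>t. curve D (cis t)) has_vector_derivative d) (at t)"
    using assms unfolding is_diagram_def C1_differentiable_on_def by blast
  have "((\<lambda>r::real. t + r) has_vector_derivative 1) (at 0)"
    by (auto intro!: derivative_eq_intros)
  then have "(((\<lambda>t. curve D (cis t)) \<circ> (\<lambda>r. t + r)) has_vector_derivative 1 *\<^sub>R d) (at 0)"
    by (rule vector_diff_chain_at) (use d in simp)
  then have "((\<lambda>r. curve D (cis t * cis r)) has_vector_derivative d) (at 0)"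
    by (simp add: o_def cis_mult)
  then have "tangent D (cis t) = d"
    unfolding tangent_def by (rule vector_derivative_at)
  then show ?thesis using d by simp
qed

text \<open>
  At the ends of a strand or of a replaced path only one side of the curve is known.
\<close>

lemma tangent_one_sided:
  assumes "is_diagram D" "a < b" "t \<in> {a..b}"
    and "((\<lambda>u. curve D (cis u)) has_vector_derivative d) (at t within {a..b})"
  shows "tangent D (cis t) = d"
proof -
  have "((\<lambda>u. curve D (cis u)) has_vector_derivative tangent D (cis t)) (at t within cbox a b)"
    using curve_has_vector_derivative[OF assms(1)] has_vector_derivative_at_within by blast
  then show ?thesis
    using vector_derivative_unique_within_closed_interval[of a b t] assms by simp
qed

lemma tangent_cong_interval:
  assumes "is_diagram D" "is_diagram D'" "a < b" "t \<in> {a..b}"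
    and eq: "\<And>u. u \<in> {a..b} \<Longrightarrow> curve D (cis u) = curve D' (cis u)"
  shows "tangent D (cis t) = tangent D' (cis t)"
proof (rule tangent_one_sided[OF assms(1,3,4)])
  have "((\<lambda>u. curve D' (cis u)) has_vector_derivative tangent D' (cis t)) (at t within {a..b})"
    using curve_has_vector_derivative[OF assms(2)] has_vector_derivative_at_within by blast
  then show "((\<lambda>u. curve D (cis u)) has_vector_derivative tangent D' (cis t)) (at t within {a..b})"
    by (rule has_vector_derivative_transform[OF assms(4), rotated]) (simp add: eq)
qed

text \<open>
  The determinant of the derivative is 1 at the start of the isotopy and never 0, so it stays positive.
\<close>

lemma ambient_isotopy_end:
  assumes "ambient_isotopy \<Phi>"
  obtains A where "bij (\<Phi> 1)" "\<And>z. (\<Phi> 1 has_derivative A z) (at z)"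
    "\<And>z. orient (A z 1) (A z \<i>) > 0"
proof -
  obtain \<Phi>' :: "real \<Rightarrow> complex \<Rightarrow> complex \<Rightarrow>\<^sub>L complex" where
    \<Phi>: "\<Phi> 0 = id" "\<And>t. t \<in> {0..1} \<Longrightarrow> bij (\<Phi> t)"
    "\<And>t z. t \<in> {0..1} \<Longrightarrow> (\<Phi> t has_derivative blinfun_apply (\<Phi>' t z)) (at z)"
    "\<And>t z. t \<in> {0..1} \<Longrightarrow> orient (\<Phi>' t z 1) (\<Phi>' t z \<i>) \<noteq> 0"
    and cont: "continuous_on ({0..1} \<times> UNIV) (\<lambda>(t, z). \<Phi>' t z)"
    using assms unfolding ambient_isotopy_def by blast
  have "orient (\<Phi>' 1 z 1) (\<Phi>' 1 z \<i>) > 0" for z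
  proof -
    let ?f = "\<lambda>t. orient (\<Phi>' t z 1) (\<Phi>' t z \<i>)"
    have "continuous_on {0..1} (\<lambda>t. (\<lambda>(t, z). \<Phi>' t z) (t, z))"
      by (rule continuous_on_compose2[OF cont]) (auto intro!: continuous_intros)
    then have c: "continuous_on {0..1} (\<lambda>t. \<Phi>' t z)" by simp
    have "continuous_on {0..1} ?f"
      unfolding orient_def by (intro continuous_intros c)
    then have "connected (?f ` {0..1})"
      by (rule connected_continuous_image) simp
    moreover have "0 \<notin> ?f ` {0..1}" using \<Phi>(4) by force
    moreover have "?f 0 = 1"
    proof -
      have "(id has_derivative blinfun_apply (\<Phi>' 0 z)) (at z)"
        using \<Phi>(1) \<Phi>(3)[of 0 z] by simp
      moreover have "(id has_derivative id) (at z)" by (rule has_derivative_id[unfolded id_def[symmetric]])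
      ultimately have "blinfun_apply (\<Phi>' 0 z) = id" by (rule has_derivative_unique)
      then show ?thesis by (simp add: orient_def)
    qed
    ultimately show ?thesis
      using connectedD_interval[of "?f ` {0..1}" "?f 1" "?f 0" 0] by fastforce
  qed
  then show ?thesis using that[of "\<lambda>z. blinfun_apply (\<Phi>' 1 z)"] \<Phi> by auto
qed

lemma crossing_parameters_subset: "crossing_parameters D \<subseteq> circle"
  by (auto simp: crossing_parameters_def)

lemma isCont_cis: "isCont cis t"
proof -
  have "continuous_on UNIV cis" by (intro continuous_intros)
  then show ?thesis using continuous_on_eq_continuous_at by blast
qed

text \<open>
  The lift \<open>g\<close> is strictly increasing and commutes with full turns.  Hence \<open>\<rho>\<close> is a homeomorphism
  of the circle that preserves the cyclic order.
\<close>

locale circle_reparametrisation =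
  fixes \<rho> :: "complex \<Rightarrow> complex" and g g' :: "real \<Rightarrow> real"
  assumes deriv: "(g has_real_derivative g' t) (at t)" and pos: "g' t > 0"
    and period: "g (t + 2 * pi) = g t + 2 * pi" and lift: "\<rho> (cis t) = cis (g t)"
begin

lemma strict_mono: "s < t \<Longrightarrow> g s < g t"
  by (rule DERIV_pos_imp_increasing) (use deriv pos in blast)+

lemma continuous: "continuous_on S g"
  using deriv by (meson DERIV_isCont continuous_at_imp_continuous_on)

lemma image_interval:
  assumes "s < t" shows "\<rho> ` cis ` {s<..<t} = cis ` {g s<..<g t}"
proof -
  have "g ` {s<..<t} = {g s<..<g t}"
  proof (intro equalityI subsetI)
    fix y assume y: "y \<in> {g s<..<g t}"
    then obtain x where x: "s \<le> x" "x \<le> t" "g x = y"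
      using IVT'[of g s y t] assms continuous by auto
    moreover have "x \<noteq> s" "x \<noteq> t" using x y by auto
    ultimately show "y \<in> g ` {s<..<t}" by force
  qed (use strict_mono in auto)
  then show ?thesis unfolding image_image lift by (metis image_image)
qed

lemma image_circle_path:
  assumes "x \<in> circle" "y \<in> circle"
  shows "\<rho> ` circle_path x y = circle_path (\<rho> x) (\<rho> y)"
proof -
  obtain s where s: "x = cis s" using assms circle_angle by metis
  obtain t where t: "s < t" "t \<le> s + 2 * pi" "y = cis t"
    using assms circle_angle_from by metis
  have "g s < g t" "g t \<le> g s + 2 * pi"
    using strict_mono[of s t] strict_mono[of t "s + 2 * pi"] t period[of s]
    by (cases "t = s + 2 * pi"; simp)+
  then show ?thesis using s t lift circle_path_cis image_interval by simp
qed

lemma inj_on_circle: "inj_on \<rho> circle"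
proof (rule inj_onI, rule ccontr)
  fix x y assume xy: "x \<in> circle" "y \<in> circle" "\<rho> x = \<rho> y" "x \<noteq> y"
  obtain s where s: "x = cis s" using xy circle_angle by metis
  obtain t where t: "s < t" "t \<le> s + 2 * pi" "y = cis t"
    using xy circle_angle_from by metis
  then have "t < s + 2 * pi" using xy s by (metis cis_plus_2pi order_le_less)
  then have "g s < g t" "g t < g s + 2 * pi"
    using strict_mono t period[of s] by metis+
  moreover have "cis (g s) = cis (g t)" using xy s t lift by simp
  ultimately show False using cis_eq_imp_eq[of "g s" "g t"] by auto
qed

lemma image_circle: "\<rho> ` circle = circle"
proof
  show "\<rho> ` circle \<subseteq> circle"
    by (metis cis_in_circle circle_angle image_subsetI lift)
  show "circle \<subseteq> \<rho> ` circle"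
  proof
    fix y assume "y \<in> circle"
    then obtain u where u: "g 0 < u" "u \<le> g 0 + 2 * pi" "y = cis u"
      using circle_angle_from by metis
    then obtain x where "g x = u"
      using IVT'[of g 0 u "2 * pi"] period[of 0] continuous by auto
    then show "y \<in> \<rho> ` circle" using u lift cis_in_circle by (metis imageI)
  qed
qed

lemma continuous_on_circle: "continuous_on circle \<rho>"
  unfolding continuous_on_eq_continuous_within
proof
  fix x assume "x \<in> circle"
  then obtain s where s: "x = cis s" using circle_angle by metis
  have eq: "\<rho> z = cis (g (s + Arg (z / cis s)))" if "z \<in> circle" for z
  proof -
    have "cis (Arg (z / cis s)) = z / cis s"
      using that by (subst cis_Arg) (auto simp: sgn_div_norm norm_divide)
    then have "z = cis (s + Arg (z / cis s))" by (simp add: cis_mult[symmetric])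
    then show ?thesis using lift by metis
  qed
  \<comment> \<open>near \<open>x\<close> the angle of \<open>z\<close> can be chosen as \<open>s + Arg (z / cis s)\<close>, which is continuous there\<close>
  have "isCont Arg (x / cis s)"
    by (rule continuous_at_Arg) (simp add: s)
  then have "isCont (\<lambda>z. Arg (z / cis s)) x"
    by (rule isCont_o2[rotated]) (auto intro!: continuous_intros)
  then have "isCont (\<lambda>z. s + Arg (z / cis s)) x"
    by (intro continuous_intros)
  moreover have "isCont g t" for t using deriv DERIV_isCont by blast
  ultimately have "isCont (\<lambda>z. g (s + Arg (z / cis s))) x"
    using isCont_o2 by blast
  then have "isCont (\<lambda>z. cis (g (s + Arg (z / cis s)))) x"
    by (rule isCont_o2) (rule isCont_cis)
  then have "continuous (at x within circle) (\<lambda>z. cis (g (s + Arg (z / cis s))))"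
    by (rule continuous_at_imp_continuous_within)
  then show "continuous (at x within circle) \<rho>"
    by (rule continuous_transform_within[where \<delta>=1]) (use eq \<open>x \<in> circle\<close> in auto)
qed

lemma image_arc:
  assumes "crossing_parameters D' = \<rho> ` crossing_parameters D" and a: "a \<in> arcs D"
  shows "\<rho> ` a \<in> arcs D'"
proof -
  obtain h where h: "homeomorphism circle circle \<rho> h"
    using homeomorphism_compact[OF _ continuous_on_circle image_circle inj_on_circle] by auto
  let ?S = "circle - crossing_parameters D" and ?S' = "circle - crossing_parameters D'"
  have "\<rho> ` ?S = ?S'"
    using inj_on_image_set_diff[OF inj_on_circle, of circle "crossing_parameters D"] image_circle assms(1)
      crossing_parameters_subset[of D] by auto
  then have hom: "homeomorphism ?S ?S' \<rho> h"
    by (intro homeomorphism_of_subsets[OF h, of _ "{}"]) auto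
  obtain x where x: "x \<in> ?S" "a = connected_component_set ?S x"
    using a unfolding arcs_eq components_def by blast
  have "\<rho> ` a = connected_component_set ?S' (\<rho> x)"
    using connected_component_set_homeomorphism[OF hom x(1)] x(2) by simp
  moreover have "\<rho> x \<in> ?S'" using x \<open>\<rho> ` ?S = ?S'\<close> by blast
  ultimately show ?thesis unfolding arcs_eq by (simp add: componentsI)
qed

lemma image_arc_from_into:
  assumes "is_diagram D" "x \<in> circle"
    and cp: "crossing_parameters D' = \<rho> ` crossing_parameters D"
  shows "arc_from D' (\<rho> x) = \<rho> ` arc_from D x" "arc_into D' (\<rho> x) = \<rho> ` arc_into D x"
proof -
  obtain s where s: "x = cis s" using assms circle_angle by metis
  obtain e where e: "e > 0" "\<And>u. u \<noteq> s \<Longrightarrow> \<bar>u - s\<bar> < e \<Longrightarrow> cis u \<notin> crossing_parameters D"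
    using finite_avoids_near finite_crossing_parameters assms by blast
  have free': "cis ` {g u<..<g v} \<inter> crossing_parameters D' = {}"
    if "u < v" "cis ` {u<..<v} \<inter> crossing_parameters D = {}" for u v
  proof -
    have "\<rho> ` (cis ` {u<..<v} \<inter> crossing_parameters D)
      = \<rho> ` cis ` {u<..<v} \<inter> \<rho> ` crossing_parameters D"
      by (rule inj_on_image_Int[OF inj_on_circle]) (auto simp: crossing_parameters_def)
    then show ?thesis using that image_interval[of u v] cp by simp
  qed
  have free: "cis ` {s<..<s + e} \<inter> crossing_parameters D = {}"
    "cis ` {s - e<..<s} \<inter> crossing_parameters D = {}"
    using e(2) by auto
  have mem: "cis (s + e / 2) \<in> cis ` {s<..<s + e}" "cis (s - e / 2) \<in> cis ` {s - e<..<s}"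
    using e(1) by auto
  { have "cis ` {s<..<s + e} \<subseteq> arc_from D x" "arc_from D x \<in> arcs D"
      unfolding s using arc_from_interval[of s "s + e" D] e(1) free by auto
    moreover have "cis ` {g s<..<g (s + e)} \<subseteq> arc_from D' (\<rho> x)" "arc_from D' (\<rho> x) \<in> arcs D'"
      unfolding s lift using arc_from_interval[of "g s" "g (s + e)" D'] e(1) free free' strict_mono
      by auto
    moreover have "\<rho> (cis (s + e / 2)) \<in> cis ` {g s<..<g (s + e)}"
      using mem e(1) image_interval[of s "s + e"] by (metis imageI less_add_same_cancel1)
    ultimately show "arc_from D' (\<rho> x) = \<rho> ` arc_from D x"
      using arc_unique[OF _ image_arc[OF cp]] mem by blast }
  { have "cis ` {s - e<..<s} \<subseteq> arc_into D x" "arc_into D x \<in> arcs D"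
      unfolding s using arc_into_interval[of "s - e" s D] e(1) free by auto
    moreover have "cis ` {g (s - e)<..<g s} \<subseteq> arc_into D' (\<rho> x)" "arc_into D' (\<rho> x) \<in> arcs D'"
      unfolding s lift using arc_into_interval[of "g (s - e)" "g s" D'] e(1) free free' strict_mono
      by auto
    moreover have "\<rho> (cis (s - e / 2)) \<in> cis ` {g (s - e)<..<g s}"
      using mem e(1) image_interval[of "s - e" s] by (metis imageI diff_less_eq less_add_same_cancel1)
    ultimately show "arc_into D' (\<rho> x) = \<rho> ` arc_into D x"
      using arc_unique[OF _ image_arc[OF cp]] mem by blast }
qed

end

text \<open>
  Both the end map of the isotopy and the change of parameter preserve orientations, so they carry NE
  and NW strands, left paths and arcs over; the two sums agree term by term.
\<close>

lemma isotopy_intersection: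
  assumes D: "is_diagram D" and D': "is_diagram D'"
    and iso: "ambient_isotopy \<Phi>" and rep: "reparametrisation \<rho>"
    and curve: "\<forall>x\<in>circle. curve D' (\<rho> x) = \<Phi> 1 (curve D x)"
    and classical: "classical D' = \<Phi> 1 ` classical D"
    and d: "\<And>a. a \<in> arcs D \<Longrightarrow> d a = d' (\<rho> ` a)"
    and v: "v \<in> classical D"
  shows "intersection_number D (left_half D v) d
       = intersection_number D' (left_half D' (\<Phi> 1 v)) d'"
proof -
  obtain A where bij: "bij (\<Phi> 1)" and A: "\<And>z. (\<Phi> 1 has_derivative A z) (at z)"
    "\<And>z. orient (A z 1) (A z \<i>) > 0"
    using ambient_isotopy_end[OF iso] by blast
  obtain g g' where "circle_reparametrisation \<rho> g g'"
    using rep unfolding reparametrisation_def circle_reparametrisation_def by blast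
  then interpret circle_reparametrisation \<rho> g g' .
  have inj: "\<Phi> 1 y = \<Phi> 1 z \<longleftrightarrow> y = z" for y z using bij by (metis bij_pointE)
  have mem: "\<rho> x \<in> circle" if "x \<in> circle" for x using image_circle that by blast
  have "x \<in> crossing_parameters D \<longleftrightarrow> \<rho> x \<in> crossing_parameters D'" if "x \<in> circle" for x
    using that curve classical inj mem by (auto simp: crossing_parameters_def)
  then have "\<rho> ` {x \<in> circle. x \<in> crossing_parameters D}
      = {x \<in> \<rho> ` circle. x \<in> crossing_parameters D'}"
    by blast
  then have cp: "crossing_parameters D' = \<rho> ` crossing_parameters D"
    unfolding image_circle crossing_parameters_def by simp
  have tangent: "\<exists>c>0. A (curve D x) (tangent D x) = c *\<^sub>R tangent D' (\<rho> x)" if x: "x \<in> circle" for x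
  proof -
    obtain t where t: "x = cis t" using x circle_angle by metis
    have "(g has_vector_derivative g' t) (at t)"
      using deriv by (simp add: has_real_derivative_iff_has_vector_derivative)
    then have "(((\<lambda>u. curve D' (cis u)) \<circ> g) has_vector_derivative g' t *\<^sub>R tangent D' (cis (g t))) (at t)"
      by (rule vector_diff_chain_at) (rule curve_has_vector_derivative[OF D'])
    moreover have "(\<lambda>u. curve D' (cis u)) \<circ> g = \<Phi> 1 \<circ> (\<lambda>u. curve D (cis u))"
      using curve lift by (auto simp: o_def) (metis cis_in_circle)
    moreover have "((\<Phi> 1 \<circ> (\<lambda>u. curve D (cis u))) has_vector_derivative
        A (curve D (cis t)) (tangent D (cis t))) (at t)"
      using vector_derivative_diff_chain_within[of "\<lambda>u. curve D (cis u)" _ t UNIV "\<Phi> 1"]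
        curve_has_vector_derivative[OF D, of t] A(1)[of "curve D (cis t)"]
      by (simp add: has_derivative_at_withinI)
    ultimately have "A (curve D (cis t)) (tangent D (cis t)) = g' t *\<^sub>R tangent D' (cis (g t))"
      using vector_derivative_unique_at by metis
    then show ?thesis using pos t lift by auto
  qed
  have NE: "to_NE D' (\<Phi> 1 w) = \<rho> (to_NE D w)" and NW: "to_NW D' (\<Phi> 1 w) = \<rho> (to_NW D w)"
    if w: "w \<in> classical D" for w
  proof -
    note cr = classical_crossing[OF D w]
    obtain c where c: "c > 0" "A w (tangent D (to_NE D w)) = c *\<^sub>R tangent D' (\<rho> (to_NE D w))"
      using tangent[OF cr(1)] cr(4) by auto
    obtain c' where c': "c' > 0" "A w (tangent D (to_NW D w)) = c' *\<^sub>R tangent D' (\<rho> (to_NW D w))"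
      using tangent[OF cr(2)] cr(5) by auto
    have "orient (A w (tangent D (to_NE D w))) (A w (tangent D (to_NW D w)))
      = orient (A w 1) (A w \<i>) * orient (tangent D (to_NE D w)) (tangent D (to_NW D w))"
      by (rule orient_linear) (rule has_derivative_linear[OF A(1)])
    also have "\<dots> > 0" by (rule mult_pos_pos[OF A(2) cr(6)])
    finally have "0 < orient (A w (tangent D (to_NE D w))) (A w (tangent D (to_NW D w)))" .
    then have "c * c' * orient (tangent D' (\<rho> (to_NE D w))) (tangent D' (\<rho> (to_NW D w))) > 0"
      unfolding c c' orient_scaleR .
    then have pos: "orient (tangent D' (\<rho> (to_NE D w))) (tangent D' (\<rho> (to_NW D w))) > 0"
      using mult_pos_pos[OF c(1) c'(1)] zero_less_mult_pos by blast
    have eq: "curve D' (\<rho> (to_NE D w)) = \<Phi> 1 w" "curve D' (\<rho> (to_NW D w)) = \<Phi> 1 w"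
      using curve cr by simp_all
    show "to_NE D' (\<Phi> 1 w) = \<rho> (to_NE D w)" "to_NW D' (\<Phi> 1 w) = \<rho> (to_NW D w)"
      by (rule to_NE_to_NW_eqI[OF D' mem[OF cr(1)] mem[OF cr(2)] eq pos])+
  qed
  note cv = classical_crossing[OF D v]
  have path: "left_path D' (\<Phi> 1 v) = \<rho> ` left_path D v"
    using NE[OF v] NW[OF v] image_circle_path cv by simp
  have path_mem: "\<rho> z \<in> left_path D' (\<Phi> 1 v) \<longleftrightarrow> z \<in> left_path D v" if "z \<in> circle" for z
  proof -
    have "left_path D v \<subseteq> circle" using cv by (auto simp: circle_path_def norm_mult)
    then show ?thesis
      unfolding path using inj_on_image_mem_iff[OF inj_on_circle that] by blast
  qed
  have flux: "flux D' d' (left_path D' (\<Phi> 1 v)) (\<Phi> 1 w) = flux D d (left_path D v) w"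
    if w: "w \<in> classical D" for w
    using classical_crossing[OF D w] image_arc_from_into[OF D _ cp] d arc_from_into_in_arcs[OF D]
    by (simp add: flux_def arc_NW_def arc_SW_def NE[OF w] NW[OF w] path_mem)
  have v': "\<Phi> 1 v \<in> classical D'" using v classical by simp
  have "inj_on (\<Phi> 1) (classical D)" using inj by (auto intro: inj_onI)
  then have "(\<Sum>w\<in>classical D'. flux D' d' (left_path D' (\<Phi> 1 v)) w)
    = (\<Sum>w\<in>classical D. flux D' d' (left_path D' (\<Phi> 1 v)) (\<Phi> 1 w))"
    unfolding classical by (simp add: sum.reindex)
  also have "\<dots> = (\<Sum>w\<in>classical D. flux D d (left_path D v) w)"
    by (rule sum.cong[OF refl flux])
  finally show ?thesis
    using intersection_left_half[OF D v] intersection_left_half[OF D' v'] by metis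
qed

text \<open>
  The crossings have the same parameters in both diagrams, and the same tangents there: even if the
  replaced path starts or ends at a classical crossing, the tangent is determined by the other side,
  which is unchanged.
\<close>

lemma detour_intersection:
  assumes D: "is_diagram D" and D': "is_diagram D'" and pq: "p < q" "q < p + 2 * pi"
    and curve: "\<forall>x \<in> circle - cis ` {p<..<q}. curve D' x = curve D x"
    and virt: "\<forall>x \<in> cis ` {p<..<q}. curve D x \<notin> classical D \<and> curve D' x \<notin> classical D'"
    and classical: "classical D' = classical D"
    and d: "\<And>a. a \<in> arcs D \<Longrightarrow> d a = d' a"
    and v: "v \<in> classical D"
  shows "intersection_number D (left_half D v) d = intersection_number D' (left_half D' v) d'"
proof -
  have "curve D' x \<in> classical D' \<longleftrightarrow> curve D x \<in> classical D" if "x \<in> circle" for x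
  proof (cases "x \<in> cis ` {p<..<q}")
    case True
    then show ?thesis using virt by metis
  next
    case False
    then have "curve D' x = curve D x" using curve that by blast
    then show ?thesis using classical by simp
  qed
  then have cp: "crossing_parameters D' = crossing_parameters D"
    unfolding crossing_parameters_def by blast
  have tangent: "tangent D' x = tangent D x" if x: "x \<in> circle" "x \<notin> cis ` {p<..<q}" for x
  proof -
    obtain t where t: "p < t" "t \<le> p + 2 * pi" "x = cis t"
      using circle_angle_from x(1) by metis
    then have "q \<le> t" using x(2) by force
    have "cis u \<notin> cis ` {p<..<q}" if "u \<in> {q..p + 2 * pi}" for u
      using that pq by (subst cis_in_image_iff) auto
    then show ?thesis
      unfolding t using tangent_cong_interval[OF D' D, of q "p + 2 * pi" t] curve pq t \<open>q \<le> t\<close> by auto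
  qed
  have same: "to_NE D' w = to_NE D w \<and> to_NW D' w = to_NW D w" if w: "w \<in> classical D" for w
  proof -
    note cr = classical_crossing[OF D w]
    have "to_NE D w \<notin> cis ` {p<..<q}" "to_NW D w \<notin> cis ` {p<..<q}"
      using virt cr(4,5) w by metis+
    then show ?thesis
      using to_NE_to_NW_eqI[OF D' cr(1,2), of w] cr curve tangent by simp
  qed
  have "arcs D' = arcs D" unfolding arcs_eq cp ..
  then have arc: "arc_from D' x = arc_from D x" "arc_into D' x = arc_into D x" for x
    unfolding arc_from_def arc_into_def by simp_all
  have "(\<Sum>w\<in>classical D'. flux D' d' (left_path D' v) w) = (\<Sum>w\<in>classical D. flux D d (left_path D v) w)"
  proof (rule sum.cong[OF classical])
    fix w assume w: "w \<in> classical D"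
    then show "flux D' d' (left_path D' v) w = flux D d (left_path D v) w"
      using same[OF w] same[OF v] arc d arc_from_into_in_arcs[OF D] classical_crossing[OF D w]
      by (simp add: flux_def arc_NW_def arc_SW_def)
  qed
  then show ?thesis
    using intersection_left_half[OF D v] intersection_left_half[OF D' v[folded classical]] by metis
qed

section \<open>Changes of a diagram inside a region\<close>

text \<open>
  The two diagrams differ only inside \<open>U\<close>.  The set \<open>S\<close> of the parameters of points in \<open>U\<close> is the same
  for both of them, and \<open>d\<close> and \<open>d'\<close> have equal values on correspondent arcs.
\<close>

locale region_change =
  fixes U :: "complex set" and D D' :: vdiagram and S :: "complex set"
    and d d' :: "complex set \<Rightarrow> 'a::ab_group_add"
  assumes D: "is_diagram D" and D': "is_diagram D'"
    and same: "same_outside U D D'"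
    and closed: "closed S"
    and inside: "{x \<in> circle. curve D x \<in> U} = S" and inside': "{x \<in> circle. curve D' x \<in> U} = S"
    and corr: "\<And>a a'. (a, a') \<in> correspondent_arcs U D D' \<Longrightarrow> d a = d' a'"
begin

lemma curve_eq: "x \<in> circle \<Longrightarrow> x \<notin> S \<Longrightarrow> curve D' x = curve D x"
  using same inside unfolding same_outside_def by (metis (mono_tags, lifting) mem_Collect_eq)

lemma classical_eq: "classical D' - U = classical D - U"
  using same unfolding same_outside_def by simp

lemma outside: "x \<in> circle \<Longrightarrow> x \<notin> S \<Longrightarrow> curve D x \<notin> U"
  using inside by blast

lemma tangent_eq:
  assumes "x \<in> circle" "x \<notin> S"
  shows "tangent D' x = tangent D x"
proof -
  obtain s where s: "x = cis s" using assms circle_angle by metis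
  obtain e where e: "e > 0" "\<And>u. \<bar>u - s\<bar> < e \<Longrightarrow> cis u \<notin> S"
    using closed_avoids_near closed assms s by metis
  show ?thesis unfolding s
    by (rule tangent_cong_interval[OF D' D, of "s - e / 2" "s + e / 2"])
      (use e curve_eq in \<open>auto simp: abs_less_iff\<close>)
qed

lemma crossing_outside:
  assumes "v \<in> classical D - U"
  shows "to_NE D v \<notin> S" "to_NW D v \<notin> S" "to_NE D' v = to_NE D v" "to_NW D' v = to_NW D v"
proof -
  note cr = classical_crossing[OF D, of v]
  show *: "to_NE D v \<notin> S" "to_NW D v \<notin> S" using cr assms inside by auto
  then show "to_NE D' v = to_NE D v" "to_NW D' v = to_NW D v"
    using to_NE_to_NW_eqI[OF D', of "to_NE D v" "to_NW D v" v] cr assms curve_eq tangent_eq by auto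
qed

text \<open>
  The two arcs share the points just after \<open>cis s\<close>, which are outside of the region.
\<close>

lemma arc_from_value:
  assumes "s < t" "cis ` {s<..<t} \<inter> S = {}"
  shows "d (arc_from D (cis s)) = d' (arc_from D' (cis s))"
proof -
  obtain e where e: "e > 0"
    "\<And>u. u \<noteq> s \<Longrightarrow> \<bar>u - s\<bar> < e \<Longrightarrow> cis u \<notin> crossing_parameters D \<union> crossing_parameters D'"
    using finite_avoids_near[of "crossing_parameters D \<union> crossing_parameters D'" s]
      finite_crossing_parameters[OF D] finite_crossing_parameters[OF D'] by auto
  let ?t = "min t (s + e)"
  have t: "s < ?t" using assms e by auto
  have free: "cis ` {s<..<?t} \<inter> crossing_parameters D = {}" "cis ` {s<..<?t} \<inter> crossing_parameters D' = {}"
    using e(2) by auto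
  define z where "z = cis ((s + ?t) / 2)"
  have mid: "(s + ?t) / 2 \<in> {s<..<?t}" using t by (auto simp: field_simps)
  then have "z \<in> arc_from D (cis s)" "z \<in> arc_from D' (cis s)"
    using arc_from_interval(2)[OF t free(1)] arc_from_interval(2)[OF t free(2)]
    unfolding z_def by blast+
  moreover have "z \<in> cis ` {s<..<t}"
    unfolding z_def using mid by (intro imageI) auto
  then have "z \<notin> S" using assms(2) by blast
  then have "curve D z \<notin> U" using outside by (simp add: z_def)
  ultimately show ?thesis
    using corr arc_from_interval(1)[OF t free(1)] arc_from_interval(1)[OF t free(2)]
    unfolding correspondent_arcs_def by blast
qed

lemma arc_into_value:
  assumes "s < t" "cis ` {s<..<t} \<inter> S = {}"
  shows "d (arc_into D (cis t)) = d' (arc_into D' (cis t))"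
proof -
  obtain e where e: "e > 0"
    "\<And>u. u \<noteq> t \<Longrightarrow> \<bar>u - t\<bar> < e \<Longrightarrow> cis u \<notin> crossing_parameters D \<union> crossing_parameters D'"
    using finite_avoids_near[of "crossing_parameters D \<union> crossing_parameters D'" t]
      finite_crossing_parameters[OF D] finite_crossing_parameters[OF D'] by auto
  let ?s = "max s (t - e)"
  have s: "?s < t" using assms e by auto
  have free: "cis ` {?s<..<t} \<inter> crossing_parameters D = {}" "cis ` {?s<..<t} \<inter> crossing_parameters D' = {}"
    using e(2) by auto
  define z where "z = cis ((?s + t) / 2)"
  have mid: "(?s + t) / 2 \<in> {?s<..<t}" using s by (auto simp: field_simps)
  then have "z \<in> arc_into D (cis t)" "z \<in> arc_into D' (cis t)"
    using arc_into_interval(2)[OF s free(1)] arc_into_interval(2)[OF s free(2)]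
    unfolding z_def by blast+
  moreover have "z \<in> cis ` {s<..<t}"
    unfolding z_def using mid by (intro imageI) auto
  then have "z \<notin> S" using assms(2) by blast
  then have "curve D z \<notin> U" using outside by (simp add: z_def)
  ultimately show ?thesis
    using corr arc_into_interval(1)[OF s free(1)] arc_into_interval(1)[OF s free(2)]
    unfolding correspondent_arcs_def by blast
qed

lemma arc_value_outside:
  assumes "x \<in> circle" "x \<notin> S"
  shows "d (arc_from D x) = d' (arc_from D' x)" "d (arc_into D x) = d' (arc_into D' x)"
proof -
  obtain s where s: "x = cis s" using assms circle_angle by metis
  obtain e where e: "e > 0" "\<And>u. \<bar>u - s\<bar> < e \<Longrightarrow> cis u \<notin> S"
    using closed_avoids_near closed assms s by metis
  have "cis ` {s<..<s + e} \<inter> S = {}" "cis ` {s - e<..<s} \<inter> S = {}" using e(2) by auto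
  then show "d (arc_from D x) = d' (arc_from D' x)" "d (arc_into D x) = d' (arc_into D' x)"
    unfolding s using arc_from_value[of s "s + e"] arc_into_value[of "s - e" s] e(1) by auto
qed

text \<open>
  A crossing outside of the region keeps its parameters and its tangents, and the arcs around it are
  correspondent.
\<close>

lemma outer_flux:
  assumes "\<And>z. z \<in> circle \<Longrightarrow> z \<notin> S \<Longrightarrow> z \<in> I \<longleftrightarrow> z \<in> I'"
  shows "(\<Sum>w\<in>classical D - U. flux D d I w) = (\<Sum>w\<in>classical D' - U. flux D' d' I' w)"
proof (rule sum.cong[OF classical_eq[symmetric]])
  fix w assume "w \<in> classical D' - U"
  then have w: "w \<in> classical D - U" using classical_eq by simp
  then have "w \<in> classical D" by simp
  note cr = classical_crossing[OF D this] crossing_outside[OF w]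
  show "flux D d I w = flux D' d' I' w"
    unfolding flux_def arc_NW_def arc_SW_def cr(9,10)
    using assms[OF cr(1,7)] assms[OF cr(2,8)] arc_value_outside[OF cr(2,8)] arc_value_outside[OF cr(1,7)]
    by simp
qed

end

lemma flux_sum_split:
  assumes "is_diagram D"
  shows "(\<Sum>w\<in>classical D. flux D d I w) = (\<Sum>w\<in>classical D - U. flux D d I w) + (\<Sum>w\<in>classical D \<inter> U. flux D d I w)"
  using sum.Int_Diff[OF finite_classical[OF assms], of "flux D d I" U] by (simp add: add.commute)

section \<open>Strands of a tangle\<close>

text \<open>
  In \<open>U\<close> the diagram is the image under \<open>h\<close> of the model curves \<open>m k\<close>, with tangents \<open>m' k\<close>.  The number
  \<open>q k s\<close> is the angle at which the diagram runs through the point \<open>h (m k s)\<close> of strand \<open>k\<close>; it grows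
  with \<open>s\<close> or decreases, according to the direction \<open>\<sigma> k\<close>.  The orientation of two strands at a common
  point can be read off from the models, because \<open>h\<close> preserves orientations.
\<close>

locale strands =
  fixes D :: vdiagram and U :: "complex set" and h :: "complex \<Rightarrow> complex" and n :: nat
    and a b \<sigma> :: "nat \<Rightarrow> real" and m m' :: "nat \<Rightarrow> real \<Rightarrow> complex" and q :: "nat \<Rightarrow> real \<Rightarrow> real"
  assumes D: "is_diagram D" and region: "U = h ` cball 0 2" and inj: "inj h"
    and ab: "\<And>k. k < n \<Longrightarrow> a k < b k" "\<And>k. k < n \<Longrightarrow> b k < a k + 2 * pi"
    and sgn: "\<And>k. k < n \<Longrightarrow> \<sigma> k = 1 \<or> \<sigma> k = -1"
    and disj: "\<And>j k. j < n \<Longrightarrow> k < n \<Longrightarrow> j \<noteq> k \<Longrightarrow> cis ` {a j..b j} \<inter> cis ` {a k..b k} = {}"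
    and inside: "{x \<in> circle. curve D x \<in> U} = (\<Union>k<n. cis ` {a k..b k})"
    and cont: "\<And>k s. k < n \<Longrightarrow> isCont (m k) s"
    and q_surj: "\<And>k t. k < n \<Longrightarrow> t \<in> {a k..b k} \<Longrightarrow> \<exists>s. m k s \<in> cball 0 2 \<and> q k s = t"
    and q_mem: "\<And>k s. k < n \<Longrightarrow> m k s \<in> cball 0 2 \<Longrightarrow> q k s \<in> {a k..b k}"
    and q_curve: "\<And>k s. k < n \<Longrightarrow> m k s \<in> cball 0 2 \<Longrightarrow> curve D (cis (q k s)) = h (m k s)"
    and q_mono: "\<And>k s s'. k < n \<Longrightarrow> \<sigma> k = 1 \<Longrightarrow> m k s \<in> cball 0 2 \<Longrightarrow> m k s' \<in> cball 0 2 \<Longrightarrow> s < s'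
      \<Longrightarrow> q k s < q k s'"
    and q_anti: "\<And>k s s'. k < n \<Longrightarrow> \<sigma> k = -1 \<Longrightarrow> m k s \<in> cball 0 2 \<Longrightarrow> m k s' \<in> cball 0 2 \<Longrightarrow> s < s'
      \<Longrightarrow> q k s' < q k s"
    and q_orient: "\<And>i j s s'. i < n \<Longrightarrow> j < n \<Longrightarrow> m i s \<in> cball 0 2 \<Longrightarrow> m i s = m j s' \<Longrightarrow>
      \<exists>\<kappa>>0. orient (tangent D (cis (q i s))) (tangent D (cis (q j s')))
        = \<kappa> * (\<sigma> i * \<sigma> j * orient (m' i s) (m' j s'))"

text \<open>
  The changes of parameter in \<open>tangle\<close> are strictly monotone by the mean value theorem; \<open>q k\<close> is the
  inverse.  In the last condition of \<open>strands\<close>, \<open>\<kappa>\<close> is the determinant of the derivative of the chart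
  times the absolute values of the two speeds.
\<close>

lemma tangle_strands:
  assumes D: "is_diagram D" and tangle: "tangle D h n a b \<sigma> m" and U: "U = h ` cball 0 2"
    and m': "\<And>k s. k < n \<Longrightarrow> (m k has_vector_derivative m' k s) (at s)"
  obtains q where "strands D U h n a b \<sigma> m m' q"
proof -
  have chart: "plane_chart h" using tangle unfolding tangle_def by simp
  then obtain h' :: "complex \<Rightarrow> complex \<Rightarrow>\<^sub>L complex" where h':
    "\<forall>z. (h has_derivative blinfun_apply (h' z)) (at z) \<and> orient (h' z 1) (h' z \<i>) > 0"
    unfolding plane_chart_def by (elim conjE exE) rule
  have h: "bij h" "\<And>z. (h has_derivative blinfun_apply (h' z)) (at z)"
    "\<And>z. orient (h' z 1) (h' z \<i>) > 0"
    using chart h' unfolding plane_chart_def by simp_all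
  define P where "P k g g' \<longleftrightarrow> g ` {a k..b k} = {s. m k s \<in> cball 0 2} \<and>
        (\<forall>t\<in>{a k..b k}. (g has_real_derivative g' t) (at t within {a k..b k}) \<and>
           \<sigma> k * g' t > 0 \<and> curve D (cis t) = h (m k (g t)))" for k and g g' :: "real \<Rightarrow> real"
  have "\<forall>k<n. \<exists>g g'. P k g g'"
    using tangle unfolding tangle_def P_def by (elim conjE)
  then obtain g g' where gg: "\<And>k. k < n \<Longrightarrow> P k (g k) (g' k)" by metis
  have g: "g k ` {a k..b k} = {s. m k s \<in> cball 0 2}" if "k < n" for k
    using gg that by (simp add: P_def)
  have g': "(g k has_real_derivative g' k t) (at t within {a k..b k})" "\<sigma> k * g' k t > 0"
    and gc: "curve D (cis t) = h (m k (g k t))"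
    if "k < n" "t \<in> {a k..b k}" for k t
    using gg that by (simp_all add: P_def)
  have ab: "a k < b k" "b k < a k + 2 * pi" "\<sigma> k = 1 \<or> \<sigma> k = -1" if "k < n" for k
    using tangle that unfolding tangle_def by auto
  have g_mono: "\<sigma> k * g k s < \<sigma> k * g k t" if "k < n" "s \<in> {a k..b k}" "t \<in> {a k..b k}" "s < t" for k s t
  proof -
    have "\<exists>x\<in>{s<..<t}. g k t - g k s = (\<lambda>y. g' k x * y) (t - s)"
    proof (rule mvt_simple[OF \<open>s < t\<close>])
      fix x assume x: "s \<le> x" "x \<le> t"
      have "(g k has_derivative (*) (g' k x)) (at x within {a k..b k})"
        using g'(1)[of k x] that x unfolding has_field_derivative_def by auto
      then show "(g k has_derivative (\<lambda>y. g' k x * y)) (at x within {s..t})"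
        by (rule has_derivative_subset) (use that in auto)
    qed
    then obtain x where x: "x \<in> {s<..<t}" "g k t - g k s = g' k x * (t - s)" by blast
    have "\<sigma> k * (g k t - g k s) = \<sigma> k * g' k x * (t - s)" using x by simp
    also have "\<dots> > 0" using g'(2)[of k x] that x by (intro mult_pos_pos[of "\<sigma> k * g' k x"]) auto
    finally show ?thesis by (simp add: algebra_simps)
  qed
  define q where "q k = inv_into {a k..b k} (g k)" for k
  have q: "q k s \<in> {a k..b k}" "g k (q k s) = s" if "k < n" "m k s \<in> cball 0 2" for k s
  proof -
    have "s \<in> g k ` {a k..b k}" using g that by blast
    then show "q k s \<in> {a k..b k}" "g k (q k s) = s"
      unfolding q_def by (rule inv_into_into, rule f_inv_into_f)
  qed
  have inj_g: "inj_on (g k) {a k..b k}" if "k < n" for k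
    by (rule linorder_inj_onI) (use g_mono that in force)+
  have q_less: "q k s < q k s'" if "k < n" "m k s \<in> cball 0 2" "m k s' \<in> cball 0 2" "\<sigma> k * s < \<sigma> k * s'" for k s s'
  proof (rule ccontr)
    assume "\<not> q k s < q k s'"
    then consider "q k s = q k s'" | "q k s' < q k s" by linarith
    then show False
    proof cases
      case 1
      then have "s = s'" using q(2)[of k s] q(2)[of k s'] that by metis
      then show False using that by simp
    next
      case 2
      then show False using g_mono[of k "q k s'" "q k s"] q[of k s] q[of k s'] that by simp
    qed
  qed
  have tangent: "tangent D (cis t) = g' k t *\<^sub>R h' (m k (g k t)) (m' k (g k t))"
    if k: "k < n" and t: "t \<in> {a k..b k}" for k t
  proof -
    have "(g k has_vector_derivative g' k t) (at t within {a k..b k})"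
      using g'(1)[OF k t] by (simp add: has_real_derivative_iff_has_vector_derivative)
    then have "((m k \<circ> g k) has_vector_derivative g' k t *\<^sub>R m' k (g k t)) (at t within {a k..b k})"
      by (rule vector_diff_chain_within) (use m'[OF k] has_vector_derivative_at_within in blast)
    then have "((h \<circ> (m k \<circ> g k)) has_vector_derivative h' ((m k \<circ> g k) t) (g' k t *\<^sub>R m' k (g k t)))
        (at t within {a k..b k})"
      by (rule vector_derivative_diff_chain_within) (use h(2) has_derivative_at_withinI in blast)
    then have "((\<lambda>u. curve D (cis u)) has_vector_derivative h' ((m k \<circ> g k) t) (g' k t *\<^sub>R m' k (g k t)))
        (at t within {a k..b k})"
      by (rule has_vector_derivative_transform[OF t, rotated]) (use gc k in simp)
    then show ?thesis
      using tangent_one_sided[OF D ab(1)[OF k] t] by (simp add: blinfun.scaleR_right)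
  qed
  have orient: "\<exists>\<kappa>>0. orient (tangent D (cis (q i s))) (tangent D (cis (q j s')))
        = \<kappa> * (\<sigma> i * \<sigma> j * orient (m' i s) (m' j s'))"
    if "i < n" "j < n" "m i s \<in> cball 0 2" and eq: "m i s = m j s'" for i j s s'
  proof -
    have mj: "m j s' \<in> cball 0 2" using that by simp
    let ?A = "blinfun_apply (h' (m i s))"
    let ?x = "\<sigma> i * g' i (q i s)" and ?y = "\<sigma> j * g' j (q j s')"
    have "orient (tangent D (cis (q i s))) (tangent D (cis (q j s')))
      = g' i (q i s) * g' j (q j s') * orient (?A (m' i s)) (?A (m' j s'))"
      using tangent[OF that(1) q(1)[OF that(1,3)]] tangent[OF that(2) q(1)[OF that(2) mj]]
        q(2)[OF that(1,3)] q(2)[OF that(2) mj] eq by (simp add: orient_scaleR)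
    also have "orient (?A (m' i s)) (?A (m' j s')) = orient (?A 1) (?A \<i>) * orient (m' i s) (m' j s')"
      by (rule orient_linear) (rule has_derivative_linear[OF h(2)])
    also have "g' i (q i s) * g' j (q j s') = ?x * ?y * (\<sigma> i * \<sigma> j)"
      using ab(3)[OF that(1)] ab(3)[OF that(2)] by auto
    finally have "orient (tangent D (cis (q i s))) (tangent D (cis (q j s')))
      = (?x * ?y * orient (?A 1) (?A \<i>)) * (\<sigma> i * \<sigma> j * orient (m' i s) (m' j s'))"
      by (simp only: mult_ac)
    moreover have "?x * ?y * orient (?A 1) (?A \<i>) > 0"
      by (rule mult_pos_pos[OF mult_pos_pos[OF g'(2)[OF that(1) q(1)[OF that(1,3)]]
            g'(2)[OF that(2) q(1)[OF that(2) mj]]] h(3)])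
    ultimately show ?thesis by blast
  qed
  have "strands D U h n a b \<sigma> m m' q"
  proof
    show "inj h" using h(1) by (rule bij_is_inj)
    show "{x \<in> circle. curve D x \<in> U} = (\<Union>k<n. cis ` {a k..b k})"
      "\<And>j k. j < n \<Longrightarrow> k < n \<Longrightarrow> j \<noteq> k \<Longrightarrow> cis ` {a j..b j} \<inter> cis ` {a k..b k} = {}"
      using tangle unfolding tangle_def U by blast+
    show "isCont (m k) s" if "k < n" for k s
      using m'[OF that] has_vector_derivative_continuous by blast
    show "\<exists>s. m k s \<in> cball 0 2 \<and> q k s = t" if "k < n" "t \<in> {a k..b k}" for k t
    proof (intro exI conjI)
      show "m k (g k t) \<in> cball 0 2" using g that by blast
      show "q k (g k t) = t" unfolding q_def using inv_into_f_f[OF inj_g] that by blast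
    qed
    show "curve D (cis (q k s)) = h (m k s)" if "k < n" "m k s \<in> cball 0 2" for k s
      using gc[OF that(1) q(1)[OF that]] q(2)[OF that] by simp
  qed (use D U ab q(1) q_less orient in auto)
  then show ?thesis using that by blast
qed

context strands
begin

abbreviation strand_parameters :: "complex set" where
  "strand_parameters \<equiv> (\<Union>k<n. cis ` {a k..b k})"

lemma closed_strand_parameters: "closed strand_parameters"
  by (intro closed_UN) (auto intro!: compact_imp_closed compact_continuous_image continuous_intros)

text \<open>
  The model parameter can be moved a little in both directions without leaving the disc.
\<close>

lemma strand_interior:
  assumes k: "k < n" and "norm (m k s) < 2"
  shows "a k < q k s" "q k s < b k"
proof -
  have "open (m k -` ball 0 2)"
    using cont[OF k] by (intro open_vimage) (auto simp: continuous_on_eq_continuous_at)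
  moreover have "s \<in> m k -` ball 0 2" using assms by simp
  ultimately obtain e where e: "e > 0" "\<And>u. dist u s < e \<Longrightarrow> u \<in> m k -` ball 0 2"
    unfolding open_dist by blast
  have mem: "m k s \<in> cball 0 2" "m k (s + e / 2) \<in> cball 0 2" "m k (s - e / 2) \<in> cball 0 2"
    using assms e(2)[of "s + e/2"] e(2)[of "s - e/2"] e(1) by (auto simp: dist_real_def)
  then have "q k s \<in> {a k..b k}" "q k (s + e/2) \<in> {a k..b k}" "q k (s - e/2) \<in> {a k..b k}"
    using q_mem[OF k] by blast+
  then show "a k < q k s" "q k s < b k"
    using sgn[OF k] e(1) mem q_mono[OF k, of s "s + e/2"] q_mono[OF k, of "s - e/2" s]
      q_anti[OF k, of s "s + e/2"] q_anti[OF k, of "s - e/2" s] by auto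
qed

lemma strand_point_eq_iff:
  assumes "i < n" "j < n" "m i s \<in> cball 0 2" "m j s' \<in> cball 0 2"
  shows "cis (q i s) = cis (q j s') \<longleftrightarrow> i = j \<and> s = s'"
proof
  assume eq: "cis (q i s) = cis (q j s')"
  have mem: "q i s \<in> {a i..b i}" "q j s' \<in> {a j..b j}" using q_mem assms by blast+
  then have ij: "i = j" using eq disj[OF assms(1,2)] by (metis disjoint_iff imageI)
  have "q i s = q j s'"
    by (rule cis_eq_imp_eq[OF eq]) (use mem ab(2)[OF assms(1)] ij in auto)
  then have "s = s'"
    using sgn[OF assms(1)] q_mono[of i s s'] q_mono[of i s' s] q_anti[of i s s'] q_anti[of i s' s] assms ij
    by (metis less_irrefl linorder_neqE_linordered_idom)
  with ij show "i = j \<and> s = s'" by simp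
qed auto

lemma strand_point:
  assumes "x \<in> circle" "curve D x \<in> U"
  obtains k s where "k < n" "m k s \<in> cball 0 2" "x = cis (q k s)"
proof -
  have "x \<in> strand_parameters" using assms inside by blast
  then obtain k t where k: "k < n" "t \<in> {a k..b k}" "x = cis t" by blast
  then show ?thesis using q_surj[OF k(1,2)] that by metis
qed

lemma strand_point_in:
  assumes "k < n" "m k s \<in> cball 0 2"
  shows "cis (q k s) \<in> strand_parameters" "cis (q k s) \<in> cis ` {a k..b k}" "curve D (cis (q k s)) \<in> U"
proof -
  show strand: "cis (q k s) \<in> cis ` {a k..b k}" using q_mem[OF assms] by blast
  show "cis (q k s) \<in> strand_parameters" using strand assms(1) by blast
  show "curve D (cis (q k s)) \<in> U" using q_curve[OF assms] assms region by auto
qed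

text \<open>
  Since the chart is injective, double points in the region come from double points of the models.
\<close>

lemma double_point_strands:
  assumes "v \<in> double_points D \<inter> U"
  obtains i j s s' where "i < n" "j < n" "(i, s) \<noteq> (j, s')" "m i s \<in> cball 0 2" "m i s = m j s'" "v = h (m i s)"
proof -
  obtain x y where xy: "x \<in> circle" "y \<in> circle" "x \<noteq> y" "curve D x = v" "curve D y = v" "v \<in> U"
    using assms unfolding double_points_def by blast
  obtain i s where i: "i < n" "m i s \<in> cball 0 2" "x = cis (q i s)"
    using strand_point[OF xy(1)] xy by metis
  obtain j s' where j: "j < n" "m j s' \<in> cball 0 2" "y = cis (q j s')"
    using strand_point[OF xy(2)] xy by metis
  have "h (m i s) = h (m j s')" using q_curve i j xy by metis
  then have "m i s = m j s'" using inj by (simp add: inj_eq)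
  then show ?thesis using that[of i j s s'] i j xy q_curve by auto
qed

lemma crossing_parameter_strands:
  assumes "k < n" "m k s \<in> cball 0 2" "cis (q k s) \<in> crossing_parameters D"
  obtains j s' where "j < n" "(j, s') \<noteq> (k, s)" "m j s' = m k s"
proof -
  let ?v = "curve D (cis (q k s))"
  have v: "?v \<in> classical D" using assms by (simp add: crossing_parameters_def)
  note cr = classical_crossing[OF D v]
  obtain y where y: "y \<in> circle" "curve D y = ?v" "y \<noteq> cis (q k s)"
    using cr by metis
  obtain j s' where j: "j < n" "m j s' \<in> cball 0 2" "y = cis (q j s')"
    using strand_point[OF y(1)] y(2) strand_point_in(3)[OF assms(1,2)] by metis
  have "h (m j s') = h (m k s)" using q_curve j y(2) assms by metis
  then have "m j s' = m k s" using inj by (simp add: inj_eq)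
  moreover have "(j, s') \<noteq> (k, s)" using j(3) y(3) by blast
  ultimately show ?thesis using that j(1) by blast
qed

lemma crossing_at:
  assumes double: "double_points D \<inter> U \<subseteq> classical D"
    and ij: "i < n" "j < n" and p: "p \<in> cball 0 2" "m i s = p" "m j s' = p"
    and pos: "\<sigma> i * \<sigma> j * orient (m' i s) (m' j s') > 0"
  shows "h p \<in> classical D \<inter> U" "to_NE D (h p) = cis (q i s)" "to_NW D (h p) = cis (q j s')"
proof -
  obtain \<kappa> where \<kappa>: "\<kappa> > 0" "orient (tangent D (cis (q i s))) (tangent D (cis (q j s')))
        = \<kappa> * (\<sigma> i * \<sigma> j * orient (m' i s) (m' j s'))"
    using q_orient[OF ij, of s s'] p by auto
  then have pos': "orient (tangent D (cis (q i s))) (tangent D (cis (q j s'))) > 0"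
    using pos by simp
  have c: "curve D (cis (q i s)) = h p" "curve D (cis (q j s')) = h p"
    using q_curve ij p by auto
  show "to_NE D (h p) = cis (q i s)" "to_NW D (h p) = cis (q j s')"
    by (rule to_NE_to_NW_eqI[OF D _ _ c pos']; simp)+
  have "cis (q i s) \<noteq> cis (q j s')" using pos' by (auto simp: orient_def)
  then have "h p \<in> double_points D" unfolding double_points_def using c by force
  moreover have "h p \<in> U" using region p by blast
  ultimately show "h p \<in> classical D \<inter> U" using double by blast
qed

text \<open>
  The strands are finitely many disjoint compact sets of parameters.
\<close>

lemma beyond_strand:
  assumes k: "k < n"
  obtains e where "e > 0" "cis ` {b k<..<b k + e} \<inter> strand_parameters = {}"
    "cis ` {a k - e<..<a k} \<inter> strand_parameters = {}"
proof -
  let ?T = "\<Union>j\<in>{..<n} - {k}. cis ` {a j..b j}"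
  have "closed ?T"
    by (intro closed_UN) (auto intro!: compact_imp_closed compact_continuous_image continuous_intros)
  moreover have "cis (b k) \<notin> ?T" "cis (a k) \<notin> ?T"
    using disj[OF _ k] ab(1)[OF k] by (fastforce simp: disjoint_iff)+
  ultimately have T: "closed ?T" "cis (b k) \<notin> ?T" "cis (a k) \<notin> ?T" by blast+
  obtain e1 where e1: "e1 > 0" "\<And>u. \<bar>u - b k\<bar> < e1 \<Longrightarrow> cis u \<notin> ?T"
    using closed_avoids_near[OF T(1,2)] by metis
  obtain e2 where e2: "e2 > 0" "\<And>u. \<bar>u - a k\<bar> < e2 \<Longrightarrow> cis u \<notin> ?T"
    using closed_avoids_near[OF T(1,3)] by metis
  define e where "e = min (min e1 e2) (a k + 2 * pi - b k)"
  have own: "cis u \<notin> cis ` {a k..b k}" if "u \<in> {b k<..<b k + e} \<union> {a k - e<..<a k}" for u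
    using that ab[OF k] by (subst cis_in_image_iff) (auto simp: e_def)
  have far: "cis u \<notin> strand_parameters" if "u \<in> {b k<..<b k + e} \<union> {a k - e<..<a k}" for u
  proof -
    have "\<bar>u - b k\<bar> < e1 \<or> \<bar>u - a k\<bar> < e2" using that by (auto simp: e_def abs_less_iff)
    then have "cis u \<notin> ?T" using e1(2) e2(2) by metis
    then show ?thesis using own[OF that] by blast
  qed
  have "e > 0" using e1(1) e2(1) ab[OF k] by (simp add: e_def)
  moreover have "cis ` {b k<..<b k + e} \<inter> strand_parameters = {}"
    "cis ` {a k - e<..<a k} \<inter> strand_parameters = {}"
    using far by blast+
  ultimately show ?thesis by (rule that)
qed

end

section \<open>Moves that change one tangle\<close>

lemma (in region_change) outer_flux_cong:
  assumes "\<And>z. z \<in> circle \<Longrightarrow> z \<notin> S \<Longrightarrow> z \<in> I \<longleftrightarrow> z \<in> I'"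
  shows "(\<Sum>w\<in>classical D - U. flux D d I w) = (\<Sum>w\<in>classical D - U. flux D d I' w)"
  using outer_flux[of I I', OF assms] outer_flux[of I' I'] by simp

lemma flux_empty [simp]: "flux D d {} w = 0"
  by (simp add: flux_def)

lemma flux_Compl: "flux D d I w + flux D d (- I) w = flux D d UNIV w"
  by (simp add: flux_def)

context strands
begin

lemma strand_without_crossings:
  assumes k: "k < n" and free: "\<And>u. m k u \<in> cball 0 2 \<Longrightarrow> cis (q k u) \<notin> crossing_parameters D"
  shows "arc_into D (cis (a k)) = arc_from D (cis (b k))"
proof -
  have not: "cis r \<notin> crossing_parameters D" if "r \<in> {a k..b k}" for r
    using q_surj[OF k that] free by blast
  have "cis ` {a k<..<b k} \<inter> crossing_parameters D = {}" using not by auto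
  then have "arc_from D (cis (a k)) = arc_into D (cis (b k))"
    by (rule arc_from_eq_arc_into[OF ab(1)[OF k]])
  then show ?thesis
    using arc_from_eq_arc_into_same[OF D not, of "a k"] arc_from_eq_arc_into_same[OF D not, of "b k"]
      ab(1)[OF k] by simp
qed

lemma strand_with_two_crossings:
  assumes k: "k < n" and int: "norm (m k s) < 2" "norm (m k s') < 2" and less: "q k s < q k s'"
    and only: "\<And>u. m k u \<in> cball 0 2 \<Longrightarrow> cis (q k u) \<in> crossing_parameters D \<Longrightarrow> u = s \<or> u = s'"
  shows "arc_into D (cis (a k)) = arc_into D (cis (q k s))"
    "arc_from D (cis (q k s)) = arc_into D (cis (q k s'))"
    "arc_from D (cis (q k s')) = arc_from D (cis (b k))"
proof -
  note pos = strand_interior[OF k int(1)] strand_interior[OF k int(2)]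
  have free: "cis r \<notin> crossing_parameters D" if r: "r \<in> {a k..b k}" "r \<noteq> q k s" "r \<noteq> q k s'" for r
    using q_surj[OF k r(1)] only r by blast
  have "cis ` {a k<..<q k s} \<inter> crossing_parameters D = {}"
    "cis ` {q k s<..<q k s'} \<inter> crossing_parameters D = {}"
    "cis ` {q k s'<..<b k} \<inter> crossing_parameters D = {}"
    using free pos less by auto
  note free3 = this
  have "arc_from D (cis (a k)) = arc_into D (cis (q k s))"
    "arc_from D (cis (q k s)) = arc_into D (cis (q k s'))"
    "arc_from D (cis (q k s')) = arc_into D (cis (b k))"
    by (rule arc_from_eq_arc_into[OF pos(1) free3(1)] arc_from_eq_arc_into[OF less free3(2)]
          arc_from_eq_arc_into[OF pos(4) free3(3)])+
  then show "arc_into D (cis (a k)) = arc_into D (cis (q k s))"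
    "arc_from D (cis (q k s)) = arc_into D (cis (q k s'))"
    "arc_from D (cis (q k s')) = arc_from D (cis (b k))"
    using arc_from_eq_arc_into_same[OF D free, of "a k"] arc_from_eq_arc_into_same[OF D free, of "b k"]
      ab(1)[OF k] pos less by auto
qed

end

text \<open>
  A Reidemeister move: the strands have the same parameters and directions before and after it, but
  different models.
\<close>

locale tangle_change =
  region_change U D D' "\<Union>k<n. cis ` {a k..b k}" d d' +
  old: strands D U h n a b \<sigma> m m' q + new: strands D' U h1 n a b \<sigma> m1 m1' q1
  for U D D' n a b and d d' :: "complex set \<Rightarrow> 'a::ab_group_add" and h \<sigma> m m' q h1 m1 m1' q1
begin

text \<open>
  Just before and just after a strand the diagram is outside of the region.
\<close>

lemma strand_ends:
  assumes "k < n"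
  shows "d (arc_into D (cis (a k))) = d' (arc_into D' (cis (a k)))"
    "d (arc_from D (cis (b k))) = d' (arc_from D' (cis (b k)))"
proof -
  obtain e where e: "e > 0" "cis ` {b k<..<b k + e} \<inter> old.strand_parameters = {}"
    "cis ` {a k - e<..<a k} \<inter> old.strand_parameters = {}"
    using old.beyond_strand[OF assms] by blast
  then show "d (arc_into D (cis (a k))) = d' (arc_into D' (cis (a k)))"
    "d (arc_from D (cis (b k))) = d' (arc_from D' (cis (b k)))"
    using arc_into_value[of "a k - e" "a k"] arc_from_value[of "b k" "b k + e"] by auto
qed

text \<open>
  If the point of \<open>s\<close> comes first, both arcs are the piece between the two crossings.  Otherwise they are
  the pieces of the strand after and before the crossings, which become parts of a single arc under the
  move.
\<close>

lemma strand_value_through: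
  assumes k: "k < n" and neq: "s \<noteq> s'" and int: "norm (m k s) < 2" "norm (m k s') < 2"
    and only: "\<And>u. m k u \<in> cball 0 2 \<Longrightarrow> cis (q k u) \<in> crossing_parameters D \<Longrightarrow> u = s \<or> u = s'"
    and none: "\<And>u. m1 k u \<in> cball 0 2 \<Longrightarrow> cis (q1 k u) \<notin> crossing_parameters D'"
  shows "d (arc_from D (cis (q k s))) = d (arc_into D (cis (q k s')))"
proof -
  have "cis (q k s) \<noteq> cis (q k s')" using old.strand_point_eq_iff[OF k k] int neq by auto
  then have "q k s \<noteq> q k s'" by auto
  then consider "q k s < q k s'" | "q k s' < q k s" by linarith
  then show ?thesis
  proof cases
    case 1
    show ?thesis using old.strand_with_two_crossings(2)[OF k int 1 only] by simp
  next
    case 2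
    have only': "\<And>u. m k u \<in> cball 0 2 \<Longrightarrow> cis (q k u) \<in> crossing_parameters D \<Longrightarrow> u = s' \<or> u = s"
      using only by blast
    show ?thesis
      using old.strand_with_two_crossings(1,3)[OF k int(2,1) 2 only']
        new.strand_without_crossings[OF k none] strand_ends[OF k] by simp
  qed
qed

lemma outer_crossing_path:
  assumes "v \<in> classical D - U"
  shows "left_path D' v = left_path D v"
    and "\<lbrakk>i < n; z \<in> cis ` {a i..b i}; z' \<in> cis ` {a i..b i}\<rbrakk> \<Longrightarrow>
      z \<in> left_path D v \<longleftrightarrow> z' \<in> left_path D v"
proof -
  have vD: "v \<in> classical D" using assms by blast
  note cr = classical_crossing[OF D vD] and out = crossing_outside[OF assms]
  show "left_path D' v = left_path D v" using out by simp
  assume i: "i < n" and z: "z \<in> cis ` {a i..b i}" "z' \<in> cis ` {a i..b i}"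
  have notin: "to_NW D v \<notin> cis ` {a i..b i}" "to_NE D v \<notin> cis ` {a i..b i}"
    using out(1,2) i by blast+
  have "connected (cis ` {a i..b i})" "cis ` {a i..b i} \<subseteq> circle"
    by (auto intro!: connected_cis_image)
  then show "z \<in> left_path D v \<longleftrightarrow> z' \<in> left_path D v"
    using circle_path_connected[OF cr(2,1) cr(3)[symmetric] _ _ notin z] by blast
qed

text \<open>
  The crossings outside of the region contribute equally to both sides.
\<close>

lemma intersection_eqI:
  assumes v: "v \<in> classical D" and v': "v' \<in> classical D'"
    and outer: "\<And>z. z \<in> circle \<Longrightarrow> z \<notin> old.strand_parameters \<Longrightarrow> z \<in> left_path D v \<longleftrightarrow> z \<in> left_path D' v'"
    and inner: "(\<Sum>w\<in>classical D \<inter> U. flux D d (left_path D v) w)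
      = (\<Sum>w\<in>classical D' \<inter> U. flux D' d' (left_path D' v') w)"
  shows "intersection_number D (left_half D v) d = intersection_number D' (left_half D' v') d'"
  unfolding intersection_left_half[OF D v] intersection_left_half[OF D' v']
    flux_sum_split[OF D, of d _ U] flux_sum_split[OF D', of d' _ U]
  using outer_flux[OF outer] inner by simp

end

lemma tangle_changeI:
  assumes D: "is_diagram D" "is_diagram D'" and same: "same_outside U D D'"
    and U: "U = h ` cball 0 2" "U = h1 ` cball 0 2"
    and t: "tangle D h n a b \<sigma> m" "tangle D' h1 n a b \<sigma> m1"
    and m': "\<And>k s. k < n \<Longrightarrow> (m k has_vector_derivative m' k s) (at s)"
      "\<And>k s. k < n \<Longrightarrow> (m1 k has_vector_derivative m1' k s) (at s)"
    and corr: "\<And>a a'. (a, a') \<in> correspondent_arcs U D D' \<Longrightarrow> d a = d' a'"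
  obtains q q1 where "tangle_change U D D' n a b d d' h \<sigma> m m' q h1 m1 m1' q1"
proof -
  obtain q where q: "strands D U h n a b \<sigma> m m' q"
    using tangle_strands[OF D(1) t(1) U(1) m'(1)] by blast
  obtain q1 where q1: "strands D' U h1 n a b \<sigma> m1 m1' q1"
    using tangle_strands[OF D(2) t(2) U(2) m'(2)] by blast
  have "region_change U D D' (\<Union>k<n. cis ` {a k..b k}) d d'"
    using D same strands.closed_strand_parameters[OF q] strands.inside[OF q] strands.inside[OF q1] corr
    by unfold_locales auto
  then show ?thesis using that q q1 unfolding tangle_change_def by blast
qed

section \<open>The first Reidemeister move\<close>

definition kink_tangent :: "real \<Rightarrow> complex" where
  "kink_tangent s = Complex (3 * s\<^sup>2 - 1) (2 * s)"

lemma has_vector_derivative_Complex: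
  assumes "(f has_real_derivative f') (at s)" "(g has_real_derivative g') (at s)"
  shows "((\<lambda>s. Complex (f s) (g s)) has_vector_derivative Complex f' g') (at s)"
proof -
  have "((\<lambda>s. of_real (f s) + \<i> * of_real (g s)) has_vector_derivative of_real f' + \<i> * of_real g') (at s)"
    by (intro has_vector_derivative_add has_vector_derivative_mult_right has_vector_derivative_of_real)
      (use assms in \<open>simp_all add: has_real_derivative_iff_has_vector_derivative\<close>)
  then show ?thesis by (simp add: Complex_eq)
qed

lemma kink_deriv: "(kink has_vector_derivative kink_tangent s) (at s)"
  unfolding kink_def kink_tangent_def
  by (rule has_vector_derivative_Complex) (auto intro!: derivative_eq_intros)

lemma straight_deriv: "(straight has_vector_derivative 1) (at s)"
  unfolding straight_def
  using has_vector_derivative_of_real[of "\<lambda>s. s" 1 "at s"] by (simp add: has_vector_derivative_id)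

lemma kink_eq_iff: "kink s = kink s' \<longleftrightarrow> s = s' \<or> s = 1 \<and> s' = -1 \<or> s = -1 \<and> s' = 1"
proof
  assume eq: "kink s = kink s'"
  then have im: "s\<^sup>2 = s'\<^sup>2" and re: "s ^ 3 - s = s' ^ 3 - s'" by (auto simp: kink_def)
  from im consider "s = s'" | "s' = - s" by (auto simp: power2_eq_iff)
  then show "s = s' \<or> s = 1 \<and> s' = -1 \<or> s = -1 \<and> s' = 1"
  proof cases
    case 2
    then have "s * (s - 1) * (s + 1) = 0" using re by (simp add: algebra_simps power3_eq_cube)
    then show ?thesis using 2 by auto
  qed simp
qed (auto simp: kink_def)

text \<open>
  By \<open>strand_value_through\<close> the node contributes 0 to every path that contains both of its parameters or
  none of them.  Its own left path is either the loop of the kink, which meets no crossings, or it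
  contains all parameters outside of the region; in the second case the sum is that of the whole circle,
  which is 0 if \<open>d\<close> is normalized.
\<close>

lemma R1_parity:
  assumes R1: "decreasing_R1 U D D'"
    and corr: "\<And>a a'. (a, a') \<in> correspondent_arcs U D D' \<Longrightarrow> d a = d' a'"
  shows "v \<in> classical D - U \<Longrightarrow>
      intersection_number D (left_half D v) d = intersection_number D' (left_half D' v) d'"
    and "v \<in> classical D \<inter> U \<Longrightarrow> normalized D d \<Longrightarrow> intersection_number D (left_half D v) d = 0"
proof -
  obtain h h1 a b \<sigma> where U: "U = h ` cball 0 2" "U = h1 ` cball 0 2"
    and t: "tangle D h 1 a b \<sigma> (\<lambda>_. kink)" "tangle D' h1 1 a b \<sigma> (\<lambda>_. straight)"
    using R1 unfolding decreasing_R1_def by (elim exE conjE) (rule that)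
  have D: "is_diagram D" and D': "is_diagram D'" and same: "same_outside U D D'"
    and double: "double_points D \<inter> U \<subseteq> classical D"
    using R1 unfolding decreasing_R1_def by simp_all
  obtain q q1 where "tangle_change U D D' 1 a b d d' h \<sigma> (\<lambda>_. kink) (\<lambda>_. kink_tangent) q
      h1 (\<lambda>_. straight) (\<lambda>_ _. 1) q1"
    by (rule tangle_changeI[OF D D' same U t kink_deriv straight_deriv corr])
  then interpret tangle_change U D D' 1 a b d d' h \<sigma> "\<lambda>_. kink" "\<lambda>_. kink_tangent" q
      h1 "\<lambda>_. straight" "\<lambda>_ _. 1" q1 .
  have node: "kink 1 = 0" "kink (-1) = 0" by (simp_all add: kink_def complex_eq_iff)
  let ?x = "q 0 (-1)" and ?y = "q 0 1" and ?u = "h 0"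
  have "\<sigma> 0 * \<sigma> 0 = 1" using old.sgn[of 0] by auto
  then have u: "?u \<in> classical D \<inter> U" "to_NE D ?u = cis ?x" "to_NW D ?u = cis ?y"
    using old.crossing_at[OF double, of 0 0 0 "-1" 1] node by (simp_all add: kink_tangent_def orient_def)
  have cl: "classical D \<inter> U = {?u}"
  proof (intro equalityI subsetI)
    fix w assume "w \<in> classical D \<inter> U"
    then have "w \<in> double_points D \<inter> U" using D unfolding is_diagram_def by blast
    then obtain i j :: nat and s s' where ij: "i < 1" "j < 1" "(i, s) \<noteq> (j, s')" "kink s \<in> cball 0 2" "kink s = kink s'" "w = h (kink s)"
      by (rule old.double_point_strands)
    then have "s = 1 \<or> s = -1" using kink_eq_iff[of s s'] by auto
    then show "w \<in> {?u}" using ij node by auto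
  qed (use u in simp)
  have cl': "classical D' \<inter> U = {}"
  proof (rule equals0I)
    fix w assume "w \<in> classical D' \<inter> U"
    then have "w \<in> double_points D' \<inter> U" using D' unfolding is_diagram_def by blast
    then obtain i j :: nat and s s' where "i < 1" "j < 1" "(i, s) \<noteq> (j, s')" "straight s \<in> cball 0 2" "straight s = straight s'"
      by (rule new.double_point_strands)
    then show False by (simp add: straight_def)
  qed
  have only: "s = -1 \<or> s = 1" "s = 1 \<or> s = -1"
    if c: "kink s \<in> cball 0 2" "cis (q 0 s) \<in> crossing_parameters D" for s
  proof -
    obtain j :: nat and s' where "j < 1" "(j, s') \<noteq> (0, s)" "kink s' = kink s"
      by (rule old.crossing_parameter_strands[OF zero_less_one c])
    then show "s = -1 \<or> s = 1" "s = 1 \<or> s = -1" using kink_eq_iff[of s' s] by auto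
  qed
  have none: "cis (q1 0 s) \<notin> crossing_parameters D'" if s: "straight s \<in> cball 0 2" for s
  proof
    assume "cis (q1 0 s) \<in> crossing_parameters D'"
    then obtain j :: nat and s' where "j < 1" "(j, s') \<noteq> (0, s)" "straight s' = straight s"
      by (rule new.crossing_parameter_strands[OF zero_less_one s])
    then show False by (simp add: straight_def)
  qed
  have through: "d (arc_from D (cis ?y)) = d (arc_into D (cis ?x))"
    by (rule strand_value_through) (use node only none in auto)
  have flux_u: "flux D d I ?u = (if cis ?x \<in> I then d (arc_into D (cis ?x)) else 0)
      - (if cis ?y \<in> I then d (arc_into D (cis ?x)) else 0)" for I
    by (simp add: flux_def u arc_NW_def arc_SW_def through)
  { assume v: "v \<in> classical D - U"
    then have v': "v \<in> classical D'" using classical_eq by blast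
    have "cis ?x \<in> left_path D v \<longleftrightarrow> cis ?y \<in> left_path D v"
      by (rule outer_crossing_path(2)[OF v zero_less_one]; rule old.strand_point_in(2)) (simp_all add: node)
    then show "intersection_number D (left_half D v) d = intersection_number D' (left_half D' v) d'"
      using v v' outer_crossing_path(1)[OF v] by (intro intersection_eqI) (simp_all add: cl cl' flux_u) }
  { assume v: "v \<in> classical D \<inter> U" and norm: "normalized D d"
    have vu: "v = ?u" using v cl by blast
    have xy: "?x \<in> {a 0..b 0}" "?y \<in> {a 0..b 0}" using old.q_mem[of 0] node by simp_all
    note ab = old.ab[of 0, simplified]
    have total: "(\<Sum>w\<in>classical D - U. flux D d UNIV w) = 0"
      using norm unfolding normalized_iff_flux[OF D] flux_sum_split[OF D, of d _ U] cl
      by (simp add: flux_u)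
    have "cis ?x \<noteq> cis ?y" using old.strand_point_eq_iff[of 0 0 "-1" 1] node by simp
    then have "?x \<noteq> ?y" by auto
    then have "\<exists>I'\<in>{{}, UNIV}. \<forall>z. z \<in> circle \<longrightarrow> z \<notin> old.strand_parameters \<longrightarrow> z \<in> left_path D ?u \<longleftrightarrow> z \<in> I'"
    proof (cases "?y < ?x")
      case True
      have "left_path D ?u = cis ` {?y<..<?x}"
        unfolding u by (rule circle_path_cis) (use True xy ab in auto)
      also have "\<dots> \<subseteq> old.strand_parameters" using xy by auto
      finally have "z \<notin> left_path D ?u" if "z \<notin> old.strand_parameters" for z
        using that by (rule contra_subsetD)
      then show ?thesis by (intro bexI[of _ "{}"]) simp_all
    next
      case False
      then have less: "?x < ?y" using \<open>?x \<noteq> ?y\<close> by simp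
      have path: "circle_path (cis ?x) (cis ?y) = cis ` {?x<..<?y}"
        by (rule circle_path_cis) (use less xy ab in auto)
      have "z \<in> left_path D ?u" if z: "z \<in> circle" "z \<notin> old.strand_parameters" for z
      proof -
        have "z \<notin> circle_path (cis ?x) (cis ?y)" "z \<noteq> cis ?x" "z \<noteq> cis ?y"
          using z(2) xy unfolding path by auto
        then show ?thesis
          using circle_path_antisym[of "cis ?x" z "cis ?y"] z(1) \<open>cis ?x \<noteq> cis ?y\<close> by (auto simp: u)
      qed
      then show ?thesis by (intro bexI[of _ UNIV]) simp_all
    qed
    then obtain I' where I': "I' \<in> {{}, UNIV}" and
      Iz: "\<forall>z. z \<in> circle \<longrightarrow> z \<notin> old.strand_parameters \<longrightarrow> z \<in> left_path D ?u \<longleftrightarrow> z \<in> I'"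
      by (rule bexE)
    have "(\<Sum>w\<in>classical D - U. flux D d (left_path D ?u) w) = 0"
      using outer_flux_cong[OF Iz[rule_format]] I' total by auto
    then show "intersection_number D (left_half D v) d = 0"
      unfolding vu using intersection_left_half[OF D IntD1[OF u(1)], of d] u flux_sum_split[OF D, of d "left_path D ?u" U]
      by (simp add: cl flux_u) }
qed

section \<open>The second Reidemeister move\<close>

lemma parabola_deriv: "(parabola e has_vector_derivative Complex 1 (2 * s)) (at s)"
  unfolding parabola_def
  by (rule has_vector_derivative_Complex) (auto intro!: derivative_eq_intros)

text \<open>
  The strands cross twice with opposite orientations: strand 0 runs towards NE at \<open>u\<close> and towards NW at
  \<open>u'\<close>.  By \<open>strand_value_through\<close> the flux at both crossings involves the same two values \<open>A\<close> and \<open>B\<close>,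
  with opposite signs, and the fluxes of a path cancel if it contains each strand as a whole or misses
  it.  Off the strands the left path of \<open>u'\<close> is the complement of the left path of \<open>u\<close>; therefore
  the two sums over the outer crossings add up to the sum for the whole circle.
\<close>

lemma R2_parity:
  assumes R2: "decreasing_R2 U D D'"
    and corr: "\<And>a a'. (a, a') \<in> correspondent_arcs U D D' \<Longrightarrow> d a = d' a'"
  shows "v \<in> classical D - U \<Longrightarrow>
      intersection_number D (left_half D v) d = intersection_number D' (left_half D' v) d'"
    and "normalized D d \<Longrightarrow> v1 \<noteq> v2 \<Longrightarrow> classical D \<inter> U = {v1, v2} \<Longrightarrow>
      intersection_number D (left_half D v1) d + intersection_number D (left_half D v2) d = 0"
proof -
  let ?m = "\<lambda>k::nat. if k = 0 then straight else parabola (-1)"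
  let ?m1 = "\<lambda>k::nat. if k = 0 then straight else parabola 1"
  let ?m' = "\<lambda>(k::nat) s. if k = 0 then 1 else Complex 1 (2 * s)"
  obtain h h1 a b \<sigma> where U: "U = h ` cball 0 2" "U = h1 ` cball 0 2"
    and t: "tangle D h 2 a b \<sigma> ?m" "tangle D' h1 2 a b \<sigma> ?m1"
    using R2 unfolding decreasing_R2_def by (elim exE conjE) (rule that)
  have D: "is_diagram D" and D': "is_diagram D'" and same: "same_outside U D D'"
    and double: "double_points D \<inter> U \<subseteq> classical D"
    using R2 unfolding decreasing_R2_def by simp_all
  have deriv: "(?m k has_vector_derivative ?m' k s) (at s)" "(?m1 k has_vector_derivative ?m' k s) (at s)"
    for k s using straight_deriv parabola_deriv by simp_all
  obtain q q1 where "tangle_change U D D' 2 a b d d' h \<sigma> ?m ?m' q h1 ?m1 ?m' q1"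
    by (rule tangle_changeI[OF D D' same U t deriv corr])
  then interpret tangle_change U D D' 2 a b d d' h \<sigma> ?m ?m' q h1 ?m1 ?m' q1 .
  have m_eq: "(i, s) = (j, s') \<or> i \<noteq> j \<and> s = s' \<and> (s = 1 \<or> s = -1)"
    if "i < 2" "j < 2" "?m i s = ?m j s'" for i j :: nat and s s' :: real
    using that by (auto simp: straight_def parabola_def complex_eq_iff less_2_cases_iff power2_eq_1_iff split: if_splits)
  have m1_eq: "(i, s) = (j, s')" if "i < 2" "j < 2" "?m1 i s = ?m1 j s'" for i j :: nat and s s' :: real
  proof -
    have "r\<^sup>2 + 1 \<noteq> 0" for r :: real by (smt (verit) zero_le_power2)
    then show ?thesis
      using that by (auto simp: straight_def parabola_def complex_eq_iff less_2_cases_iff split: if_splits)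
  qed
  \<comment> \<open>strand 0 runs towards NE at the crossing with model parameter \<open>\<epsilon>\<close>\<close>
  define \<epsilon> where "\<epsilon> = \<sigma> 0 * \<sigma> 1"
  have \<epsilon>: "\<epsilon> = 1 \<or> \<epsilon> = -1" using old.sgn[of 0] old.sgn[of 1] by (auto simp: \<epsilon>_def)
  have corner: "?m i \<epsilon> = of_real \<epsilon>" "?m i (-\<epsilon>) = of_real (-\<epsilon>)" for i
    using \<epsilon> by (auto simp: straight_def parabola_def complex_eq_iff)
  have int: "norm (?m i \<epsilon>) < 2" "norm (?m i (-\<epsilon>)) < 2" "?m i \<epsilon> \<in> cball 0 2" "?m i (-\<epsilon>) \<in> cball 0 2" for i
    unfolding corner using \<epsilon> by auto
  let ?u = "h (of_real \<epsilon>)" and ?u' = "h (of_real (-\<epsilon>))"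
  let ?\<alpha> = "q 0 \<epsilon>" and ?\<alpha>' = "q 0 (-\<epsilon>)" and ?\<beta> = "q 1 \<epsilon>" and ?\<beta>' = "q 1 (-\<epsilon>)"
  have "\<sigma> 0 * \<sigma> 1 * \<epsilon> > 0" "\<sigma> 1 * \<sigma> 0 * \<epsilon> > 0"
    using old.sgn[of 0] old.sgn[of 1] by (auto simp: \<epsilon>_def)
  then have pos: "\<sigma> 0 * \<sigma> 1 * orient (?m' 0 \<epsilon>) (?m' 1 \<epsilon>) > 0"
    "\<sigma> 1 * \<sigma> 0 * orient (?m' 1 (-\<epsilon>)) (?m' 0 (-\<epsilon>)) > 0"
    by (simp_all add: orient_def mult_ac)
  have disc: "of_real \<epsilon> \<in> cball (0::complex) 2" "of_real (-\<epsilon>) \<in> cball (0::complex) 2" using \<epsilon> by auto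
  have u: "?u \<in> classical D \<inter> U" "to_NE D ?u = cis ?\<alpha>" "to_NW D ?u = cis ?\<beta>"
    by (rule old.crossing_at[OF double _ _ disc(1) corner(1) corner(1) pos(1)]; simp)+
  have u': "?u' \<in> classical D \<inter> U" "to_NE D ?u' = cis ?\<beta>'" "to_NW D ?u' = cis ?\<alpha>'"
    by (rule old.crossing_at[OF double _ _ disc(2) corner(2) corner(2) pos(2)]; simp)+
  have neq: "?u \<noteq> ?u'" using old.inj \<epsilon> by (auto simp: inj_eq)
  have cl: "classical D \<inter> U = {?u, ?u'}"
  proof (intro equalityI subsetI)
    fix w assume "w \<in> classical D \<inter> U"
    then have "w \<in> double_points D \<inter> U" using D unfolding is_diagram_def by blast
    then obtain i j s s' where ij: "i < 2" "j < 2" "(i, s) \<noteq> (j, s')" "?m i s \<in> cball 0 2" "?m i s = ?m j s'" "w = h (?m i s)"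
      by (rule old.double_point_strands)
    then have "s = \<epsilon> \<or> s = -\<epsilon>" using m_eq[OF ij(1,2,5)] ij(3) \<epsilon> by auto
    then show "w \<in> {?u, ?u'}"
      unfolding ij(6) by (elim disjE) (simp_all only: corner insert_iff simp_thms)
  qed (use u u' in auto)
  have cl': "classical D' \<inter> U = {}"
  proof (rule equals0I)
    fix w assume "w \<in> classical D' \<inter> U"
    then have "w \<in> double_points D' \<inter> U" using D' unfolding is_diagram_def by blast
    then obtain i j s s' where "i < 2" "j < 2" "(i, s) \<noteq> (j, s')" "?m1 i s \<in> cball 0 2" "?m1 i s = ?m1 j s'"
      by (rule new.double_point_strands)
    then show False using m1_eq by blast
  qed
  have only: "s = \<epsilon> \<or> s = -\<epsilon>" "s = -\<epsilon> \<or> s = \<epsilon>"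
    if k: "k < 2" and c: "?m k s \<in> cball 0 2" "cis (q k s) \<in> crossing_parameters D" for k s
  proof -
    obtain j s' where "j < 2" "(j, s') \<noteq> (k, s)" "?m j s' = ?m k s"
      by (rule old.crossing_parameter_strands[OF k c])
    then show "s = \<epsilon> \<or> s = -\<epsilon>" "s = -\<epsilon> \<or> s = \<epsilon>" using m_eq[of j k s' s] k \<epsilon> by auto
  qed
  have none: "cis (q1 k s) \<notin> crossing_parameters D'" if k: "k < 2" and s: "?m1 k s \<in> cball 0 2" for k s
  proof
    assume "cis (q1 k s) \<in> crossing_parameters D'"
    then obtain j s' where "j < 2" "(j, s') \<noteq> (k, s)" "?m1 j s' = ?m1 k s"
      using new.crossing_parameter_strands[OF k s] by metis
    then show False using m1_eq k by blast
  qed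
  have "\<epsilon> \<noteq> -\<epsilon>" and "-\<epsilon> \<noteq> \<epsilon>" using \<epsilon> by auto
  note through =
    strand_value_through[of 1 \<epsilon> "-\<epsilon>", OF _ \<open>\<epsilon> \<noteq> -\<epsilon>\<close> int(1,2) only(1)[where k = 1] none[where k = 1], simplified]
    strand_value_through[of 0 "-\<epsilon>" \<epsilon>, OF _ \<open>-\<epsilon> \<noteq> \<epsilon>\<close> int(2,1) only(2)[where k = 0] none[where k = 0], simplified]
  define A B where "A = d (arc_from D (cis ?\<beta>))" and "B = d (arc_into D (cis ?\<alpha>))"
  have flux_u: "flux D d I ?u = (if cis ?\<alpha> \<in> I then A else 0) - (if cis ?\<beta> \<in> I then B else 0)"
    and flux_u': "flux D d I ?u' = (if cis ?\<beta>' \<in> I then B else 0) - (if cis ?\<alpha>' \<in> I then A else 0)" for I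
    unfolding flux_def u u' arc_NW_def arc_SW_def A_def B_def using through by simp_all
  have inner: "(\<Sum>w\<in>classical D \<inter> U. flux D d I w) = flux D d I ?u + flux D d I ?u'" for I
    using neq by (simp add: cl)
  have str: "cis ?\<alpha> \<in> cis ` {a 0..b 0}" "cis ?\<alpha>' \<in> cis ` {a 0..b 0}"
    "cis ?\<beta> \<in> cis ` {a 1..b 1}" "cis ?\<beta>' \<in> cis ` {a 1..b 1}"
    by (rule old.strand_point_in(2)[OF _ int(3)] old.strand_point_in(2)[OF _ int(4)]; simp)+
  { assume v: "v \<in> classical D - U"
    then have v': "v \<in> classical D'" using classical_eq by blast
    have "cis ?\<alpha> \<in> left_path D v \<longleftrightarrow> cis ?\<alpha>' \<in> left_path D v" "cis ?\<beta> \<in> left_path D v \<longleftrightarrow> cis ?\<beta>' \<in> left_path D v"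
      by (rule outer_crossing_path(2)[OF v _ str(1,2)] outer_crossing_path(2)[OF v _ str(3,4)]; simp)+
    then have "(\<Sum>w\<in>classical D \<inter> U. flux D d (left_path D v) w) = 0"
      unfolding inner flux_u flux_u' by simp
    then show "intersection_number D (left_half D v) d = intersection_number D' (left_half D' v) d'"
      using v v' outer_crossing_path(1)[OF v] by (intro intersection_eqI) (simp_all add: cl') }
  { assume norm: "normalized D d" and vs: "v1 \<noteq> v2" "classical D \<inter> U = {v1, v2}"
    let ?I = "left_path D ?u" and ?I' = "left_path D ?u'"
    have disj: "cis ` {a 0..b 0} \<inter> cis ` {a 1..b 1} = {}" using old.disj[of 0 1] by simp
    have ne: "cis ?\<alpha> \<noteq> cis ?\<beta>" "cis ?\<alpha>' \<noteq> cis ?\<beta>'" using str disj by (metis disjoint_iff)+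
    have int_q: "?\<alpha> \<in> {a 0..b 0}" "?\<alpha>' \<in> {a 0..b 0}" "?\<beta> \<in> {a 1..b 1}" "?\<beta>' \<in> {a 1..b 1}"
      by (rule old.q_mem[OF _ int(3)] old.q_mem[OF _ int(4)]; simp)+
    have notin: "cis ?\<alpha> \<notin> cis ` {a 1..b 1}" "cis ?\<alpha>' \<notin> cis ` {a 1..b 1}"
      "cis ?\<beta> \<notin> cis ` {a 0..b 0}" "cis ?\<beta>' \<notin> cis ` {a 0..b 0}"
      using str disj by blast+
    have "cis ?\<alpha> \<noteq> cis ?\<alpha>'" "cis ?\<beta> \<noteq> cis ?\<beta>'"
      using old.strand_point_eq_iff[OF _ _ int(3,4), of 0 0] old.strand_point_eq_iff[OF _ _ int(3,4), of 1 1]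
        \<open>\<epsilon> \<noteq> -\<epsilon>\<close>
      by simp_all
    then have "?\<alpha> \<noteq> ?\<alpha>'" "?\<beta> \<noteq> ?\<beta>'" by auto
    then have mem: "cis ?\<beta>' \<in> ?I \<longleftrightarrow> ?\<beta> < ?\<beta>'" "cis ?\<alpha>' \<in> ?I \<longleftrightarrow> ?\<alpha>' < ?\<alpha>"
      "cis ?\<alpha> \<in> ?I' \<longleftrightarrow> ?\<alpha>' < ?\<alpha>" "cis ?\<beta> \<in> ?I' \<longleftrightarrow> ?\<beta> < ?\<beta>'"
      unfolding u u'
      using circle_path_strand_iff[OF int_q(3,4), of "cis ?\<alpha>"] circle_path_strand_iff[OF int_q(2,1), of "cis ?\<beta>"]
        circle_path_strand_iff[OF int_q(2,1), of "cis ?\<beta>'"] circle_path_strand_iff[OF int_q(3,4), of "cis ?\<alpha>'"]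
        notin old.ab(2)[of 0] old.ab(2)[of 1]
      by auto
    have ends: "cis ?\<alpha> \<notin> ?I" "cis ?\<beta> \<notin> ?I" "cis ?\<alpha>' \<notin> ?I'" "cis ?\<beta>' \<notin> ?I'"
      unfolding u u' by simp_all
    have outer: "z \<in> ?I' \<longleftrightarrow> z \<in> - ?I" if z: "z \<in> circle" "z \<notin> old.strand_parameters" for z
    proof -
      have zn: "z \<notin> cis ` {a 0..b 0}" "z \<notin> cis ` {a 1..b 1}" using z(2) by (auto simp: less_2_cases_iff)
      then have zne: "z \<noteq> cis ?\<alpha>" "z \<noteq> cis ?\<beta>" using str by blast+
      have "z \<in> circle_path (cis ?\<alpha>') (cis ?\<beta>') \<longleftrightarrow> z \<in> circle_path (cis ?\<alpha>) (cis ?\<beta>)"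
        by (rule circle_path_move_endpoints[OF _ _ _ _ disj str(2,1,4,3) z(1) zn])
          (auto intro!: connected_cis_image)
      also have "\<dots> \<longleftrightarrow> z \<notin> circle_path (cis ?\<beta>) (cis ?\<alpha>)"
        by (rule circle_path_antisym) (use z(1) zne ne in auto)
      finally show ?thesis unfolding u u' by simp
    qed
    have "(\<Sum>w\<in>classical D - U. flux D d ?I' w) = (\<Sum>w\<in>classical D - U. flux D d (- ?I) w)"
      by (rule outer_flux_cong[OF outer])
    moreover have "(\<Sum>w\<in>classical D - U. flux D d ?I w) + (\<Sum>w\<in>classical D - U. flux D d (- ?I) w)
        = (\<Sum>w\<in>classical D - U. flux D d UNIV w)"
      by (simp add: sum.distrib[symmetric] flux_Compl)
    moreover have "(\<Sum>w\<in>classical D - U. flux D d UNIV w) = 0"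
      using norm unfolding normalized_iff_flux[OF D] flux_sum_split[OF D, of d _ U] inner flux_u flux_u'
      by simp
    ultimately have out0: "(\<Sum>w\<in>classical D - U. flux D d ?I w) + (\<Sum>w\<in>classical D - U. flux D d ?I' w) = 0"
      by simp
    have in0: "(flux D d ?I ?u + flux D d ?I ?u') + (flux D d ?I' ?u + flux D d ?I' ?u') = 0"
      unfolding flux_u flux_u' using mem ends by simp
    have regroup: "(x + y) + (x' + y') = (x + x') + (y + y')" for x y x' y' :: 'a
      by (simp add: add_ac)
    have "intersection_number D (left_half D ?u) d + intersection_number D (left_half D ?u') d = 0"
      unfolding intersection_left_half[OF D IntD1[OF u(1)]] intersection_left_half[OF D IntD1[OF u'(1)]]
        flux_sum_split[OF D, of d _ U] inner regroup out0 in0 by simp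
    moreover have "{v1, v2} = {?u, ?u'}" using vs cl by simp
    ultimately show "intersection_number D (left_half D v1) d + intersection_number D (left_half D v2) d = 0"
      using vs(1) by (auto simp: doubleton_eq_iff add.commute) }
qed

section \<open>The third Reidemeister move: algebra\<close>

text \<open>
  Strands \<open>i\<close>, \<open>j\<close>, \<open>k\<close> of the triangle such that each one is the successor of the one before.
\<close>

definition cyclic3 :: "nat \<Rightarrow> nat \<Rightarrow> nat \<Rightarrow> bool" where
  "cyclic3 i j k \<longleftrightarrow> i = 0 \<and> j = 1 \<and> k = 2 \<or> i = 1 \<and> j = 2 \<and> k = 0 \<or> i = 2 \<and> j = 0 \<and> k = 1"

text \<open>
  The flux at the crossing of a strand with its successor, in terms of the values of a cycle.  Each
  strand meets its successor in a point \<open>P\<close> and its predecessor in a point \<open>N\<close>; here \<open>P\<close> is on the strand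
  and \<open>N\<close> on the successor.  The truth values \<open>t\<close> and \<open>u\<close> say whether \<open>P\<close> comes before \<open>N\<close> on the strand
  and on the successor, and \<open>p\<close> and \<open>n\<close> whether \<open>P\<close> and \<open>N\<close> are in the set of parameters.  The cycle has
  the values \<open>x\<close> and \<open>y\<close> at the starts of the strand and of its successor; in passing the points \<open>P\<close> of
  the predecessor, the strand itself and the successor its value changes by \<open>i\<close>, \<open>j\<close> and \<open>l\<close>.  At \<open>N\<close> on
  the successor it changes by \<open>- j\<close>, since the flow through the crossing is conserved.  The strand with
  \<open>P\<close> is the one towards NE iff \<open>t = u\<close>.
\<close>

definition corner_flux :: "bool \<Rightarrow> bool \<Rightarrow> bool \<Rightarrow> bool \<Rightarrow> 'a \<Rightarrow> 'a \<Rightarrow> 'a \<Rightarrow> 'a \<Rightarrow> 'a \<Rightarrow> 'a::ab_group_add" where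
  "corner_flux t u p n x y i j l =
    (let into_P = (if t then x else x - i); from_P = into_P + j;
         into_N = (if u then y + l else y); from_N = into_N - j
     in if t = u then (if p then from_N else 0) - (if n then into_P else 0)
        else (if n then from_P else 0) - (if p then into_N else 0))"

definition triangle_flux ::
  "(nat \<Rightarrow> bool) \<Rightarrow> (nat \<Rightarrow> bool) \<Rightarrow> (nat \<Rightarrow> bool) \<Rightarrow> (nat \<Rightarrow> 'a) \<Rightarrow> (nat \<Rightarrow> 'a) \<Rightarrow> 'a::ab_group_add" where
  "triangle_flux \<tau> p n X J =
     corner_flux (\<tau> 0) (\<tau> 1) (p 0) (n 1) (X 0) (X 1) (J 2) (J 0) (J 1)
   + corner_flux (\<tau> 1) (\<tau> 2) (p 1) (n 2) (X 1) (X 2) (J 0) (J 1) (J 2)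
   + corner_flux (\<tau> 2) (\<tau> 0) (p 2) (n 0) (X 2) (X 0) (J 1) (J 2) (J 0)"

text \<open>
  For a path that contains each strand as a whole or misses it.  The move reverses the order of the
  crossings on each strand and shifts the jumps by a common constant, because the values at the ends of
  the strands do not change.
\<close>

lemma triangle_flux_strands:
  assumes "\<And>k. k < 3 \<Longrightarrow> p k = s k" "\<And>k. k < 3 \<Longrightarrow> n k = s k" "\<And>k. k < 3 \<Longrightarrow> p' k = s k" "\<And>k. k < 3 \<Longrightarrow> n' k = s k"
    and "\<And>k. k < 3 \<Longrightarrow> J' k = J k + c" "\<And>k. k < 3 \<Longrightarrow> \<tau>' k \<longleftrightarrow> \<not> \<tau> k"
  shows "triangle_flux \<tau> p n X J = triangle_flux \<tau>' p' n' X J'"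
proof -
  note * = assms[of 0] assms[of 1] assms[of 2]
  show ?thesis
    unfolding triangle_flux_def corner_flux_def Let_def using *
    by (cases "\<tau> 0"; cases "\<tau> 1"; cases "\<tau> 2"; simp add: algebra_simps)
qed

text \<open>
  For the left path of the crossing of \<open>A\<close> and \<open>B\<close>, before and after the move.
\<close>

lemma triangle_flux_corner:
  assumes "cyclic3 A B C"
    and "\<not> p A" "\<not> n B" "n A \<longleftrightarrow> \<not> \<tau> B" "p B \<longleftrightarrow> \<not> \<tau> A" "p C \<longleftrightarrow> \<omega>" "n C \<longleftrightarrow> \<omega>"
    and "\<not> p' A" "\<not> n' B" "n' A \<longleftrightarrow> \<not> \<tau>' B" "p' B \<longleftrightarrow> \<not> \<tau>' A" "p' C \<longleftrightarrow> \<omega>" "n' C \<longleftrightarrow> \<omega>"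
    and "\<And>k. k < 3 \<Longrightarrow> J' k = J k + c" "\<And>k. k < 3 \<Longrightarrow> \<tau>' k \<longleftrightarrow> \<not> \<tau> k"
  shows "triangle_flux \<tau> p n X J = triangle_flux \<tau>' p' n' X J'"
proof -
  note * = assms(14,15)[of 0] assms(14,15)[of 1] assms(14,15)[of 2]
  show ?thesis
    using assms(1)[unfolded cyclic3_def]
    unfolding triangle_flux_def corner_flux_def Let_def
    using assms(2-13) *
    by (elim disjE conjE; cases "\<tau> 0"; cases "\<tau> 1"; cases "\<tau> 2"; simp add: algebra_simps)
qed

text \<open>
  For the three sets of parameters that belong to the corners of the triangle, indexed by the first
  argument of \<open>p\<close> and \<open>n\<close>.  Each strand is covered unevenly by them, but in the sum of the fluxes this
  is compensated by the conservation of the flow at the corners.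
\<close>

lemma triangle_flux_sum:
  assumes "\<And>A B C. cyclic3 A B C \<Longrightarrow>
     (p A A \<longleftrightarrow> \<tau> A \<noteq> \<tau> B) \<and> (n A B \<longleftrightarrow> \<tau> A \<noteq> \<tau> B) \<and> (n A A \<longleftrightarrow> \<not> \<tau> A) \<and> (p A B \<longleftrightarrow> \<not> \<tau> B)
     \<and> (p A C \<longleftrightarrow> \<omega>) \<and> (n A C \<longleftrightarrow> \<omega>)"
  shows "triangle_flux \<tau> (p 0) (n 0) X J + triangle_flux \<tau> (p 1) (n 1) X J + triangle_flux \<tau> (p 2) (n 2) X J
    = (if \<omega> then triangle_flux \<tau> (\<lambda>_. True) (\<lambda>_. True) X J + triangle_flux \<tau> (\<lambda>_. True) (\<lambda>_. True) X J
       else triangle_flux \<tau> (\<lambda>_. True) (\<lambda>_. True) X J)"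
proof -
  note * = assms[of 0 1 2, unfolded cyclic3_def, simplified]
    assms[of 1 2 0, unfolded cyclic3_def, simplified] assms[of 2 0 1, unfolded cyclic3_def, simplified]
  show ?thesis
    unfolding triangle_flux_def corner_flux_def Let_def
    using *
    by (cases "\<tau> 0"; cases "\<tau> 1"; cases "\<tau> 2"; cases \<omega>; simp add: algebra_simps)
qed

section \<open>The third Reidemeister move: geometry\<close>

context strands
begin

text \<open>
  Only the middle piece of a strand with two crossings stays in the region.
\<close>

lemma strand_sides:
  assumes k: "k < n" and int: "norm (m k s) < 2" "norm (m k s') < 2" and less: "q k s < q k s'"
    and only: "\<And>u. m k u \<in> cball 0 2 \<Longrightarrow> cis (q k u) \<in> crossing_parameters D \<Longrightarrow> u = s \<or> u = s'"
    and cr: "cis (q k s) \<in> crossing_parameters D" "cis (q k s') \<in> crossing_parameters D"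
  shows "\<not> curve D ` arc_into D (cis (q k s)) \<subseteq> U" "curve D ` arc_from D (cis (q k s)) \<subseteq> U"
    "curve D ` arc_into D (cis (q k s')) \<subseteq> U" "\<not> curve D ` arc_from D (cis (q k s')) \<subseteq> U"
proof -
  have two: "arc_into D (cis (a k)) = arc_into D (cis (q k s))"
    "arc_from D (cis (q k s)) = arc_into D (cis (q k s'))"
    "arc_from D (cis (q k s')) = arc_from D (cis (b k))"
    by (rule strand_with_two_crossings[OF k int less], erule (1) only)+
  note pos = strand_interior[OF k int(1)] strand_interior[OF k int(2)]
  obtain e where e: "e > 0" "cis ` {b k<..<b k + e} \<inter> strand_parameters = {}"
    "cis ` {a k - e<..<a k} \<inter> strand_parameters = {}"
    by (rule beyond_strand[OF k])
  have leaves: "\<not> curve D ` A \<subseteq> U" if "cis u \<in> A" "cis u \<notin> strand_parameters" for A u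
  proof -
    have "curve D (cis u) \<notin> U" using that(2) inside by (metis (mono_tags, lifting) cis_in_circle mem_Collect_eq)
    then show ?thesis using that(1) by blast
  qed
  obtain e1 where e1: "e1 > 0" "\<And>u. u \<noteq> a k \<Longrightarrow> \<bar>u - a k\<bar> < e1 \<Longrightarrow> cis u \<notin> crossing_parameters D"
    using finite_avoids_near finite_crossing_parameters[OF D] by blast
  have le: "max (a k - e) (a k - e1) < a k" using e(1) e1(1) by simp
  have "cis ` {max (a k - e) (a k - e1)<..<a k} \<inter> crossing_parameters D = {}" using e1(2) by auto
  note sub = arc_into_interval(2)[OF le this]
  obtain u where u: "max (a k - e) (a k - e1) < u" "u < a k" using dense[OF le] by blast
  then have "cis u \<in> cis ` {max (a k - e) (a k - e1)<..<a k}" "cis u \<in> cis ` {a k - e<..<a k}" by auto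
  then have "cis u \<in> arc_into D (cis (a k))" "cis u \<notin> strand_parameters" using sub e(3) by blast+
  then show "\<not> curve D ` arc_into D (cis (q k s)) \<subseteq> U"
    unfolding two(1)[symmetric] by (rule leaves)
  obtain e2 where e2: "e2 > 0" "\<And>u. u \<noteq> b k \<Longrightarrow> \<bar>u - b k\<bar> < e2 \<Longrightarrow> cis u \<notin> crossing_parameters D"
    using finite_avoids_near finite_crossing_parameters[OF D] by blast
  have le: "b k < min (b k + e) (b k + e2)" using e(1) e2(1) by simp
  have "cis ` {b k<..<min (b k + e) (b k + e2)} \<inter> crossing_parameters D = {}" using e2(2) by auto
  note sub' = arc_from_interval(2)[OF le this]
  obtain u' where u': "b k < u'" "u' < min (b k + e) (b k + e2)" using dense[OF le] by blast
  then have "cis u' \<in> cis ` {b k<..<min (b k + e) (b k + e2)}" "cis u' \<in> cis ` {b k<..<b k + e}" by auto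
  then have "cis u' \<in> arc_from D (cis (b k))" "cis u' \<notin> strand_parameters" using sub' e(2) by blast+
  then show "\<not> curve D ` arc_from D (cis (q k s')) \<subseteq> U"
    unfolding two(3) by (rule leaves)
  let ?M = "arc_from D (cis (q k s))"
  have path: "circle_path (cis (q k s)) (cis (q k s')) = cis ` {q k s<..<q k s'}"
    by (rule circle_path_cis) (use less pos ab[OF k] in auto)
  have neq: "cis (q k s) \<noteq> cis (q k s')"
    using strand_point_eq_iff[OF k k, of s s'] int less by auto
  have M: "?M \<in> arcs D" using arc_from_into_in_arcs(1)[OF D] by simp
  have "cis r \<notin> crossing_parameters D" if r: "r \<in> {q k s<..<q k s'}" for r
  proof -
    have "r \<in> {a k..b k}" using r pos by auto
    then obtain u where "m k u \<in> cball 0 2" "q k u = r" using q_surj[OF k] by blast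
    then show ?thesis using only[of u] r by auto
  qed
  then have free: "cis ` {q k s<..<q k s'} \<inter> crossing_parameters D = {}" by blast
  obtain z where z: "q k s < z" "z < q k s'" using dense[OF less] by blast
  have zM: "cis z \<in> ?M" using arc_from_interval(2)[OF less free] z by auto
  have avoid: "cis (q k s) \<notin> ?M" "cis (q k s') \<notin> ?M" "?M \<subseteq> circle"
    using arc_subset[OF M] cr by blast+
  have "?M \<subseteq> cis ` {q k s<..<q k s'}"
  proof
    fix y assume y: "y \<in> ?M"
    have "cis z \<in> circle_path (cis (q k s)) (cis (q k s'))" unfolding path using z by auto
    then show "y \<in> cis ` {q k s<..<q k s'}"
      using circle_path_connected[OF _ _ neq arc_connected[OF M] avoid(3,1,2) y zM] unfolding path by simp
  qed
  also have "\<dots> \<subseteq> strand_parameters"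
  proof -
    have "{q k s<..<q k s'} \<subseteq> {a k..b k}" using pos by auto
    then show ?thesis using k by blast
  qed
  also have "\<dots> = {x \<in> circle. curve D x \<in> U}" using inside by simp
  finally show "curve D ` ?M \<subseteq> U" by blast
  then show "curve D ` arc_into D (cis (q k s')) \<subseteq> U" unfolding two(2) .
qed

end

lemma cyclic3_less: "cyclic3 i j k \<Longrightarrow> i < 3" "cyclic3 i j k \<Longrightarrow> j < 3" "cyclic3 i j k \<Longrightarrow> k < 3"
  by (auto simp: cyclic3_def)

lemma cyclic3_neq: "cyclic3 i j k \<Longrightarrow> i \<noteq> j" "cyclic3 i j k \<Longrightarrow> j \<noteq> k" "cyclic3 i j k \<Longrightarrow> i \<noteq> k"
  by (auto simp: cyclic3_def)

lemma cyclic3_exhaust: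
  assumes "i < 3" "j < 3" "i \<noteq> j"
  shows "(\<exists>k. cyclic3 i j k) \<or> (\<exists>k. cyclic3 j i k)"
proof -
  have "i = 0 \<or> i = 1 \<or> i = 2" "j = 0 \<or> j = 1 \<or> j = 2" using assms by auto
  then show ?thesis using assms(3) by (auto simp: cyclic3_def)
qed

lemma cis_next:
  assumes "cyclic3 i j k"
  shows "cis (2 * pi * real j / 3) = cis (2 * pi * real i / 3) * cis (2 * pi / 3)"
proof -
  have "cis (2 * pi * 3 / 3) = 1" by (simp add: complex_eq_iff)
  then have "cis (2 * pi * 2 / 3) * cis (2 * pi / 3) = 1"
    by (simp add: cis_mult algebra_simps)
  then show ?thesis using assms by (auto simp: cyclic3_def cis_mult algebra_simps)
qed

lemma cis_third: "cis (2 * pi / 3) = Complex (- 1 / 2) (sqrt 3 / 2)"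
  by (simp add: complex_eq_iff cos_120 sin_120)

text \<open>
  Consecutive lines differ by a third of a full turn, so there is only one intersection to compute.
\<close>

lemma triangle_line_eq:
  assumes c: "cyclic3 i j k"
  shows "triangle_line e i s = triangle_line e j s' \<longleftrightarrow> s = - (sqrt 3 / 2 * e) \<and> s' = sqrt 3 / 2 * e"
proof -
  have "triangle_line e i s = triangle_line e j s' \<longleftrightarrow> Complex s (e / 2) = cis (2 * pi / 3) * Complex s' (e / 2)"
    unfolding triangle_line_def cis_next[OF c] by simp
  also have "\<dots> \<longleftrightarrow> s = - s' / 2 - sqrt 3 / 2 * (e / 2) \<and> e / 2 = sqrt 3 / 2 * s' - e / 4"
    by (simp add: cis_third complex_eq_iff)
  also have "\<dots> \<longleftrightarrow> s = - (sqrt 3 / 2 * e) \<and> s' = sqrt 3 / 2 * e"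
  proof -
    have "e / 2 = sqrt 3 / 2 * s' - e / 4 \<longleftrightarrow> sqrt 3 * s' = 3 / 2 * e" by auto
    also have "3 / 2 * e = sqrt 3 * (sqrt 3 / 2 * e)" by simp
    also have "sqrt 3 * s' = \<dots> \<longleftrightarrow> s' = sqrt 3 / 2 * e" unfolding mult_cancel_left by simp
    finally show ?thesis by auto
  qed
  finally show ?thesis .
qed

lemma triangle_line_inj: "triangle_line e i s = triangle_line e i s' \<longleftrightarrow> s = s'"
  by (simp add: triangle_line_def)

lemma triangle_line_deriv:
  "(triangle_line e k has_vector_derivative cis (2 * pi * real k / 3)) (at s)"
proof -
  have "((\<lambda>s. Complex s (e / 2)) has_vector_derivative Complex 1 0) (at s)"
    by (rule has_vector_derivative_Complex) (auto intro!: derivative_eq_intros)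
  from has_vector_derivative_mult_right[OF this, of "cis (2 * pi * real k / 3)"]
  show ?thesis unfolding triangle_line_def by (simp add: Complex_eq)
qed

text \<open>
  The triangle of a third Reidemeister move, with \<open>e = 1\<close> before and \<open>e = - 1\<close> after the move.
\<close>

locale triangle_tangle =
  strands D U h 3 a b \<sigma> "triangle_line e" "\<lambda>k _. cis (2 * pi * real k / 3)" q
  for D U h a b \<sigma> e q +
  assumes e: "e = 1 \<or> e = -1" and double: "double_points D \<inter> U \<subseteq> classical D"
begin

text \<open>
  Strand \<open>k\<close> meets its successor at the model parameter \<open>- r\<close> and its predecessor at \<open>r\<close>.
\<close>

definition r :: real where "r = sqrt 3 / 2 * e"
definition next_point :: "nat \<Rightarrow> real" where "next_point k = q k (- r)"
definition prev_point :: "nat \<Rightarrow> real" where "prev_point k = q k r"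
definition corner :: "nat \<Rightarrow> complex" where "corner k = h (triangle_line e k (- r))"
definition next_first :: "nat \<Rightarrow> bool" where "next_first k \<longleftrightarrow> next_point k < prev_point k"

lemma r_neq: "r \<noteq> 0" "r \<noteq> - r" "- r \<noteq> r"
  using e by (auto simp: r_def)

lemma r_sign: "e = 1 \<Longrightarrow> - r < r" "e = - 1 \<Longrightarrow> r < - r"
  unfolding r_def by simp_all

lemma corner_disc [simp]: "norm (triangle_line e k r) < 2" "norm (triangle_line e k (- r)) < 2"
  "norm (triangle_line e k r) \<le> 2" "norm (triangle_line e k (- r)) \<le> 2"
proof -
  have "r\<^sup>2 + (e / 2)\<^sup>2 = 1" using e by (auto simp: r_def power2_eq_square)
  then have "norm (Complex r (e / 2)) = 1" "norm (Complex (- r) (e / 2)) = 1"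
    by (simp_all add: cmod_def)
  then have "norm (triangle_line e k r) = 1" "norm (triangle_line e k (- r)) = 1"
    by (simp_all add: triangle_line_def norm_mult)
  then show "norm (triangle_line e k r) < 2" "norm (triangle_line e k (- r)) < 2"
    "norm (triangle_line e k r) \<le> 2" "norm (triangle_line e k (- r)) \<le> 2" by simp_all
qed

lemma meet:
  assumes "cyclic3 i j k" shows "triangle_line e j r = triangle_line e i (- r)"
  using triangle_line_eq[OF assms, of e "- r" r] by (simp add: r_def)

text \<open>
  In particular the order of the two crossings on a strand is reversed if \<open>e\<close> changes its sign.
\<close>

lemma next_first_iff: "k < 3 \<Longrightarrow> next_first k \<longleftrightarrow> \<sigma> k * e = 1"
  using sgn[of k] e r_sign q_mono[of k r "- r"] q_mono[of k "- r" r] q_anti[of k r "- r"] q_anti[of k "- r" r]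
  by (auto simp: next_first_def next_point_def prev_point_def)

lemma strand_points:
  assumes "k < 3"
  shows "next_point k \<in> {a k..b k}" "prev_point k \<in> {a k..b k}" "next_point k \<noteq> prev_point k"
    "cis (next_point k) \<in> cis ` {a k..b k}" "cis (prev_point k) \<in> cis ` {a k..b k}"
proof -
  show *: "next_point k \<in> {a k..b k}" "prev_point k \<in> {a k..b k}"
    unfolding next_point_def prev_point_def by (rule q_mem[OF assms]; simp)+
  then show "cis (next_point k) \<in> cis ` {a k..b k}" "cis (prev_point k) \<in> cis ` {a k..b k}" by blast+
  have "cis (q k (- r)) \<noteq> cis (q k r)"
    using strand_point_eq_iff[OF assms assms, of "- r" r] r_neq by simp
  then show "next_point k \<noteq> prev_point k" unfolding next_point_def prev_point_def by auto
qed

lemma corner_crossing: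
  assumes c: "cyclic3 i j k"
  shows "corner i \<in> classical D \<inter> U"
    "to_NE D (corner i) = (if next_first i = next_first j then cis (next_point i) else cis (prev_point j))"
    "to_NW D (corner i) = (if next_first i = next_first j then cis (prev_point j) else cis (next_point i))"
proof -
  note ij = cyclic3_less[OF c]
  let ?t = "\<lambda>k. cis (2 * pi * real k / 3)"
  have o: "orient z (z * cis (2 * pi / 3)) = (norm z)\<^sup>2 * (sqrt 3 / 2)" for z
    unfolding orient_def cis_third cmod_power2 by (simp add: power2_eq_square algebra_simps)
  have "orient (?t i) (?t j) = sqrt 3 / 2" using o[of "?t i"] by (simp add: cis_next[OF c])
  moreover have "sqrt 3 > (0::real)" by simp
  ultimately have o1: "orient (?t i) (?t j) > 0" "orient (?t j) (?t i) < 0"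
    using orient_swap[of "?t j" "?t i"] by linarith+
  have disc: "triangle_line e i (- r) \<in> cball 0 2" by simp
  have same: "next_first i = next_first j \<longleftrightarrow> \<sigma> i * \<sigma> j = 1"
    using next_first_iff[OF ij(1)] next_first_iff[OF ij(2)] sgn[OF ij(1)] sgn[OF ij(2)] e by auto
  have "corner i \<in> classical D \<inter> U \<and>
    to_NE D (corner i) = (if next_first i = next_first j then cis (next_point i) else cis (prev_point j)) \<and>
    to_NW D (corner i) = (if next_first i = next_first j then cis (prev_point j) else cis (next_point i))"
  proof (cases "next_first i = next_first j")
    case True
    then have "\<sigma> i * \<sigma> j * orient (?t i) (?t j) > 0" using same o1 by simp
    then show ?thesis
      using crossing_at[OF double ij(1,2) disc refl meet[OF c]] True
      unfolding corner_def next_point_def prev_point_def by simp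
  next
    case False
    then have "\<sigma> j * \<sigma> i = -1" using same sgn[OF ij(1)] sgn[OF ij(2)] by auto
    then have "\<sigma> j * \<sigma> i * orient (?t j) (?t i) > 0" using o1 by simp
    then show ?thesis
      using crossing_at[OF double ij(2,1) disc meet[OF c] refl] False
      unfolding corner_def next_point_def prev_point_def by simp
  qed
  then show "corner i \<in> classical D \<inter> U"
    "to_NE D (corner i) = (if next_first i = next_first j then cis (next_point i) else cis (prev_point j))"
    "to_NW D (corner i) = (if next_first i = next_first j then cis (prev_point j) else cis (next_point i))"
    by blast+
qed

lemma corner_crossing_parameters:
  assumes "k < 3"
  shows "cis (next_point k) \<in> crossing_parameters D" "cis (prev_point k) \<in> crossing_parameters D"
proof -
  obtain j l where c: "cyclic3 k j l" "cyclic3 l k j"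
  proof -
    have "k = 0 \<or> k = 1 \<or> k = 2" using assms by auto
    then show ?thesis using that[of 1 2] that[of 2 0] that[of 0 1] by (auto simp: cyclic3_def)
  qed
  show "cis (next_point k) \<in> crossing_parameters D"
    using corner_crossing[OF c(1)] to_NE_to_NW_crossing_parameters[OF D, of "corner k"]
    by (auto split: if_splits)
  show "cis (prev_point k) \<in> crossing_parameters D"
    using corner_crossing[OF c(2)] to_NE_to_NW_crossing_parameters[OF D, of "corner l"]
    by (auto split: if_splits)
qed

lemma meeting_points:
  assumes "i < 3" "j < 3" "(i, s) \<noteq> (j, s')" "triangle_line e i s = triangle_line e j s'"
  shows "\<exists>k. cyclic3 i j k \<and> s = - r \<and> s' = r \<or> cyclic3 j i k \<and> s = r \<and> s' = - r"
proof -
  have "i \<noteq> j" using assms triangle_line_inj by auto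
  then consider k where "cyclic3 i j k" | k where "cyclic3 j i k"
    using cyclic3_exhaust assms by blast
  then show ?thesis
  proof cases
    case 1
    then show ?thesis using triangle_line_eq[OF 1, of e s s'] assms by (auto simp: r_def)
  next
    case 2
    then show ?thesis using triangle_line_eq[OF 2, of e s' s] assms by (auto simp: r_def)
  qed
qed

lemma classical_inside: "classical D \<inter> U = {corner 0, corner 1, corner 2}"
proof (intro equalityI subsetI)
  fix w assume "w \<in> classical D \<inter> U"
  then have "w \<in> double_points D \<inter> U" using D unfolding is_diagram_def by blast
  then obtain i j s s' where ij: "i < 3" "j < 3" "(i, s) \<noteq> (j, s')" "triangle_line e i s \<in> cball 0 2"
    "triangle_line e i s = triangle_line e j s'" "w = h (triangle_line e i s)"
    by (rule double_point_strands)
  obtain k where "cyclic3 i j k \<and> s = - r \<and> s' = r \<or> cyclic3 j i k \<and> s = r \<and> s' = - r"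
    using meeting_points[OF ij(1,2,3,5)] by blast
  then have "w = corner i \<or> w = corner j" using ij(5,6) by (auto simp: corner_def)
  moreover have "i = 0 \<or> i = 1 \<or> i = 2" "j = 0 \<or> j = 1 \<or> j = 2" using ij by auto
  ultimately show "w \<in> {corner 0, corner 1, corner 2}" by auto
next
  have "corner 0 \<in> classical D \<inter> U" by (rule corner_crossing[of 0 1 2]) (simp add: cyclic3_def)
  moreover have "corner 1 \<in> classical D \<inter> U" by (rule corner_crossing[of 1 2 0]) (simp add: cyclic3_def)
  moreover have "corner 2 \<in> classical D \<inter> U" by (rule corner_crossing[of 2 0 1]) (simp add: cyclic3_def)
  moreover fix w assume "w \<in> {corner 0, corner 1, corner 2}"
  ultimately show "w \<in> classical D \<inter> U" by blast
qed

lemma corner_inj: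
  assumes "i < 3" "j < 3" "corner i = corner j" shows "i = j"
proof (rule ccontr)
  assume "i \<noteq> j"
  have "triangle_line e i (- r) = triangle_line e j (- r)" using assms inj by (simp add: corner_def inj_eq)
  then show False using meeting_points[OF assms(1,2), of "- r" "- r"] \<open>i \<noteq> j\<close> r_neq by auto
qed

lemma only_crossings:
  assumes "k < 3" "triangle_line e k u \<in> cball 0 2" "cis (q k u) \<in> crossing_parameters D"
  shows "u = r \<or> u = - r"
proof -
  obtain j s where j: "j < 3" "(j, s) \<noteq> (k, u)" "triangle_line e j s = triangle_line e k u"
    by (rule crossing_parameter_strands[OF assms])
  then show ?thesis using meeting_points[OF j(1) assms(1) j(2,3)] by blast
qed

lemma strand_arcs:
  assumes k: "k < 3"
  shows "next_first k \<Longrightarrow> arc_into D (cis (next_point k)) = arc_into D (cis (a k))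
      \<and> arc_into D (cis (prev_point k)) = arc_from D (cis (next_point k))
      \<and> arc_from D (cis (b k)) = arc_from D (cis (prev_point k))"
    and "\<not> next_first k \<Longrightarrow> arc_into D (cis (prev_point k)) = arc_into D (cis (a k))
      \<and> arc_into D (cis (next_point k)) = arc_from D (cis (prev_point k))
      \<and> arc_from D (cis (b k)) = arc_from D (cis (next_point k))"
proof -
  have only: "u = - r \<or> u = r" "u = r \<or> u = - r"
    if "triangle_line e k u \<in> cball 0 2" "cis (q k u) \<in> crossing_parameters D" for u
    using only_crossings[OF k that] by blast+
  { assume "next_first k"
    then have "q k (- r) < q k r" by (simp add: next_first_def next_point_def prev_point_def)
    from strand_with_two_crossings[OF k corner_disc(2,1) this only(1)]
    show "arc_into D (cis (next_point k)) = arc_into D (cis (a k))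
      \<and> arc_into D (cis (prev_point k)) = arc_from D (cis (next_point k))
      \<and> arc_from D (cis (b k)) = arc_from D (cis (prev_point k))"
      by (simp add: next_point_def prev_point_def) }
  { assume "\<not> next_first k"
    then have "q k r < q k (- r)"
      using strand_points(3)[OF k] by (simp add: next_first_def next_point_def prev_point_def)
    from strand_with_two_crossings[OF k corner_disc(1,2) this only(2)]
    show "arc_into D (cis (prev_point k)) = arc_into D (cis (a k))
      \<and> arc_into D (cis (next_point k)) = arc_from D (cis (prev_point k))
      \<and> arc_from D (cis (b k)) = arc_from D (cis (next_point k))"
      by (simp add: next_point_def prev_point_def) }
qed

lemma side_iff:
  assumes k: "k < 3"
  shows "curve D ` arc_into D (cis (next_point k)) \<subseteq> U \<longleftrightarrow> \<not> next_first k"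
    "curve D ` arc_from D (cis (next_point k)) \<subseteq> U \<longleftrightarrow> next_first k"
    "curve D ` arc_into D (cis (prev_point k)) \<subseteq> U \<longleftrightarrow> next_first k"
    "curve D ` arc_from D (cis (prev_point k)) \<subseteq> U \<longleftrightarrow> \<not> next_first k"
proof -
  have only: "u = - r \<or> u = r" "u = r \<or> u = - r"
    if "triangle_line e k u \<in> cball 0 2" "cis (q k u) \<in> crossing_parameters D" for u
    using only_crossings[OF k that] by blast+
  note cr = corner_crossing_parameters[OF k, unfolded next_point_def prev_point_def]
  have "(curve D ` arc_into D (cis (next_point k)) \<subseteq> U \<longleftrightarrow> \<not> next_first k) \<and>
    (curve D ` arc_from D (cis (next_point k)) \<subseteq> U \<longleftrightarrow> next_first k) \<and>
    (curve D ` arc_into D (cis (prev_point k)) \<subseteq> U \<longleftrightarrow> next_first k) \<and>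
    (curve D ` arc_from D (cis (prev_point k)) \<subseteq> U \<longleftrightarrow> \<not> next_first k)"
  proof (cases "next_first k")
    case True
    then have "q k (- r) < q k r" by (simp add: next_first_def next_point_def prev_point_def)
    from strand_sides[OF k corner_disc(2,1) this only(1) cr] True
    show ?thesis unfolding next_point_def prev_point_def by blast
  next
    case False
    then have "q k r < q k (- r)"
      using strand_points(3)[OF k] by (simp add: next_first_def next_point_def prev_point_def)
    from strand_sides[OF k corner_disc(1,2) this only(2) cr(2,1)] False
    show ?thesis unfolding next_point_def prev_point_def by blast
  qed
  then show "curve D ` arc_into D (cis (next_point k)) \<subseteq> U \<longleftrightarrow> \<not> next_first k"
    "curve D ` arc_from D (cis (next_point k)) \<subseteq> U \<longleftrightarrow> next_first k"
    "curve D ` arc_into D (cis (prev_point k)) \<subseteq> U \<longleftrightarrow> next_first k"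
    "curve D ` arc_from D (cis (prev_point k)) \<subseteq> U \<longleftrightarrow> \<not> next_first k" by blast+
qed

text \<open>
  The triangle lies to the left or to the right of a corner iff one of its two sides there arrives and the
  other one leaves.  The side on \<open>i\<close> leaves iff \<open>next_first i\<close>, the side on \<open>j\<close> arrives iff \<open>next_first j\<close>.
\<close>

lemma triangle_sign_corner:
  assumes c: "cyclic3 i j k"
  shows "triangle_sign U D (corner i) = (if next_first i = next_first j then 1 else -1)"
proof -
  note ij = cyclic3_less[OF c]
  have "{arc_into D x, arc_from D y} \<subseteq> {a \<in> arcs D. curve D ` a \<subseteq> U} \<longleftrightarrow>
      curve D ` arc_into D x \<subseteq> U \<and> curve D ` arc_from D y \<subseteq> U" if "x \<in> circle" "y \<in> circle" for x y
    using arc_from_into_in_arcs[OF D] that by simp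
  then show ?thesis
    unfolding triangle_sign_def Let_def arc_SW_def arc_NW_def arc_SE_def arc_NE_def
    using corner_crossing(2,3)[OF c] side_iff[OF ij(1)] side_iff[OF ij(2)]
    by auto
qed

end

section \<open>Left paths and values along a triangle\<close>

text \<open>
  Whether the strands are passed in the cyclic order 0, 1, 2.
\<close>

definition strand_turn :: "(nat \<Rightarrow> real) \<Rightarrow> bool" where
  "strand_turn a \<longleftrightarrow> cis (a 1) \<in> circle_path (cis (a 0)) (cis (a 2))"

context triangle_tangle
begin

abbreviation strand_set :: "nat \<Rightarrow> complex set" where
  "strand_set k \<equiv> cis ` {a k..b k}"

lemma strand_set_connected: "connected (strand_set k)" "strand_set k \<subseteq> circle"
  by (auto intro!: connected_cis_image)

lemma start_in_strand: "k < 3 \<Longrightarrow> cis (a k) \<in> strand_set k"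
  using ab(1)[of k] by auto

lemma strand_starts_distinct: "i < 3 \<Longrightarrow> j < 3 \<Longrightarrow> i \<noteq> j \<Longrightarrow> cis (a i) \<noteq> cis (a j)"
  using disj[of i j] start_in_strand[of i] start_in_strand[of j] by (metis disjoint_iff)

lemma third_strand:
  assumes c: "cyclic3 i j k" and x: "x \<in> strand_set i" and y: "y \<in> strand_set j" and z: "z \<in> strand_set k"
  shows "z \<in> circle_path y x \<longleftrightarrow> strand_turn a" "z \<in> circle_path x y \<longleftrightarrow> \<not> strand_turn a"
proof -
  note lt = cyclic3_less[OF c] and ne = cyclic3_neq[OF c]
  have dis: "strand_set j \<inter> strand_set i = {}" "strand_set k \<inter> strand_set j = {}" "strand_set k \<inter> strand_set i = {}"
    using disj lt ne by metis+
  have zc: "z \<in> circle" "x \<in> circle" "y \<in> circle" using x y z by auto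
  have z': "z \<notin> strand_set j" "z \<notin> strand_set i" using z dis by blast+
  note st = start_in_strand[OF lt(1)] start_in_strand[OF lt(2)] start_in_strand[OF lt(3)]
  have off: "cis (a j) \<notin> strand_set k" "cis (a i) \<notin> strand_set k" using st dis by blast+
  have "z \<in> circle_path y x \<longleftrightarrow> z \<in> circle_path (cis (a j)) (cis (a i))"
    by (rule circle_path_move_endpoints[OF strand_set_connected strand_set_connected dis(1) y st(2) x st(1) zc(1) z'])
  also have "\<dots> \<longleftrightarrow> cis (a k) \<in> circle_path (cis (a j)) (cis (a i))"
    by (rule circle_path_connected[OF _ _ strand_starts_distinct[OF lt(2,1) ne(1)[symmetric]]
          strand_set_connected off z st(3)]) simp_all
  also have "\<dots> \<longleftrightarrow> strand_turn a"
  proof -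
    have "strand_turn a \<longleftrightarrow> cis (a 2) \<in> circle_path (cis (a 1)) (cis (a 0))" unfolding strand_turn_def
      by (rule circle_path_rotate) (simp_all add: strand_starts_distinct)
    moreover have "\<dots> \<longleftrightarrow> cis (a 0) \<in> circle_path (cis (a 2)) (cis (a 1))"
      by (rule circle_path_rotate) (simp_all add: strand_starts_distinct)
    ultimately show ?thesis
      using c unfolding cyclic3_def by (elim disjE conjE) (simp_all only: strand_turn_def)
  qed
  finally show 1: "z \<in> circle_path y x \<longleftrightarrow> strand_turn a" .
  have "x \<noteq> y" "z \<noteq> x" "z \<noteq> y" using x y z dis by blast+
  then show "z \<in> circle_path x y \<longleftrightarrow> \<not> strand_turn a"
    using circle_path_antisym[of x z y] 1 zc by auto
qed

text \<open>
  The left path of a corner runs from strand \<open>j\<close> to strand \<open>i\<close> or from \<open>i\<close> to \<open>j\<close>, according to the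
  orientation of the corner.
\<close>

lemma corner_path_points:
  assumes c: "cyclic3 i j k"
  shows "cis (next_point i) \<notin> left_path D (corner i)" "cis (prev_point j) \<notin> left_path D (corner i)"
    "cis (prev_point i) \<in> left_path D (corner i) \<longleftrightarrow> \<not> next_first j"
    "cis (next_point j) \<in> left_path D (corner i) \<longleftrightarrow> \<not> next_first i"
    "cis (next_point k) \<in> left_path D (corner i) \<longleftrightarrow> strand_turn a = (next_first i = next_first j)"
    "cis (prev_point k) \<in> left_path D (corner i) \<longleftrightarrow> strand_turn a = (next_first i = next_first j)"
proof -
  note lt = cyclic3_less[OF c] and ne = cyclic3_neq[OF c]
  note pi = strand_points[OF lt(1)] and pj = strand_points[OF lt(2)] and pk = strand_points[OF lt(3)]
  have dis: "strand_set j \<inter> strand_set i = {}" using disj lt ne by metis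
  have out: "cis (next_point i) \<notin> strand_set j" "cis (prev_point j) \<notin> strand_set i"
    using pi pj dis by blast+
  note paths = corner_crossing(2,3)[OF c]
  note third = third_strand[OF c pi(4) pj(5) pk(4)] third_strand[OF c pi(4) pj(5) pk(5)]
  note on_i = circle_path_strand_iff[OF pi(1,2,3) ab(2)[OF lt(1)] _ out(2)]
    circle_path_strand_iff[OF pi(2,1) pi(3)[symmetric] ab(2)[OF lt(1)] _ out(2)]
  note on_j = circle_path_strand_iff[OF pj(1,2,3) ab(2)[OF lt(2)] _ out(1)]
    circle_path_strand_iff[OF pj(2,1) pj(3)[symmetric] ab(2)[OF lt(2)] _ out(1)]
  have first: "prev_point l < next_point l \<longleftrightarrow> \<not> next_first l" if "l < 3" for l
    using strand_points(3)[OF that] by (auto simp: next_first_def)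
  note first = first[OF lt(1)] first[OF lt(2)] next_first_def[of i, symmetric] next_first_def[of j, symmetric]
  show "cis (next_point i) \<notin> left_path D (corner i)" "cis (prev_point j) \<notin> left_path D (corner i)"
    unfolding paths by simp_all
  show "cis (prev_point i) \<in> left_path D (corner i) \<longleftrightarrow> \<not> next_first j"
    "cis (next_point j) \<in> left_path D (corner i) \<longleftrightarrow> \<not> next_first i"
    unfolding paths using on_i on_j first by auto
  show "cis (next_point k) \<in> left_path D (corner i) \<longleftrightarrow> strand_turn a = (next_first i = next_first j)"
    "cis (prev_point k) \<in> left_path D (corner i) \<longleftrightarrow> strand_turn a = (next_first i = next_first j)"
    unfolding paths using third by auto
qed

lemma corner_path_outer:
  assumes c: "cyclic3 i j k" and z: "z \<in> circle" "z \<notin> strand_parameters"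
  shows "z \<in> left_path D (corner i) \<longleftrightarrow>
    (z \<in> circle_path (cis (a j)) (cis (a i))) = (next_first i = next_first j)"
proof -
  note lt = cyclic3_less[OF c] and ne = cyclic3_neq[OF c]
  note pi = strand_points[OF lt(1)] and pj = strand_points[OF lt(2)]
  note st = start_in_strand[OF lt(1)] start_in_strand[OF lt(2)]
  have dis: "strand_set j \<inter> strand_set i = {}" "strand_set i \<inter> strand_set j = {}"
    using disj lt ne by metis+
  have z': "z \<notin> strand_set i" "z \<notin> strand_set j" using z lt by blast+
  have ji: "z \<in> circle_path (cis (prev_point j)) (cis (next_point i)) \<longleftrightarrow> z \<in> circle_path (cis (a j)) (cis (a i))"
    by (rule circle_path_move_endpoints[OF strand_set_connected strand_set_connected dis(1) pj(5) st(2) pi(4) st(1) z(1) z'(2,1)])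
  have "cis (next_point i) \<noteq> cis (prev_point j)" using pi pj dis by blast
  moreover have "z \<noteq> cis (next_point i)" "z \<noteq> cis (prev_point j)" using z' pi pj by blast+
  ultimately have "z \<in> circle_path (cis (next_point i)) (cis (prev_point j))
      \<longleftrightarrow> z \<notin> circle_path (cis (prev_point j)) (cis (next_point i))"
    using circle_path_antisym[of "cis (next_point i)" z "cis (prev_point j)"] z(1) by auto
  then show ?thesis unfolding corner_crossing(2,3)[OF c] using ji by simp
qed

lemma crossing_of_strands:
  assumes c: "cyclic3 i j k" and v: "v \<in> curve D ` strand_set i" "v \<in> curve D ` strand_set j"
  shows "v = corner i"
proof -
  note lt = cyclic3_less[OF c] and ne = cyclic3_neq[OF c]
  obtain t t' where t: "t \<in> {a i..b i}" "v = curve D (cis t)" "t' \<in> {a j..b j}" "v = curve D (cis t')"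
    using v by blast
  obtain s where s: "triangle_line e i s \<in> cball 0 2" "q i s = t" using q_surj[OF lt(1) t(1)] by blast
  obtain s' where s': "triangle_line e j s' \<in> cball 0 2" "q j s' = t'" using q_surj[OF lt(2) t(3)] by blast
  have eq: "v = h (triangle_line e i s)" "v = h (triangle_line e j s')"
    using q_curve[OF lt(1) s(1)] q_curve[OF lt(2) s'(1)] s s' t by simp_all
  then have "triangle_line e i s = triangle_line e j s'" using inj by (simp add: inj_eq)
  then have "s = - r" using triangle_line_eq[OF c] by (simp add: r_def)
  then show ?thesis using eq(1) by (simp add: corner_def)
qed

text \<open>
  By the conservation of the flow at the corners, the values of a cycle along the strands are determined
  by those at the starts and by the changes at the crossings with the successors.
\<close>

definition start_value :: "(complex set \<Rightarrow> 'b::ab_group_add) \<Rightarrow> nat \<Rightarrow> 'b" where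
  "start_value d k = d (arc_into D (cis (a k)))"

definition jump :: "(complex set \<Rightarrow> 'b::ab_group_add) \<Rightarrow> nat \<Rightarrow> 'b" where
  "jump d k = d (arc_from D (cis (next_point k))) - d (arc_into D (cis (next_point k)))"

lemma corner_conservation:
  assumes d: "d \<in> cycles D" and c: "cyclic3 i j k"
  shows "d (arc_from D (cis (prev_point j))) = d (arc_into D (cis (prev_point j))) - jump d i"
proof -
  have "corner i \<in> classical D" using corner_crossing(1)[OF c] by blast
  then have "d (arc_SW D (corner i)) + d (arc_SE D (corner i)) = d (arc_NW D (corner i)) + d (arc_NE D (corner i))"
    using d unfolding cycles_def by blast
  then show ?thesis
    unfolding arc_SW_def arc_SE_def arc_NW_def arc_NE_def corner_crossing(2,3)[OF c] jump_def
    by (cases "next_first i = next_first j") (simp_all add: algebra_simps)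
qed

lemma corner_values:
  assumes d: "d \<in> cycles D" and c: "cyclic3 i j k"
  shows "d (arc_into D (cis (next_point i))) = (if next_first i then start_value d i else start_value d i - jump d k)"
    "d (arc_into D (cis (prev_point i))) = (if next_first i then start_value d i + jump d i else start_value d i)"
    "d (arc_from D (cis (b i))) = start_value d i + jump d i - jump d k"
proof -
  have c': "cyclic3 k i j" using c by (auto simp: cyclic3_def)
  note cons = corner_conservation[OF d c']
  have J: "d (arc_from D (cis (next_point i))) = d (arc_into D (cis (next_point i))) + jump d i"
    by (simp add: jump_def)
  have "d (arc_into D (cis (next_point i))) = (if next_first i then start_value d i else start_value d i - jump d k)
    \<and> d (arc_into D (cis (prev_point i))) = (if next_first i then start_value d i + jump d i else start_value d i)
    \<and> d (arc_from D (cis (b i))) = start_value d i + jump d i - jump d k"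
    using strand_arcs[OF cyclic3_less(1)[OF c]] cons J
    by (cases "next_first i") (simp_all add: start_value_def algebra_simps)
  then show "d (arc_into D (cis (next_point i))) = (if next_first i then start_value d i else start_value d i - jump d k)"
    "d (arc_into D (cis (prev_point i))) = (if next_first i then start_value d i + jump d i else start_value d i)"
    "d (arc_from D (cis (b i))) = start_value d i + jump d i - jump d k" by blast+
qed

lemma flux_corner:
  assumes d: "d \<in> cycles D" and c: "cyclic3 i j k"
  shows "flux D d I (corner i) = corner_flux (next_first i) (next_first j)
    (cis (next_point i) \<in> I) (cis (prev_point j) \<in> I) (start_value d i) (start_value d j)
    (jump d k) (jump d i) (jump d j)"
proof -
  have c': "cyclic3 j k i" using c by (auto simp: cyclic3_def)
  have J: "d (arc_from D (cis (next_point i))) = d (arc_into D (cis (next_point i))) + jump d i"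
    by (simp add: jump_def)
  show ?thesis
    unfolding flux_def arc_NW_def arc_SW_def corner_crossing(2,3)[OF c] corner_flux_def Let_def
    using corner_values(1)[OF d c] corner_values(2)[OF d c'] corner_conservation[OF d c] J
    by (cases "next_first i = next_first j") simp_all
qed

lemma inner_flux:
  assumes d: "d \<in> cycles D"
  shows "(\<Sum>w\<in>classical D \<inter> U. flux D d I w) = triangle_flux next_first
    (\<lambda>k. cis (next_point k) \<in> I) (\<lambda>k. cis (prev_point k) \<in> I) (start_value d) (jump d)"
proof -
  have "corner 0 \<noteq> corner 1" "corner 0 \<noteq> corner 2" "corner 1 \<noteq> corner 2"
    using corner_inj[of 0 1] corner_inj[of 0 2] corner_inj[of 1 2] by auto
  then have "(\<Sum>w\<in>classical D \<inter> U. flux D d I w)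
      = flux D d I (corner 0) + flux D d I (corner 1) + flux D d I (corner 2)"
    unfolding classical_inside by (simp add: add.assoc)
  then show ?thesis
    using flux_corner[OF d, of 0 1 2 I] flux_corner[OF d, of 1 2 0 I] flux_corner[OF d, of 2 0 1 I]
    by (simp add: triangle_flux_def cyclic3_def)
qed

text \<open>
  Since \<open>d\<close> is normalized, complementary sets of parameters have opposite sums of fluxes, so the term of
  a corner with negative sign is the sum for the complement of its left path.  Off the strands, the
  resulting set of the corner of \<open>i\<close> and \<open>j\<close> is the path from strand \<open>j\<close> to strand \<open>i\<close> for either sign.
\<close>

lemma triangle_relation:
  assumes d: "d \<in> cycles D" and norm: "normalized D d"
  shows "(\<Sum>v\<in>classical D \<inter> U. int_scale (triangle_sign U D v) (intersection_number D (left_half D v) d)) = 0"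
proof -
  define F where "F I = (\<Sum>w\<in>classical D. flux D d I w)" for I
  define out where "out I = (\<Sum>w\<in>classical D - U. flux D d I w)" for I
  define inn where "inn I = (\<Sum>w\<in>classical D \<inter> U. flux D d I w)" for I
  have F: "F I = out I + inn I" for I unfolding F_def out_def inn_def by (rule flux_sum_split[OF D])
  have F_UNIV: "F UNIV = 0" using norm unfolding normalized_iff_flux[OF D] F_def .
  have F_Compl: "F (- I) = - F I" for I
  proof -
    have "F I + F (- I) = F UNIV" unfolding F_def by (simp add: sum.distrib[symmetric] flux_Compl)
    then show ?thesis using F_UNIV by (metis add.inverse_unique)
  qed
  define K where "K i = (if next_first i = next_first ((i + 1) mod 3) then left_path D (corner i)
      else - left_path D (corner i))" for i
  have K: "K i = (if next_first i = next_first j then left_path D (corner i) else - left_path D (corner i))"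
    if "cyclic3 i j k" for i j k
  proof -
    have eq: "(i + 1) mod 3 = j" using that unfolding cyclic3_def by (elim disjE conjE) simp_all
    show ?thesis unfolding K_def eq ..
  qed
  have signed_parity: "int_scale (triangle_sign U D (corner i)) (intersection_number D (left_half D (corner i)) d) = F (K i)"
    if c: "cyclic3 i j k" for i j k
  proof -
    have "corner i \<in> classical D" using corner_crossing(1)[OF c] by blast
    from intersection_left_half[OF D this, of d]
    have "intersection_number D (left_half D (corner i)) d = F (left_path D (corner i))" by (simp add: F_def)
    then show ?thesis using triangle_sign_corner[OF c] K[OF c] F_Compl by simp
  qed
  have "corner 0 \<noteq> corner 1" "corner 0 \<noteq> corner 2" "corner 1 \<noteq> corner 2"
    using corner_inj[of 0 1] corner_inj[of 0 2] corner_inj[of 1 2] by auto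
  then have "(\<Sum>v\<in>classical D \<inter> U. int_scale (triangle_sign U D v) (intersection_number D (left_half D v) d))
      = F (K 0) + F (K 1) + F (K 2)"
    unfolding classical_inside using signed_parity[of 0 1 2] signed_parity[of 1 2 0] signed_parity[of 2 0 1]
    by (simp add: cyclic3_def add.assoc)
  also have "\<dots> = (out (K 0) + out (K 1) + out (K 2)) + (inn (K 0) + inn (K 1) + inn (K 2))"
    by (simp add: F add_ac)
  also have "out (K 0) + out (K 1) + out (K 2) = (if strand_turn a then out UNIV + out UNIV else out UNIV)"
  proof -
    have gap: "z \<in> K i \<longleftrightarrow> z \<in> circle_path (cis (a j)) (cis (a i))"
      if c: "cyclic3 i j k" and z: "z \<in> circle" "z \<notin> strand_parameters" for i j k z
      using corner_path_outer[OF c z] K[OF c] by auto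
    have count: "if strand_turn a then z \<notin> K 0 \<and> z \<in> K 1 \<and> z \<in> K 2 \<or> z \<in> K 0 \<and> z \<notin> K 1 \<and> z \<in> K 2 \<or> z \<in> K 0 \<and> z \<in> K 1 \<and> z \<notin> K 2
       else z \<in> K 0 \<and> z \<notin> K 1 \<and> z \<notin> K 2 \<or> z \<notin> K 0 \<and> z \<in> K 1 \<and> z \<notin> K 2 \<or> z \<notin> K 0 \<and> z \<notin> K 1 \<and> z \<in> K 2"
      if z: "z \<in> circle" "z \<notin> strand_parameters" for z
    proof -
      let ?x = "cis (a 0)" and ?y = "cis (a 1)" and ?w = "cis (a 2)"
      have ne: "?x \<noteq> ?y" "?y \<noteq> ?w" "?x \<noteq> ?w" using strand_starts_distinct by simp_all
      have "z \<noteq> cis (a k)" if "k < 3" for k using start_in_strand[OF that] z(2) that by blast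
      then have zne: "z \<noteq> ?x" "z \<noteq> ?y" "z \<noteq> ?w" by simp_all
      note g = gap[of 0 1 2, OF _ z] gap[of 1 2 0, OF _ z] gap[of 2 0 1, OF _ z]
      have anti: "z \<in> circle_path ?x ?y \<longleftrightarrow> z \<notin> circle_path ?y ?x"
        "z \<in> circle_path ?y ?w \<longleftrightarrow> z \<notin> circle_path ?w ?y"
        "z \<in> circle_path ?w ?x \<longleftrightarrow> z \<notin> circle_path ?x ?w"
        by (rule circle_path_antisym; use ne zne z in auto)+
      show ?thesis
      proof (cases "strand_turn a")
        case True
        then have "?y \<in> circle_path ?x ?w" by (simp add: strand_turn_def)
        from circle_path_three[OF _ _ _ z(1) ne zne this] show ?thesis
          using g anti True by (auto simp: cyclic3_def)
      next
        case False
        then have "?y \<in> circle_path ?w ?x"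
          using circle_path_antisym[of ?w ?y ?x] ne by (auto simp: strand_turn_def)
        from circle_path_three[OF _ _ _ z(1) ne(2)[symmetric] ne(1)[symmetric] ne(3)[symmetric] zne(3,2,1) this]
        show ?thesis using g anti False by (auto simp: cyclic3_def)
      qed
    qed
    have all_three: "flux D d (K 0) w + flux D d (K 1) w + flux D d (K 2) w
        = (if strand_turn a then flux D d UNIV w + flux D d UNIV w else flux D d UNIV w)"
      if w: "w \<in> classical D - U" for w
    proof -
      have wD: "w \<in> classical D" using w by blast
      note cr = classical_crossing[OF D wD]
      have "to_NE D w \<notin> strand_parameters" "to_NW D w \<notin> strand_parameters"
        unfolding inside[symmetric] using cr w by auto
      then show ?thesis using count[OF cr(1)] count[OF cr(2)] unfolding flux_def
        by (auto simp: algebra_simps)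
    qed
    have "out (K 0) + out (K 1) + out (K 2)
        = (\<Sum>w\<in>classical D - U. if strand_turn a then flux D d UNIV w + flux D d UNIV w else flux D d UNIV w)"
      unfolding out_def sum.distrib[symmetric] by (rule sum.cong[OF refl all_three])
    then show ?thesis by (simp add: out_def sum.distrib)
  qed
  also have "inn (K 0) + inn (K 1) + inn (K 2) = (if strand_turn a then inn UNIV + inn UNIV else inn UNIV)"
  proof -
    have "(cis (next_point i) \<in> K i \<longleftrightarrow> next_first i \<noteq> next_first j) \<and>
      (cis (prev_point j) \<in> K i \<longleftrightarrow> next_first i \<noteq> next_first j) \<and>
      (cis (prev_point i) \<in> K i \<longleftrightarrow> \<not> next_first i) \<and> (cis (next_point j) \<in> K i \<longleftrightarrow> \<not> next_first j) \<and>
      (cis (next_point k) \<in> K i \<longleftrightarrow> strand_turn a) \<and> (cis (prev_point k) \<in> K i \<longleftrightarrow> strand_turn a)"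
      if c: "cyclic3 i j k" for i j k
      using corner_path_points[OF c] K[OF c] by auto
    note sum3 = triangle_flux_sum[where \<tau> = next_first and p = "\<lambda>i k. cis (next_point k) \<in> K i"
        and n = "\<lambda>i k. cis (prev_point k) \<in> K i" and \<omega> = "strand_turn a", OF this]
    show ?thesis by (simp only: inn_def inner_flux[OF d] UNIV_I sum3)
  qed
  also have "(if strand_turn a then out UNIV + out UNIV else out UNIV) + (if strand_turn a then inn UNIV + inn UNIV else inn UNIV)
      = (if strand_turn a then F UNIV + F UNIV else F UNIV)"
    by (simp add: F add_ac)
  finally show ?thesis using F_UNIV by simp
qed

end

text \<open>
  The values before and after each strand are not affected by the move.  Hence the differences of
  consecutive jumps are preserved, and all jumps change by the same constant.
\<close>

lemma R3_parity:
  assumes R3: "R3 U D D' f"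
    and corr: "\<And>a a'. (a, a') \<in> correspondent_arcs U D D' \<Longrightarrow> d a = d' a'"
    and d: "d \<in> cycles D" and d': "d' \<in> cycles D'"
  shows "v \<in> classical D - U \<Longrightarrow>
      intersection_number D (left_half D v) d = intersection_number D' (left_half D' v) d'"
    and "(v, v') \<in> f \<Longrightarrow>
      intersection_number D (left_half D v) d = intersection_number D' (left_half D' v') d'"
    and "normalized D d \<Longrightarrow>
      (\<Sum>v\<in>classical D \<inter> U. int_scale (triangle_sign U D v) (intersection_number D (left_half D v) d)) = 0"
proof -
  let ?m' = "\<lambda>(k::nat) (s::real). cis (2 * pi * real k / 3)"
  obtain h h1 a b \<sigma> where U: "U = h ` cball 0 2" "U = h1 ` cball 0 2"
    and t: "tangle D h 3 a b \<sigma> (triangle_line 1)" "tangle D' h1 3 a b \<sigma> (triangle_line (-1))"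
    and f: "f = {(v, v'). \<exists>i<3. \<exists>j<3. i \<noteq> j \<and>
              v \<in> curve D ` cis ` {a i..b i} \<inter> curve D ` cis ` {a j..b j} \<and>
              v' \<in> curve D' ` cis ` {a i..b i} \<inter> curve D' ` cis ` {a j..b j}}"
    using R3 unfolding R3_def by (elim exE conjE) (rule that)
  have D: "is_diagram D" and D': "is_diagram D'" and same: "same_outside U D D'"
    and double: "double_points D \<inter> U \<subseteq> classical D" "double_points D' \<inter> U \<subseteq> classical D'"
    using R3 unfolding R3_def by simp_all
  obtain q q1 where "tangle_change U D D' 3 a b d d' h \<sigma> (triangle_line 1) ?m' q h1 (triangle_line (-1)) ?m' q1"
    by (rule tangle_changeI[OF D D' same U t triangle_line_deriv triangle_line_deriv corr])
  then interpret tangle_change U D D' 3 a b d d' h \<sigma> "triangle_line 1" ?m' q h1 "triangle_line (-1)" ?m' q1 .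
  interpret T: triangle_tangle D U h a b \<sigma> 1 q by unfold_locales (use double in auto)
  interpret T': triangle_tangle D' U h1 a b \<sigma> "-1" q1 by unfold_locales (use double in auto)
  have first: "T'.next_first k \<longleftrightarrow> \<not> T.next_first k" if "k < 3" for k
    using T.next_first_iff[OF that] T'.next_first_iff[OF that] old.sgn[OF that] by auto
  have start: "T'.start_value d' k = T.start_value d k" if "k < 3" for k
    unfolding T.start_value_def T'.start_value_def using strand_ends(1)[OF that] by simp
  have "T'.jump d' i - T.jump d i = T'.jump d' k - T.jump d k" if c: "cyclic3 i j k" for i j k
    using strand_ends(2)[OF cyclic3_less(1)[OF c]] T.corner_values(3)[OF d c] T'.corner_values(3)[OF d' c]
      start[OF cyclic3_less(1)[OF c]] by (simp add: algebra_simps)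
  from this[of 0 1 2] this[of 1 2 0]
  have jumps: "T'.jump d' 0 - T.jump d 0 = T'.jump d' 2 - T.jump d 2"
    "T'.jump d' 1 - T.jump d 1 = T'.jump d' 0 - T.jump d 0" by (simp_all add: cyclic3_def)
  define c where "c = T'.jump d' 0 - T.jump d 0"
  have jump: "T'.jump d' k = T.jump d k + c" if "k < 3" for k
  proof -
    have "k = 0 \<or> k = 1 \<or> k = 2" using that by auto
    moreover have "T'.jump d' 0 - T.jump d 0 = c" "T'.jump d' 1 - T.jump d 1 = c"
      "T'.jump d' 2 - T.jump d 2 = c"
      using jumps by (simp_all add: c_def)
    ultimately show ?thesis unfolding diff_eq_eq by (auto simp: add.commute)
  qed
  have start_eq: "triangle_flux \<tau> p n (T'.start_value d') J = triangle_flux \<tau> p n (T.start_value d) J" for \<tau> p n J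
    unfolding triangle_flux_def using start[of 0] start[of 1] start[of 2] by simp
  { assume v: "v \<in> classical D - U"
    then have v': "v \<in> classical D'" using classical_eq by blast
    note mem = outer_crossing_path(2)[OF v]
    have "(\<Sum>w\<in>classical D \<inter> U. flux D d (left_path D v) w) = (\<Sum>w\<in>classical D' \<inter> U. flux D' d' (left_path D' v) w)"
      unfolding T.inner_flux[OF d] T'.inner_flux[OF d'] start_eq outer_crossing_path(1)[OF v]
    proof (rule triangle_flux_strands[where s = "\<lambda>k. cis (a k) \<in> left_path D v" and c = c])
      fix k :: nat assume k: "k < 3"
      note st = T.start_in_strand[OF k]
      show "cis (T.next_point k) \<in> left_path D v \<longleftrightarrow> cis (a k) \<in> left_path D v"
        by (rule mem[OF k T.strand_points(4)[OF k] st])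
      show "cis (T.prev_point k) \<in> left_path D v \<longleftrightarrow> cis (a k) \<in> left_path D v"
        by (rule mem[OF k T.strand_points(5)[OF k] st])
      show "cis (T'.next_point k) \<in> left_path D v \<longleftrightarrow> cis (a k) \<in> left_path D v"
        by (rule mem[OF k T'.strand_points(4)[OF k] st])
      show "cis (T'.prev_point k) \<in> left_path D v \<longleftrightarrow> cis (a k) \<in> left_path D v"
        by (rule mem[OF k T'.strand_points(5)[OF k] st])
    qed (use jump first in auto)
    then show "intersection_number D (left_half D v) d = intersection_number D' (left_half D' v) d'"
      using v v' outer_crossing_path(1)[OF v] by (intro intersection_eqI) simp_all }
  { assume "(v, v') \<in> f"
    then obtain i j where ij: "i < 3" "j < 3" "i \<noteq> j"
      "v \<in> curve D ` cis ` {a i..b i}" "v \<in> curve D ` cis ` {a j..b j}"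
      "v' \<in> curve D' ` cis ` {a i..b i}" "v' \<in> curve D' ` cis ` {a j..b j}"
      unfolding f by blast
    then have "\<exists>i j k. cyclic3 i j k \<and> v = T.corner i \<and> v' = T'.corner i"
      using cyclic3_exhaust[OF ij(1-3)] T.crossing_of_strands T'.crossing_of_strands by metis
    then obtain i j k where c: "cyclic3 i j k" and vv: "v = T.corner i" "v' = T'.corner i" by blast
    have "(\<Sum>w\<in>classical D \<inter> U. flux D d (left_path D v) w) = (\<Sum>w\<in>classical D' \<inter> U. flux D' d' (left_path D' v') w)"
      unfolding T.inner_flux[OF d] T'.inner_flux[OF d'] start_eq
      by (rule triangle_flux_corner[where A = i and B = j and C = k and c = c
            and \<omega> = "strand_turn a = (T.next_first i = T.next_first j)"])
        (use c T.corner_path_points[OF c] T'.corner_path_points[OF c] jump first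
          cyclic3_less[OF c] in \<open>simp_all add: vv\<close>)
    moreover have "z \<in> left_path D v \<longleftrightarrow> z \<in> left_path D' v'"
      if z: "z \<in> circle" "z \<notin> old.strand_parameters" for z
      unfolding vv T.corner_path_outer[OF c z] T'.corner_path_outer[OF c z]
      using first cyclic3_less[OF c] by simp
    ultimately show "intersection_number D (left_half D v) d = intersection_number D' (left_half D' v') d'"
      using T.corner_crossing(1)[OF c] T'.corner_crossing(1)[OF c] unfolding vv
      by (intro intersection_eqI) simp_all }
  show "normalized D d \<Longrightarrow>
      (\<Sum>v\<in>classical D \<inter> U. int_scale (triangle_sign U D v) (intersection_number D (left_half D v) d)) = 0"
    by (rule T.triangle_relation[OF d])
qed

section \<open>The oriented parity of an invariant normalized cycle\<close>

theorem theorem2: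
  fixes K :: "vdiagram set"
    and \<delta> :: "vdiagram \<Rightarrow> complex set \<Rightarrow> 'a::ab_group_add"
  assumes "is_virtual_knot K"
    and "\<And>D. D \<in> K \<Longrightarrow> \<delta> D \<in> cycles D"
    and "invariant_chain K \<delta>"
    and "\<And>D. D \<in> K \<Longrightarrow> normalized D (\<delta> D)"
  shows "oriented_parity K (\<lambda>D v. intersection_number D (left_half D v) (\<delta> D))"
proof -
  let ?p = "\<lambda>D v. intersection_number D (left_half D v) (\<delta> D)"
  have inv: "\<delta> D a = \<delta> D' a'" if "D \<in> K" "D' \<in> K" "move D D' f r" "(a, a') \<in> r" for D D' f r a a'
    using assms(3) that unfolding invariant_chain_def by blast
  have classical_U: "classical D' - U = classical D - U" if "same_outside U D D'" for D D' U
    using that unfolding same_outside_def by simp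
  have P0: "?p D v = ?p D' v'" if K: "D \<in> K" "D' \<in> K" and mv: "move D D' f r" and vv: "(v, v') \<in> f"
    for D D' f r v v'
    using mv
  proof cases
    case (isotopy \<Phi> \<rho>)
    have "\<delta> D a = \<delta> D' (\<rho> ` a)" if "a \<in> arcs D" for a
      by (rule inv[OF K mv]) (use isotopy(2) that in blast)
    moreover have "v \<in> classical D" "v' = \<Phi> 1 v" using vv isotopy(1) by blast+
    ultimately show ?thesis using isotopy_intersection[OF isotopy(3-8), of "\<delta> D" "\<delta> D'" v] by simp
  next
    case (detour p q)
    have "\<delta> D a = \<delta> D' a" if "a \<in> arcs D" for a
      by (rule inv[OF K mv]) (use detour(2) that in blast)
    moreover have "v \<in> classical D" "v' = v" using vv detour(1) by blast+
    ultimately show ?thesis using detour_intersection[OF detour(3-9), of "\<delta> D" "\<delta> D'" v] by simp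
  next
    case (R1_decreasing U)
    have "\<delta> D a = \<delta> D' a'" if "(a, a') \<in> correspondent_arcs U D D'" for a a'
      using inv[OF K mv] that R1_decreasing(2) by simp
    moreover have "v \<in> classical D - U" "v' = v" using vv R1_decreasing(1) by blast+
    ultimately show ?thesis using R1_parity(1)[OF R1_decreasing(3), of "\<delta> D" "\<delta> D'" v] by simp
  next
    case (R1_increasing U)
    \<comment> \<open>the inverse move is decreasing and preserves the values of the cycle as well\<close>
    have "\<delta> D' a = \<delta> D a'" if "(a, a') \<in> correspondent_arcs U D' D" for a a'
      using inv[OF K(2,1) move.R1_decreasing[OF R1_increasing(3)] that] .
    moreover have "same_outside U D' D" using R1_increasing(3) unfolding decreasing_R1_def by simp
    then have "v \<in> classical D' - U" "v' = v"
      using vv R1_increasing(1) classical_U[of U D' D] by auto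
    ultimately show ?thesis using R1_parity(1)[OF R1_increasing(3), of "\<delta> D'" "\<delta> D" v] by simp
  next
    case (R2_decreasing U)
    have "\<delta> D a = \<delta> D' a'" if "(a, a') \<in> correspondent_arcs U D D'" for a a'
      using inv[OF K mv] that R2_decreasing(2) by simp
    moreover have "v \<in> classical D - U" "v' = v" using vv R2_decreasing(1) by blast+
    ultimately show ?thesis using R2_parity(1)[OF R2_decreasing(3), of "\<delta> D" "\<delta> D'" v] by simp
  next
    case (R2_increasing U)
    have "\<delta> D' a = \<delta> D a'" if "(a, a') \<in> correspondent_arcs U D' D" for a a'
      using inv[OF K(2,1) move.R2_decreasing[OF R2_increasing(3)] that] .
    moreover have "same_outside U D' D" using R2_increasing(3) unfolding decreasing_R2_def by simp
    then have "v \<in> classical D' - U" "v' = v"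
      using vv R2_increasing(1) classical_U[of U D' D] by auto
    ultimately show ?thesis using R2_parity(1)[OF R2_increasing(3), of "\<delta> D'" "\<delta> D" v] by simp
  next
    case (R3 U g)
    have corr: "\<delta> D a = \<delta> D' a'" if "(a, a') \<in> correspondent_arcs U D D'" for a a'
      using inv[OF K mv] that R3(2) by simp
    note par = R3_parity[OF R3(3) corr assms(2)[OF K(1)] assms(2)[OF K(2)]]
    show ?thesis using vv R3(1) par(1)[of v] par(2)[of v v'] by auto
  qed
  have P1: "?p D v = 0" if K: "D \<in> K" "D' \<in> K" and R1: "decreasing_R1 U D D'" and v: "v \<in> classical D \<inter> U" for D D' U v
    by (rule R1_parity(2)[OF R1 inv[OF K move.R1_decreasing[OF R1]] v assms(4)[OF K(1)]])
  have P2: "?p D v1 + ?p D v2 = 0" if K: "D \<in> K" "D' \<in> K" and R2: "decreasing_R2 U D D'"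
    and v: "v1 \<noteq> v2" "classical D \<inter> U = {v1, v2}" for D D' U v1 v2
    by (rule R2_parity(2)[OF R2 inv[OF K move.R2_decreasing[OF R2]] assms(4)[OF K(1)] v])
  have P3: "(\<Sum>v\<in>classical D \<inter> U. int_scale (triangle_sign U D v) (?p D v)) = 0"
    if K: "D \<in> K" "D' \<in> K" and R3: "R3 U D D' f" for D D' U f
    by (rule R3_parity(3)[OF R3 inv[OF K move.R3[OF R3]] assms(2)[OF K(1)] assms(2)[OF K(2)] assms(4)[OF K(1)]])
  show ?thesis
    unfolding oriented_parity_def using P0 P1 P2 P3 by blast
qed

end
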